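(* Let $M$ be a monoid whose minimal ideal $K$ is a rectangular band and let $N$ be any monoid. Let $S$ be the submonoid $(M\times\{1\})\cup (K\times N)$ of $M\times N$. Then $BS$ is homotopy equivalent to the wedge sum $BM\vee BN$. Moreover, if $N$ has a minimal ideal $J$, then $S$ has minimal ideal $K\times J$; and $S$ is finite if $M$ and $N$ are finite.
   Context: An ideal of a semigroup $S$ is a nonempty subset $I$ with $SI\cup IS\subseteq I$; the minimal ideal of $S$, if it exists, is the unique ideal contained in every ideal. A rectangular band is a semigroup in which every element is idempotent and the identity $xyx=x$ holds; equivalently, it is isomorphic to $A\times B$ with $A,B$ nonempty sets and product $(a,b)(a',b')=(a,b')$. For a semigroup (in particular, a monoid) $S$, the classifying space $BS$ is the geometric realization of the $\Delta$-set (semisimplicial set) whose set of $q$-simplices is $S^q$, with face maps $d_0(s_1,\ldots,s_q)=(s_2,\ldots,s_q)$, $d_i(s_1,\ldots,s_q)=(s_1,\ldots,s_{i-1},s_is_{i+1},s_{i+2},\ldots,s_q)$ for $1\leq i\leq q-1$, and $d_q(s_1,\ldots,s_q)=(s_1,\ldots,s_{q-1})$; for a monoid this is homotopy equivalent to the geometric realization of its nerve as a simplicial set. The wedge sum is formed at the unique vertices of $BM$ and $BN$. *)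

theory Defs
  imports "HOL-Homology.Simplices" "HOL-Algebra.Group"
begin

section \<open>Ideals and rectangular bands\<close>

text \<open>
  Semigroups are represented by HOL-Algebra records of which only \<open>carrier\<close> and \<open>mult\<close> are used.
\<close>

definition semigroup_ideal :: "('a, 'm) monoid_scheme \<Rightarrow> 'a set \<Rightarrow> bool" where
  "semigroup_ideal S I \<longleftrightarrow>
     I \<subseteq> carrier S \<and> I \<noteq> {} \<and>
     (\<forall>s\<in>carrier S. \<forall>x\<in>I. s \<otimes>\<^bsub>S\<^esub> x \<in> I \<and> x \<otimes>\<^bsub>S\<^esub> s \<in> I)"

definition minimal_ideal :: "('a, 'm) monoid_scheme \<Rightarrow> 'a set \<Rightarrow> bool" where
  "minimal_ideal S K \<longleftrightarrow> semigroup_ideal S K \<and> (\<forall>I. semigroup_ideal S I \<longrightarrow> K \<subseteq> I)"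

definition rectangular_band :: "('a, 'm) monoid_scheme \<Rightarrow> bool" where
  "rectangular_band B \<longleftrightarrow>
     carrier B \<noteq> {} \<and>
     (\<forall>x\<in>carrier B. \<forall>y\<in>carrier B. x \<otimes>\<^bsub>B\<^esub> y \<in> carrier B) \<and>
     (\<forall>x\<in>carrier B. \<forall>y\<in>carrier B. \<forall>z\<in>carrier B.
        (x \<otimes>\<^bsub>B\<^esub> y) \<otimes>\<^bsub>B\<^esub> z = x \<otimes>\<^bsub>B\<^esub> (y \<otimes>\<^bsub>B\<^esub> z)) \<and>
     (\<forall>x\<in>carrier B. x \<otimes>\<^bsub>B\<^esub> x = x) \<and>
     (\<forall>x\<in>carrier B. \<forall>y\<in>carrier B. (x \<otimes>\<^bsub>B\<^esub> y) \<otimes>\<^bsub>B\<^esub> x = x)"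

lemma submonoid_DirProd_ideal:
  assumes "monoid M" "monoid N" "semigroup_ideal M K"
  shows "submonoid (carrier M \<times> {\<one>\<^bsub>N\<^esub>} \<union> K \<times> carrier N) (M \<times>\<times> N)"
proof -
  interpret M: monoid M by fact
  interpret N: monoid N by fact
  show ?thesis
    using assms(3) by unfold_locales (auto simp: semigroup_ideal_def)
qed


section \<open>Quotient spaces and wedge sums\<close>

text \<open>
  The quotient of \<open>X\<close> by the equivalence relation generated by \<open>R\<close>, where \<open>R\<close> is meant to relate
  points of \<open>X\<close> only. Points of the quotient are equivalence classes.
\<close>

definition glue_class :: "('a \<Rightarrow> 'a \<Rightarrow> bool) \<Rightarrow> 'a \<Rightarrow> 'a set" where
  "glue_class R x = {y. equivclp R x y}"

definition quotient_topology :: "'a topology \<Rightarrow> ('a \<Rightarrow> 'a \<Rightarrow> bool) \<Rightarrow> 'a set topology" where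
  "quotient_topology X R =
     topology (\<lambda>U. U \<subseteq> glue_class R ` topspace X \<and>
                   openin X {x \<in> topspace X. glue_class R x \<in> U})"

lemma openin_quotient_topology:
  "openin (quotient_topology X R) U \<longleftrightarrow>
     U \<subseteq> glue_class R ` topspace X \<and> openin X {x \<in> topspace X. glue_class R x \<in> U}"
proof -
  have *: "{x \<in> topspace X. f x \<in> S \<inter> T} = {x \<in> topspace X. f x \<in> S} \<inter> {x \<in> topspace X. f x \<in> T}"
    "{x \<in> topspace X. f x \<in> \<Union>\<K>} = (\<Union>S\<in>\<K>. {x \<in> topspace X. f x \<in> S})"
    for S T \<K> and f :: "'a \<Rightarrow> 'a set" by auto
  have "istopology (\<lambda>U. U \<subseteq> glue_class R ` topspace X \<and>
                        openin X {x \<in> topspace X. glue_class R x \<in> U})"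
    unfolding istopology_def * by blast
  then show ?thesis
    by (simp add: quotient_topology_def)
qed

lemma topspace_quotient_topology:
  "topspace (quotient_topology X R) = glue_class R ` topspace X"
proof -
  have "{x \<in> topspace X. glue_class R x \<in> glue_class R ` topspace X} = topspace X"
    by auto
  then have "openin (quotient_topology X R) (glue_class R ` topspace X)"
    by (simp add: openin_quotient_topology)
  then have "glue_class R ` topspace X \<subseteq> topspace (quotient_topology X R)"
    by (rule openin_subset)
  moreover have "topspace (quotient_topology X R) \<subseteq> glue_class R ` topspace X"
    using openin_topspace [of "quotient_topology X R"]
    by (simp only: openin_quotient_topology)
  ultimately show ?thesis
    by (rule subset_antisym[rotated])
qed

lemma quotient_map_glue_class:
  "quotient_map X (quotient_topology X R) (glue_class R)"
  by (auto simp: quotient_map_def topspace_quotient_topology openin_quotient_topology)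

definition disjoint_union_topology :: "'a topology \<Rightarrow> 'b topology \<Rightarrow> ('a + 'b) topology" where
  "disjoint_union_topology X Y =
     topology (\<lambda>U. openin X (Inl -` U) \<and> openin Y (Inr -` U))"

lemma openin_disjoint_union_topology:
  "openin (disjoint_union_topology X Y) U \<longleftrightarrow> openin X (Inl -` U) \<and> openin Y (Inr -` U)"
proof -
  have "istopology (\<lambda>U. openin X (Inl -` U) \<and> openin Y (Inr -` U))"
    unfolding istopology_def by (auto simp: vimage_Union)
  then show ?thesis
    by (simp add: disjoint_union_topology_def)
qed

lemma topspace_disjoint_union_topology:
  "topspace (disjoint_union_topology X Y) = topspace X <+> topspace Y"
proof
  have "openin X (Inl -` topspace (disjoint_union_topology X Y))"
    "openin Y (Inr -` topspace (disjoint_union_topology X Y))"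
    using openin_topspace [of "disjoint_union_topology X Y"]
    by (simp_all only: openin_disjoint_union_topology)
  then have "Inl -` topspace (disjoint_union_topology X Y) \<subseteq> topspace X"
    "Inr -` topspace (disjoint_union_topology X Y) \<subseteq> topspace Y"
    by (simp_all add: openin_subset)
  then have *: "Inl x \<in> topspace (disjoint_union_topology X Y) \<Longrightarrow> x \<in> topspace X"
    "Inr y \<in> topspace (disjoint_union_topology X Y) \<Longrightarrow> y \<in> topspace Y" for x y
    by blast+
  show "topspace (disjoint_union_topology X Y) \<subseteq> topspace X <+> topspace Y"
  proof
    fix p assume "p \<in> topspace (disjoint_union_topology X Y)"
    then show "p \<in> topspace X <+> topspace Y"
      using * by (cases p) auto
  qed
next
  have "Inl -` (topspace X <+> topspace Y) = topspace X"
    "Inr -` (topspace X <+> topspace Y) = topspace Y"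
    by auto
  then have "openin (disjoint_union_topology X Y) (topspace X <+> topspace Y)"
    by (simp only: openin_disjoint_union_topology openin_topspace)
  then show "topspace X <+> topspace Y \<subseteq> topspace (disjoint_union_topology X Y)"
    by (rule openin_subset)
qed

definition wedge_sum :: "'a topology \<Rightarrow> 'a \<Rightarrow> 'b topology \<Rightarrow> 'b \<Rightarrow> ('a + 'b) set topology" where
  "wedge_sum X a Y b =
     quotient_topology (disjoint_union_topology X Y) (\<lambda>p q. p = Inl a \<and> q = Inr b)"


section \<open>Delta-sets and the classifying space\<close>

text \<open>
  A Delta-set is given by its sets \<open>X q\<close> of \<open>q\<close>-simplices and its face maps
  \<open>d q i :: X q \<Rightarrow> X (q - 1)\<close> for \<open>q \<ge> 1\<close>, \<open>i \<le> q\<close>. Its realization is the disjoint union of the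
  \<open>X q \<times> \<Delta>\<^sup>q\<close>, with \<open>X q\<close> discrete, modulo \<open>(x, \<delta>\<^sub>i t) \<sim> (d\<^sub>i x, t)\<close>. The coface map \<open>\<delta>\<^sub>i\<close>, which
  inserts a zero as \<open>i\<close>-th barycentric coordinate, is \<^const>\<open>simplical_face\<close>.
\<close>

definition simplex_topology :: "nat \<Rightarrow> (nat \<Rightarrow> real) topology" where
  "simplex_topology q = subtopology (powertop_real UNIV) (standard_simplex q)"

definition realization_rel ::
  "(nat \<Rightarrow> 'x set) \<Rightarrow> (nat \<Rightarrow> nat \<Rightarrow> 'x \<Rightarrow> 'x) \<Rightarrow>
   nat \<times> 'x \<times> (nat \<Rightarrow> real) \<Rightarrow> nat \<times> 'x \<times> (nat \<Rightarrow> real) \<Rightarrow> bool" where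
  "realization_rel X d p p' \<longleftrightarrow>
     (\<exists>q i x t. x \<in> X (Suc q) \<and> i \<le> Suc q \<and> t \<in> standard_simplex q \<and>
        p = (Suc q, x, simplical_face i t) \<and> p' = (q, d (Suc q) i x, t))"

definition realization ::
  "(nat \<Rightarrow> 'x set) \<Rightarrow> (nat \<Rightarrow> nat \<Rightarrow> 'x \<Rightarrow> 'x) \<Rightarrow> (nat \<times> 'x \<times> (nat \<Rightarrow> real)) set topology" where
  "realization X d =
     quotient_topology
       (sum_topology (\<lambda>q. prod_topology (discrete_topology (X q)) (simplex_topology q)) UNIV)
       (realization_rel X d)"

definition bar_simplices :: "('a, 'm) monoid_scheme \<Rightarrow> nat \<Rightarrow> 'a list set" where
  "bar_simplices S q = {s. length s = q \<and> set s \<subseteq> carrier S}"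

text \<open>List indices start at 0, so \<open>s ! (i - 1)\<close> is the \<open>i\<close>-th entry of \<open>s\<close>.\<close>

definition bar_face :: "('a, 'm) monoid_scheme \<Rightarrow> nat \<Rightarrow> nat \<Rightarrow> 'a list \<Rightarrow> 'a list" where
  "bar_face S q i s =
     (if i = 0 then tl s
      else if i = q then butlast s
      else take (i - 1) s @ [s ! (i - 1) \<otimes>\<^bsub>S\<^esub> s ! i] @ drop (i + 1) s)"

definition classifying_space ::
  "('a, 'm) monoid_scheme \<Rightarrow> (nat \<times> 'a list \<times> (nat \<Rightarrow> real)) set topology" where
  "classifying_space S = realization (bar_simplices S) (bar_face S)"

text \<open>The point of the realization given by the unique vertex \<open>()\<close>.\<close>

definition classifying_vertex ::
  "('a, 'm) monoid_scheme \<Rightarrow> (nat \<times> 'a list \<times> (nat \<Rightarrow> real)) set" where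
  "classifying_vertex S =
     glue_class (realization_rel (bar_simplices S) (bar_face S)) (0, [], \<lambda>i. if i = 0 then 1 else 0)"

lemma bar_face_in_bar_simplices:
  assumes "\<And>x y. x \<in> carrier S \<Longrightarrow> y \<in> carrier S \<Longrightarrow> x \<otimes>\<^bsub>S\<^esub> y \<in> carrier S"
    and "s \<in> bar_simplices S (Suc q)" "i \<le> Suc q"
  shows "bar_face S (Suc q) i s \<in> bar_simplices S q"
proof -
  have s: "length s = Suc q" "set s \<subseteq> carrier S"
    using assms(2) by (auto simp: bar_simplices_def)
  have "set (bar_face S (Suc q) i s) \<subseteq> carrier S"
  proof -
    have "set (tl s) \<subseteq> carrier S" "set (butlast s) \<subseteq> carrier S"
      "set (take (i - 1) s) \<subseteq> carrier S" "set (drop (i + 1) s) \<subseteq> carrier S"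
      using s set_take_subset [of "i - 1" s] set_drop_subset [of "i + 1" s]
      by (cases s; auto dest: in_set_butlastD)+
    moreover have "s ! (i - 1) \<otimes>\<^bsub>S\<^esub> s ! i \<in> carrier S" if "i \<noteq> Suc q"
    proof (rule assms(1))
      have "i - 1 < length s" "i < length s"
        using s(1) assms(3) that by auto
      then show "s ! (i - 1) \<in> carrier S" "s ! i \<in> carrier S"
        using s(2) nth_mem by blast+
    qed
    ultimately show ?thesis
      by (simp add: bar_face_def)
  qed
  moreover have "length (bar_face S (Suc q) i s) = q"
    using s(1) assms(3) by (auto simp: bar_face_def)
  ultimately show ?thesis
    by (simp add: bar_simplices_def)
qed

lemma classifying_vertex_in_topspace:
  "classifying_vertex S \<in> topspace (classifying_space S)"
  by (auto simp: classifying_vertex_def classifying_space_def realization_def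
      topspace_quotient_topology bar_simplices_def simplex_topology_def standard_simplex_def)

end

theory Submission
  imports Defs "HOL-Analysis.Abstract_Topological_Spaces"
begin

text \<open>
  Fix \<open>e \<in> K\<close>, put \<open>f = (e, 1)\<close>, and let \<open>W\<close> be the Delta-set consisting of \<open>BM\<close>, \<open>BN\<close> and an edge from
  the vertex of \<open>BN\<close> to that of \<open>BM\<close>. Its realization is homotopy equivalent to the wedge sum by the
  homotopy extension property of \<open>BN\<close> at its vertex. Sending \<open>n\<close> to \<open>(e, n)\<close> and the edge to \<open>f\<close> makes \<open>W\<close>
  a Delta-set over \<open>BS\<close>, and it carries a Delta-set \<open>E\<close> with a left \<open>S\<close>-action, whose vertices are the
  elements of \<open>S\<close> over the vertex of \<open>BM\<close> and those of \<open>Sf\<close> over the vertex of \<open>BN\<close>. Since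
  \<open>(x, n, y) \<mapsto> (x y, n)\<close> is a bijection from \<open>K e \<times> N \<times> e K\<close> to \<open>K \<times> N\<close>, \<open>E\<close> is a tree of contractible pieces, hence contractible. By
  obstruction theory over the cells of \<open>BS\<close> there is a map from \<open>BS\<close> to \<open>W\<close> that lifts coherently to \<open>E\<close>,
  and uniqueness of such lifts up to homotopy, in \<open>E\<close> and in \<open>ES\<close>, makes it a homotopy inverse of the
  map from \<open>W\<close> to \<open>BS\<close>.
\<close>

section \<open>Maps out of realizations\<close>

text \<open>Its substitute is a family of maps \<open>c q x\<close> from simplices into one
  contractible space, where the value on the 0-th face is moved by the first letter of the simplex.
  This letter may fail to be invertible, but the cell by cell construction only ever pushes values
  from faces into the simplex, so contractibility of the target suffices. The other obstacle is that
  n -> (e, n) sends 1 to the idempotent f and not to the identity of S. It still induces a map of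
  Delta-sets, as these have no degeneracies, but right multiplication by f is the identity only on
  Sf. Hence the vertex of BN must carry Sf while that of BM carries S, and the two vertices cannot
  be identified in the model. The extra edge records the inclusion of Sf into S: the simplices over
  it, one for each element of Sf, are the bridges between the pieces of E. Over the vertex of BM the
  elements (a, 1) run through all of M; they form the one piece at the root of the tree.\<close>

definition rpt ::
  "(nat \<Rightarrow> 'x set) \<Rightarrow> (nat \<Rightarrow> nat \<Rightarrow> 'x \<Rightarrow> 'x) \<Rightarrow> nat \<Rightarrow> 'x \<Rightarrow> (nat \<Rightarrow> real) \<Rightarrow>
   (nat \<times> 'x \<times> (nat \<Rightarrow> real)) set" where
  "rpt X d q x t = glue_class (realization_rel X d) (q, x, t)"

text \<open>Evaluation at an arbitrary representative of the class; for compatible families the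
  choice is immaterial.\<close>

definition rlift ::
  "(nat \<Rightarrow> 'x \<Rightarrow> (nat \<Rightarrow> real) \<Rightarrow> 'y) \<Rightarrow> (nat \<times> 'x \<times> (nat \<Rightarrow> real)) set \<Rightarrow> 'y" where
  "rlift F c = (case SOME p. p \<in> c of (q, x, t) \<Rightarrow> F q x t)"

definition compatible_family ::
  "(nat \<Rightarrow> 'x set) \<Rightarrow> (nat \<Rightarrow> nat \<Rightarrow> 'x \<Rightarrow> 'x) \<Rightarrow> (nat \<Rightarrow> 'x \<Rightarrow> (nat \<Rightarrow> real) \<Rightarrow> 'y) \<Rightarrow> bool" where
  "compatible_family X d F \<longleftrightarrow>
     (\<forall>q. \<forall>x\<in>X (Suc q). \<forall>i\<le>Suc q. \<forall>t\<in>standard_simplex q.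
        F (Suc q) x (simplical_face i t) = F q (d (Suc q) i x) t)"

lemma compatible_familyI:
  assumes "\<And>q x i t. x \<in> X (Suc q) \<Longrightarrow> i \<le> Suc q \<Longrightarrow> t \<in> standard_simplex q \<Longrightarrow>
     F (Suc q) x (simplical_face i t) = F q (d (Suc q) i x) t"
  shows "compatible_family X d F"
  using assms by (simp add: compatible_family_def)

lemma compatible_familyD:
  assumes "compatible_family X d F" "x \<in> X (Suc q)" "i \<le> Suc q" "t \<in> standard_simplex q"
  shows "F (Suc q) x (simplical_face i t) = F q (d (Suc q) i x) t"
  using assms by (simp add: compatible_family_def)

lemma rpt_face:
  assumes "x \<in> X (Suc q)" "i \<le> Suc q" "t \<in> standard_simplex q"
  shows "rpt X d (Suc q) x (simplical_face i t) = rpt X d q (d (Suc q) i x) t"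
proof -
  let ?R = "realization_rel X d"
  have *: "?R (Suc q, x, simplical_face i t) (q, d (Suc q) i x, t)"
    using assms unfolding realization_rel_def by blast
  have "equivclp ?R (Suc q, x, simplical_face i t) = equivclp ?R (q, d (Suc q) i x, t)"
    using * by (intro ext) (meson equivclp_sym equivclp_trans r_into_equivclp)
  then show ?thesis
    by (simp add: rpt_def glue_class_def)
qed

lemma compatible_family_rpt: "compatible_family X d (rpt X d)"
  by (rule compatible_familyI) (rule rpt_face)

lemma compatible_family_equivclp:
  assumes "compatible_family X d F" "equivclp (realization_rel X d) p p'"
  shows "(case p of (q, x, t) \<Rightarrow> F q x t) = (case p' of (q, x, t) \<Rightarrow> F q x t)"
  using assms(2)
proof (induction rule: equivclp_induct)
  case (step y z)
  have "(case p of (q, x, t) \<Rightarrow> F q x t) = (case p' of (q, x, t) \<Rightarrow> F q x t)"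
    if "realization_rel X d p p'" for p p'
    using that assms(1) by (auto simp: realization_rel_def compatible_family_def)
  then show ?case
    using step by metis
qed simp

text \<open>Compatibility propagates along chains of face relations. Since only linked triples are
  compared, the identity holds for arbitrary \<open>q\<close>, \<open>x\<close> and
  \<open>t\<close>, which makes it an unconditional rewrite rule.\<close>

lemma rlift_rpt:
  assumes "compatible_family X d F"
  shows "rlift F (rpt X d q x t) = F q x t"
proof -
  define p where "p = (SOME p. p \<in> rpt X d q x t)"
  have "(q, x, t) \<in> rpt X d q x t"
    by (simp add: rpt_def glue_class_def)
  then have "p \<in> rpt X d q x t"
    unfolding p_def by (rule someI)
  then have "equivclp (realization_rel X d) (q, x, t) p"
    by (simp add: rpt_def glue_class_def)
  from compatible_family_equivclp[OF assms this] show ?thesis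
    by (simp add: rlift_def p_def)
qed

lemma topspace_simplex_topology [simp]: "topspace (simplex_topology q) = standard_simplex q"
  by (simp add: simplex_topology_def)

lemma topspace_realization:
  "topspace (realization X d) = {rpt X d q x t |q x t. x \<in> X q \<and> t \<in> standard_simplex q}"
  by (force simp: realization_def topspace_quotient_topology rpt_def)

lemma rpt_in_topspace:
  "x \<in> X q \<Longrightarrow> t \<in> standard_simplex q \<Longrightarrow> rpt X d q x t \<in> topspace (realization X d)"
  by (auto simp: topspace_realization)

lemma realization_cases:
  assumes "p \<in> topspace (realization X d)"
  obtains q x t where "x \<in> X q" "t \<in> standard_simplex q" "p = rpt X d q x t"
  using assms by (auto simp: topspace_realization)

lemma continuous_map_sum_topology:
  assumes "\<And>i. i \<in> I \<Longrightarrow> continuous_map (X i) Y (\<lambda>x. f (i, x))"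
  shows "continuous_map (sum_topology X I) Y f"
  unfolding continuous_map_def
proof (intro conjI allI impI)
  show "f \<in> topspace (sum_topology X I) \<rightarrow> topspace Y"
    using assms continuous_map_image_subset_topspace by fastforce
  fix U assume "openin Y U"
  then have "openin (X i) {x \<in> topspace (X i). f (i, x) \<in> U}" if "i \<in> I" for i
    using assms[OF that] openin_continuous_map_preimage by fastforce
  then show "openin (sum_topology X I) {x \<in> topspace (sum_topology X I). f x \<in> U}"
    by (auto simp: openin_sum_topology)
qed

lemma continuous_map_discrete_prod:
  assumes "\<And>a. a \<in> A \<Longrightarrow> continuous_map X Y (\<lambda>x. f (a, x))"
  shows "continuous_map (prod_topology (discrete_topology A) X) Y f"
proof (rule pasting_lemma[where I = A and T = "\<lambda>a. {a} \<times> topspace X" and f = "\<lambda>_. f"])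
  fix a assume a: "a \<in> A"
  show "openin (prod_topology (discrete_topology A) X) ({a} \<times> topspace X)"
    using a by (simp add: openin_prod_Times_iff)
  have "continuous_map (subtopology (prod_topology (discrete_topology A) X) ({a} \<times> topspace X))
          Y ((\<lambda>x. f (a, x)) \<circ> snd)"
    by (rule continuous_map_compose[OF continuous_map_from_subtopology[OF continuous_map_snd] assms[OF a]])
  then show "continuous_map (subtopology (prod_topology (discrete_topology A) X) ({a} \<times> topspace X)) Y f"
    by (rule continuous_map_eq) auto
qed auto

lemma continuous_map_prod_discrete_prod:
  assumes "\<And>a. a \<in> A \<Longrightarrow> continuous_map (prod_topology Z X) Y (\<lambda>(z, x). f (z, (a, x)))"
  shows "continuous_map (prod_topology Z (prod_topology (discrete_topology A) X)) Y f"
proof (rule pasting_lemma[where I = A and T = "\<lambda>a. topspace Z \<times> {a} \<times> topspace X" and f = "\<lambda>_. f"])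
  fix a assume a: "a \<in> A"
  let ?T = "prod_topology Z (prod_topology (discrete_topology A) X)"
  show "openin ?T (topspace Z \<times> {a} \<times> topspace X)"
    using a by (simp add: openin_prod_Times_iff)
  have "continuous_map ?T (prod_topology Z X) (\<lambda>p. (fst p, snd (snd p)))"
    by (intro continuous_map_pairedI continuous_map_fst
        continuous_map_compose[OF continuous_map_snd continuous_map_snd, unfolded comp_def])
  then have "continuous_map (subtopology ?T (topspace Z \<times> {a} \<times> topspace X))
          Y ((\<lambda>(z, x). f (z, (a, x))) \<circ> (\<lambda>p. (fst p, snd (snd p))))"
    by (intro continuous_map_compose[OF continuous_map_from_subtopology assms[OF a]])
  then show "continuous_map (subtopology ?T (topspace Z \<times> {a} \<times> topspace X)) Y f"
    by (rule continuous_map_eq) auto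
qed auto

text \<open>Each summand is open, so a product with any space \<open>Z\<close> distributes over the
  disjoint union.\<close>

lemma continuous_map_prod_sum_topology:
  assumes "\<And>i. i \<in> I \<Longrightarrow> continuous_map (prod_topology Z (X i)) Y (\<lambda>(z, x). f (z, (i, x)))"
  shows "continuous_map (prod_topology Z (sum_topology X I)) Y f"
proof (rule pasting_lemma[where I = I and T = "\<lambda>i. topspace Z \<times> ({i} \<times> topspace (X i))" and f = "\<lambda>_. f"])
  fix i assume i: "i \<in> I"
  let ?T = "prod_topology Z (sum_topology X I)"
  let ?S = "subtopology (sum_topology X I) ({i} \<times> topspace (X i))"
  show "openin ?T (topspace Z \<times> ({i} \<times> topspace (X i)))"
  proof -
    have "openin (X j) {x. (j, x) \<in> {i} \<times> topspace (X i)}" for j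
      by (cases "j = i") auto
    then show ?thesis
      using i unfolding openin_prod_Times_iff openin_sum_topology by auto
  qed
  have *: "continuous_map ?S (X i) snd"
    unfolding continuous_map_def
  proof (intro conjI allI impI)
    show "snd \<in> topspace ?S \<rightarrow> topspace (X i)" by auto
    fix U assume U: "openin (X i) U"
    then have "U \<subseteq> topspace (X i)" by (rule openin_subset)
    then have "{p \<in> topspace ?S. snd p \<in> U} = ({i} \<times> U) \<inter> ({i} \<times> topspace (X i))"
      using i by auto
    moreover have "openin (sum_topology X I) ({i} \<times> U)"
    proof -
      have "openin (X j) {x. (j, x) \<in> {i} \<times> U}" for j
        using U by (cases "j = i") auto
      then show ?thesis
        using i openin_subset[OF U] unfolding openin_sum_topology by auto
    qed
    ultimately show "openin ?S {p \<in> topspace ?S. snd p \<in> U}"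
      unfolding openin_subtopology by blast
  qed
  have "continuous_map (prod_topology Z ?S) (prod_topology Z (X i)) (\<lambda>p. (fst p, snd (snd p)))"
    by (intro continuous_map_pairedI continuous_map_fst
        continuous_map_compose[OF continuous_map_snd *, unfolded comp_def])
  then have "continuous_map (prod_topology Z ?S) Y
      ((\<lambda>(z, x). f (z, (i, x))) \<circ> (\<lambda>p. (fst p, snd (snd p))))"
    by (rule continuous_map_compose[OF _ assms[OF i]])
  then have "continuous_map (prod_topology Z ?S) Y f"
    by (rule continuous_map_eq) auto
  then show "continuous_map (subtopology ?T (topspace Z \<times> ({i} \<times> topspace (X i)))) Y f"
    by (simp add: prod_topology_subtopology subtopology_restrict)
qed auto

lemma continuous_map_realization:
  assumes F: "compatible_family X d F"
    and cont: "\<And>q x. x \<in> X q \<Longrightarrow> continuous_map (simplex_topology q) Y (F q x)"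
  shows "continuous_map (realization X d) Y (rlift F)"
  unfolding realization_def
proof (rule continuous_compose_quotient_map[OF quotient_map_glue_class])
  have "rlift F \<circ> glue_class (realization_rel X d) = (\<lambda>(q, x, t). F q x t)"
    using rlift_rpt[OF F] by (auto simp: rpt_def fun_eq_iff)
  moreover have "continuous_map
      (sum_topology (\<lambda>q. prod_topology (discrete_topology (X q)) (simplex_topology q)) UNIV) Y
      (\<lambda>(q, x, t). F q x t)"
    by (intro continuous_map_sum_topology continuous_map_discrete_prod) (simp add: cont)
  ultimately show "continuous_map
      (sum_topology (\<lambda>q. prod_topology (discrete_topology (X q)) (simplex_topology q)) UNIV) Y
      (rlift F \<circ> glue_class (realization_rel X d))"
    by simp
qed

abbreviation "unit_interval \<equiv> top_of_set {0..1::real}"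

text \<open>The product of a quotient map with the identity of a locally compact Hausdorff space is
  a quotient map. Hence homotopies, like maps, can be defined simplex by simplex.\<close>

lemma continuous_map_unit_interval_realization:
  assumes F: "\<And>u. u \<in> {0..1} \<Longrightarrow> compatible_family X d (F u)"
    and cont: "\<And>q x. x \<in> X q \<Longrightarrow>
      continuous_map (prod_topology unit_interval (simplex_topology q)) Y (\<lambda>(u, t). F u q x t)"
  shows "continuous_map (prod_topology unit_interval (realization X d)) Y (\<lambda>(u, p). rlift (F u) p)"
  unfolding realization_def
proof (rule continuous_compose_quotient_map[OF quotient_map_prod_right[OF _ _ quotient_map_glue_class]])
  let ?S = "sum_topology (\<lambda>q. prod_topology (discrete_topology (X q)) (simplex_topology q)) UNIV"
  show "locally_compact_space unit_interval"
    by (simp add: compact_imp_locally_compact_space compact_space_subtopology)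
  show "Hausdorff_space unit_interval \<or> regular_space unit_interval"
    by (simp add: Hausdorff_space_subtopology)
  have "continuous_map (prod_topology unit_interval ?S) Y (\<lambda>(u, (q, x, t)). F u q x t)"
    by (intro continuous_map_prod_sum_topology, simp add: case_prod_unfold,
        intro continuous_map_prod_discrete_prod) (use cont in \<open>simp add: case_prod_unfold\<close>)
  then show "continuous_map (prod_topology unit_interval ?S) Y
      ((\<lambda>(u, p). rlift (F u) p) \<circ> (\<lambda>(x, y). (x, glue_class (realization_rel X d) y)))"
    by (rule continuous_map_eq) (use rlift_rpt[OF F] in \<open>auto simp: rpt_def\<close>)
qed

lemma homotopic_with_realization:
  assumes F: "\<And>u. u \<in> {0..1} \<Longrightarrow> compatible_family X d (F u)"
    and cont: "\<And>q x. x \<in> X q \<Longrightarrow>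
      continuous_map (prod_topology unit_interval (simplex_topology q)) Y (\<lambda>(u, t). F u q x t)"
    and f: "\<And>q x t. x \<in> X q \<Longrightarrow> t \<in> standard_simplex q \<Longrightarrow> f (rpt X d q x t) = F 0 q x t"
    and g: "\<And>q x t. x \<in> X q \<Longrightarrow> t \<in> standard_simplex q \<Longrightarrow> g (rpt X d q x t) = F 1 q x t"
  shows "homotopic_with (\<lambda>_. True) (realization X d) Y f g"
proof -
  have "f p = rlift (F 0) p" "g p = rlift (F 1) p" if "p \<in> topspace (realization X d)" for p
    using that f g rlift_rpt[OF F] by (auto elim!: realization_cases)
  then show ?thesis
    using continuous_map_unit_interval_realization[OF F cont]
    by (subst homotopic_with) (auto intro!: exI[where x = "\<lambda>(u, p). rlift (F u) p"])
qed

lemma continuous_map_rpt: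
  assumes "x \<in> X q"
  shows "continuous_map (simplex_topology q) (realization X d) (rpt X d q x)"
proof -
  let ?S = "sum_topology (\<lambda>q. prod_topology (discrete_topology (X q)) (simplex_topology q)) UNIV"
  have "continuous_map (simplex_topology q) ?S (\<lambda>t. (q, x, t))"
    unfolding continuous_map_def
  proof (intro conjI allI impI)
    show "(\<lambda>t. (q, x, t)) \<in> topspace (simplex_topology q) \<rightarrow> topspace ?S"
      using assms by auto
    fix U assume "openin ?S U"
    then have "openin (prod_topology (discrete_topology (X q)) (simplex_topology q)) {p. (q, p) \<in> U}"
      by (simp add: openin_sum_topology)
    moreover have "continuous_map (simplex_topology q)
        (prod_topology (discrete_topology (X q)) (simplex_topology q)) (\<lambda>t. (x, t))"
      using assms by (auto intro: continuous_map_pairedI)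
    ultimately show "openin (simplex_topology q) {t \<in> topspace (simplex_topology q). (q, x, t) \<in> U}"
      using openin_continuous_map_preimage by fastforce
  qed
  then have "continuous_map (simplex_topology q) (realization X d)
      (glue_class (realization_rel X d) \<circ> (\<lambda>t. (q, x, t)))"
    unfolding realization_def
    by (rule continuous_map_compose[OF _ quotient_imp_continuous_map[OF quotient_map_glue_class]])
  then show ?thesis
    by (simp add: rpt_def[abs_def] comp_def)
qed

section \<open>Extending maps over prisms\<close>

text \<open>All that is used of the pair is a collar. On the collar, project to the zero set, apply
  \<phi> and run the contraction up to time 2\<mu>; where \<mu> is at least 1/2, take the constant
  end point of the contraction.\<close>

lemma contractible_space_extension:
  assumes C: "contractible_space C" "topspace C \<noteq> {}"
    and mu: "continuous_map P euclideanreal \<mu>" "\<And>x. x \<in> topspace P \<Longrightarrow> 0 \<le> \<mu> x"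
    and pr: "continuous_map (subtopology P {x. \<mu> x \<le> 1/2}) (subtopology P {x. \<mu> x = 0}) \<pi>"
      "\<And>x. x \<in> topspace P \<Longrightarrow> \<mu> x = 0 \<Longrightarrow> \<pi> x = x"
    and f: "continuous_map (subtopology P {x. \<mu> x = 0}) C \<phi>"
  obtains \<psi> where "continuous_map P C \<psi>" "\<And>x. x \<in> topspace P \<Longrightarrow> \<mu> x = 0 \<Longrightarrow> \<psi> x = \<phi> x"
proof -
  obtain a H where H: "continuous_map (prod_topology unit_interval C) C H"
      "\<And>c. H (0, c) = c" "\<And>c. H (1, c) = a"
    using C(1) unfolding contractible_space_def homotopic_with_def by force
  \<comment> \<open>The empty space counts as contractible, so a point of \<open>C\<close> is needed
    to see that the end point \<open>a\<close> of the contraction lies in \<open>C\<close>.\<close>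
  obtain c where "c \<in> topspace C"
    using C(2) by blast
  then have "H (1, c) \<in> topspace C"
    using continuous_map_image_subset_topspace[OF H(1)] by fastforce
  then have a: "a \<in> topspace C"
    by (simp add: H)
  define T where "T = (\<lambda>b. {x \<in> topspace P. if b then \<mu> x \<in> {..1/2} else \<mu> x \<in> {1/2..}})"
  define F where "F = (\<lambda>b x. if b then H (2 * \<mu> x, \<phi> (\<pi> x)) else a)"
  have FT: "continuous_map (subtopology P (T True)) C (F True)"
  proof -
    have eq: "subtopology P {x. \<mu> x \<le> 1/2} = subtopology P (T True)"
      by (subst subtopology_restrict[symmetric]) (auto simp: T_def intro!: arg_cong2[where f = subtopology])
    have "continuous_map (subtopology P (T True)) unit_interval (\<lambda>x. 2 * \<mu> x)"
      by (auto simp: continuous_map_in_subtopology T_def mu(2)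
          intro!: continuous_map_from_subtopology continuous_intros mu(1))
    moreover have "continuous_map (subtopology P (T True)) C (\<phi> \<circ> \<pi>)"
      using continuous_map_compose[OF pr(1) f] by (simp only: eq)
    ultimately have "continuous_map (subtopology P (T True)) (prod_topology unit_interval C)
        (\<lambda>x. (2 * \<mu> x, \<phi> (\<pi> x)))"
      by (intro continuous_map_pairedI) (simp_all add: comp_def)
    then show ?thesis
      using continuous_map_compose[OF _ H(1)] by (fastforce simp: F_def comp_def)
  qed
  obtain \<psi> where \<psi>: "continuous_map P C \<psi>"
      "\<And>x b. b \<in> UNIV \<Longrightarrow> x \<in> topspace P \<inter> T b \<Longrightarrow> \<psi> x = F b x"
  proof (rule pasting_lemma_exists_closed[where X = P and Y = C and I = UNIV and T = T and f = F])
    show "topspace P \<subseteq> \<Union> (range T)"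
      by (auto simp: T_def UNIV_bool)
    show "closedin P (T b)" for b
      unfolding T_def
      using closedin_continuous_map_preimage[OF mu(1), of "{..1/2}"]
        closedin_continuous_map_preimage[OF mu(1), of "{1/2..}"] by (cases b) simp_all
    show "continuous_map (subtopology P (T b)) C (F b)" for b
      using FT a by (cases b) (auto simp: F_def[abs_def])
    show "F i x = F j x" if "x \<in> topspace P \<inter> T i \<inter> T j" for i j x
    proof (cases "i = j")
      case False
      then have "2 * \<mu> x = 1"
        using that by (auto simp: T_def split: if_splits)
      then show ?thesis
        by (simp add: F_def H(3))
    qed simp
  qed auto
  show ?thesis
  proof (rule that[OF \<psi>(1)])
    fix x assume "x \<in> topspace P" "\<mu> x = 0"
    then show "\<psi> x = \<phi> x"
      using \<psi>(2)[of True x] by (simp add: T_def F_def H pr(2))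
  qed
qed

section \<open>Gauge and homotheties of a standard simplex\<close>

lemma continuous_map_Min_atMost:
  fixes q :: nat
  assumes "\<And>i. i \<le> q \<Longrightarrow> continuous_map X euclideanreal (\<lambda>x. f x i)"
  shows "continuous_map X euclideanreal (\<lambda>x. Min (f x ` {..q}))"
  using assms
proof (induction q)
  case (Suc q)
  have "Min (f x ` {..Suc q}) = min (f x (Suc q)) (Min (f x ` {..q}))" for x
    by (simp add: atMost_Suc)
  then show ?case
    using continuous_map_real_min[OF Suc.prems[OF order_refl] Suc.IH] Suc.prems by simp
qed simp

text \<open>Barycentric coordinates, rescaled so that the gauge is \<open>0\<close> on the boundary and \<open>1\<close> at the
  barycentre. The map \<open>simplex_scale q r\<close> is the homothety with ratio \<open>r\<close> about the barycentre.\<close>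

definition simplex_gauge :: "nat \<Rightarrow> (nat \<Rightarrow> real) \<Rightarrow> real" where
  "simplex_gauge q t = (real q + 1) * Min (t ` {..q})"

definition simplex_scale :: "nat \<Rightarrow> real \<Rightarrow> (nat \<Rightarrow> real) \<Rightarrow> nat \<Rightarrow> real" where
  "simplex_scale q r t = (\<lambda>i. if i \<le> q then (1 - r) / (real q + 1) + r * t i else 0)"

lemma simplex_gauge_le:
  assumes "i \<le> q"
  shows "simplex_gauge q t \<le> (real q + 1) * t i"
  using assms by (simp add: simplex_gauge_def)

lemma simplex_gauge_nonneg:
  assumes "t \<in> standard_simplex q"
  shows "0 \<le> simplex_gauge q t"
  using assms by (auto simp: simplex_gauge_def standard_simplex_def)

lemma simplex_gauge_le_1:
  assumes "t \<in> standard_simplex q"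
  shows "simplex_gauge q t \<le> 1"
proof -
  have "simplex_gauge q t = (\<Sum>i\<le>q. Min (t ` {..q}))"
    by (simp add: simplex_gauge_def)
  also have "\<dots> \<le> (\<Sum>i\<le>q. t i)"
    by (rule sum_mono) simp
  finally show ?thesis
    using assms by (simp add: standard_simplex_def)
qed

lemma simplex_gauge_eq_0_iff:
  assumes "t \<in> standard_simplex q"
  shows "simplex_gauge q t = 0 \<longleftrightarrow> (\<exists>i\<le>q. t i = 0)"
proof
  assume "simplex_gauge q t = 0"
  then have "Min (t ` {..q}) = 0"
    by (simp add: simplex_gauge_def)
  moreover have "Min (t ` {..q}) \<in> t ` {..q}"
    by (rule Min_in) auto
  ultimately show "\<exists>i\<le>q. t i = 0"
    by auto
next
  assume "\<exists>i\<le>q. t i = 0"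
  then show "simplex_gauge q t = 0"
    using simplex_gauge_le[of _ q t] simplex_gauge_nonneg[OF assms] by force
qed

text \<open>The homothety multiplies the deviation of each coordinate from that of the barycentre by
  r, hence also the deviation of the least coordinate, as r is nonnegative.\<close>

lemma simplex_gauge_scale:
  assumes "0 \<le> r"
  shows "simplex_gauge q (simplex_scale q r t) = 1 - r * (1 - simplex_gauge q t)"
proof -
  have "Min ((\<lambda>i. (1 - r) / (real q + 1) + r * t i) ` {..q})
      = (1 - r) / (real q + 1) + r * Min (t ` {..q})"
    using mono_Min_commute[of "\<lambda>y. (1 - r) / (real q + 1) + r * y" "t ` {..q}"] assms
    by (simp add: mono_def mult_left_mono image_image)
  moreover have "simplex_scale q r t ` {..q} = (\<lambda>i. (1 - r) / (real q + 1) + r * t i) ` {..q}"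
    by (auto simp: simplex_scale_def)
  ultimately show ?thesis
    by (simp add: simplex_gauge_def field_simps)
qed

text \<open>The second bound on r says that the gauge of the image is nonnegative, that is, that its
  least coordinate is. The sum of the coordinates is kept by any homothety about the
  barycentre.\<close>

lemma simplex_scale_in_simplex:
  assumes t: "t \<in> standard_simplex q" and r: "0 \<le> r" "r * (1 - simplex_gauge q t) \<le> 1"
  shows "simplex_scale q r t \<in> standard_simplex q"
proof -
  let ?s = "simplex_scale q r t"
  have nonneg: "0 \<le> ?s i" for i
  proof (cases "i \<le> q")
    case True
    have "0 \<le> simplex_gauge q ?s"
      using r by (simp add: simplex_gauge_scale)
    then show ?thesis
      using simplex_gauge_le[OF True, of ?s]
      by (metis add_nonneg_pos order_trans of_nat_0_le_iff zero_le_mult_iff zero_less_one not_le)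
  qed (simp add: simplex_scale_def)
  have sum: "(\<Sum>i\<le>q. ?s i) = 1"
  proof -
    have "(\<Sum>i\<le>q. ?s i) = (\<Sum>i\<le>q. (1 - r) / (real q + 1)) + r * (\<Sum>i\<le>q. t i)"
      by (simp add: simplex_scale_def sum.distrib flip: sum_distrib_left)
    also have "(\<Sum>i\<le>q. (1 - r) / (real q + 1)) = 1 - r"
      by (simp add: field_simps)
    finally show ?thesis
      using t by (simp add: standard_simplex_def)
  qed
  have "?s i \<le> 1" for i
  proof (cases "i \<le> q")
    case True
    then have "?s i \<le> (\<Sum>i\<le>q. ?s i)"
      using nonneg by (intro member_le_sum) auto
    then show ?thesis
      by (simp add: sum)
  qed (simp add: simplex_scale_def)
  then show ?thesis
    using nonneg sum by (auto simp: standard_simplex_def simplex_scale_def)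
qed

lemma simplex_scale_1:
  assumes "t \<in> standard_simplex q"
  shows "simplex_scale q 1 t = t"
  using assms by (auto simp: simplex_scale_def standard_simplex_def)

lemma continuous_map_simplex_topologyI:
  assumes "\<And>i. continuous_map X euclideanreal (\<lambda>x. f x i)"
    and "\<And>x. x \<in> topspace X \<Longrightarrow> f x \<in> standard_simplex q"
  shows "continuous_map X (simplex_topology q) f"
  using assms by (auto simp: simplex_topology_def continuous_map_in_subtopology continuous_map_componentwise_UNIV)

lemma continuous_map_simplex_coordinate:
  "continuous_map (simplex_topology q) euclideanreal (\<lambda>t. t i)"
  unfolding simplex_topology_def
  by (intro continuous_map_from_subtopology continuous_map_product_projection) simp

lemma continuous_map_simplex_gauge:
  "continuous_map (simplex_topology q) euclideanreal (simplex_gauge q)"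
  unfolding simplex_gauge_def[abs_def]
  by (intro continuous_intros continuous_map_Min_atMost continuous_map_simplex_coordinate)

lemma continuous_map_simplex_scale:
  assumes "continuous_map X euclideanreal r" "continuous_map X (simplex_topology q) f"
    and "\<And>x. x \<in> topspace X \<Longrightarrow> 0 \<le> r x \<and> r x * (1 - simplex_gauge q (f x)) \<le> 1"
  shows "continuous_map X (simplex_topology q) (\<lambda>x. simplex_scale q (r x) (f x))"
proof (rule continuous_map_simplex_topologyI)
  fix i
  have "continuous_map X euclideanreal (\<lambda>x. f x i)"
    using continuous_map_compose[OF assms(2) continuous_map_simplex_coordinate]
    by (simp add: comp_def)
  then show "continuous_map X euclideanreal (\<lambda>x. simplex_scale q (r x) (f x) i)"
    unfolding simplex_scale_def by (cases "i \<le> q") (auto intro!: continuous_intros assms(1))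
next
  fix x assume "x \<in> topspace X"
  then show "simplex_scale q (r x) (f x) \<in> standard_simplex q"
    using assms(3) continuous_map_image_subset_topspace[OF assms(2)]
    by (intro simplex_scale_in_simplex) auto
qed

section \<open>Extension problems on prisms\<close>

abbreviation prism :: "real set \<Rightarrow> nat \<Rightarrow> (real \<times> (nat \<Rightarrow> real)) topology" where
  "prism T q \<equiv> prod_topology (top_of_set T) (simplex_topology q)"

definition prism_boundary :: "real set \<Rightarrow> nat \<Rightarrow> (real \<times> (nat \<Rightarrow> real)) set" where
  "prism_boundary T\<^sub>0 q = {(u, t). u \<in> T\<^sub>0 \<or> (\<exists>i\<le>q. t i = 0)}"

text \<open>One notion covers three uses: a point with \<open>T\<^sub>0\<close> empty gives
  existence of lifts, the unit interval with both ends gives their uniqueness up to homotopy, and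
  the unit interval with one end gives the homotopy extension property.\<close>

definition prism_extension :: "real set \<Rightarrow> real set \<Rightarrow> 'c topology \<Rightarrow> bool" where
  "prism_extension T T\<^sub>0 C \<longleftrightarrow>
     (\<forall>q \<phi>. continuous_map (subtopology (prism T q) (prism_boundary T\<^sub>0 q)) C \<phi> \<longrightarrow>
        (\<exists>\<psi>. continuous_map (prism T q) C \<psi> \<and>
             (\<forall>p\<in>topspace (prism T q) \<inter> prism_boundary T\<^sub>0 q. \<psi> p = \<phi> p)))"

text \<open>Here \<open>\<omega>\<close> is a gauge on \<open>T\<close> with centre \<open>c\<close>, vanishing exactly on \<open>T\<^sub>0\<close>.\<close>

lemma prism_extension_contractible:
  assumes C: "contractible_space C" "topspace C \<noteq> {}"
    and \<omega>: "continuous_on T \<omega>" "\<And>u. u \<in> T \<Longrightarrow> 0 \<le> \<omega> u" "\<And>u. u \<in> T \<Longrightarrow> \<omega> u = 0 \<longleftrightarrow> u \<in> T\<^sub>0"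
    and scale: "\<And>u r. u \<in> T \<Longrightarrow> 1 \<le> r \<Longrightarrow> r * (1 - \<omega> u) \<le> 1 \<Longrightarrow>
      c + r * (u - c) \<in> T \<and> \<omega> (c + r * (u - c)) = 1 - r * (1 - \<omega> u)"
  shows "prism_extension T T\<^sub>0 C"
  unfolding prism_extension_def
proof (intro allI impI)
  fix q \<phi>
  let ?P = "prism T q"
  assume \<phi>: "continuous_map (subtopology ?P (prism_boundary T\<^sub>0 q)) C \<phi>"
  \<comment> \<open>The smaller of the two gauges is a gauge on the product, centred at
    \<open>c\<close> and the barycentre. Scaling about this centre by \<open>r\<close> turns
    \<open>1 - \<mu>\<close> into 1, so \<pi> is the radial projection to the boundary, which makes
    sense away from the centre.\<close>
  define \<mu> where "\<mu> = (\<lambda>p. min (simplex_gauge q (snd p)) (\<omega> (fst p)))"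
  define r where "r = (\<lambda>p. 1 / (1 - \<mu> p))"
  define \<pi> where "\<pi> = (\<lambda>p. (c + r p * (fst p - c), simplex_scale q (r p) (snd p)))"
  have cont\<mu>: "continuous_map ?P euclideanreal \<mu>"
    unfolding \<mu>_def
    using continuous_map_compose[OF continuous_map_snd continuous_map_simplex_gauge]
      continuous_map_compose[OF continuous_map_fst, of "top_of_set T" euclideanreal \<omega>] \<omega>(1)
    by (intro continuous_map_real_min) (auto simp: comp_def)
  have \<mu>0: "0 \<le> \<mu> p" if "p \<in> topspace ?P" for p
    using that \<omega>(2) simplex_gauge_nonneg by (auto simp: \<mu>_def)
  have \<mu>0_iff: "\<mu> p = 0 \<longleftrightarrow> p \<in> prism_boundary T\<^sub>0 q" if p: "p \<in> topspace ?P" for p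
  proof -
    have "0 \<le> simplex_gauge q (snd p)" "0 \<le> \<omega> (fst p)"
      using p \<omega>(2) simplex_gauge_nonneg by auto
    then have "\<mu> p = 0 \<longleftrightarrow> simplex_gauge q (snd p) = 0 \<or> \<omega> (fst p) = 0"
      by (auto simp: \<mu>_def min_def)
    then show ?thesis
      using p \<omega>(3) simplex_gauge_eq_0_iff by (auto simp: prism_boundary_def)
  qed
  have eq0: "subtopology ?P {p. \<mu> p = 0} = subtopology ?P (prism_boundary T\<^sub>0 q)"
    by (subst (1 2) subtopology_restrict[symmetric]) (auto simp: \<mu>0_iff intro!: arg_cong2[where f = subtopology])
  have r: "1 \<le> r p" "r p * (1 - simplex_gauge q (snd p)) \<le> 1" "r p * (1 - \<omega> (fst p)) \<le> 1"
    if "p \<in> topspace ?P" "\<mu> p \<le> 1/2" for p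
  proof -
    have pos: "0 < 1 - \<mu> p" "0 \<le> \<mu> p"
      using that \<mu>0 by auto
    then show "1 \<le> r p"
      by (simp add: r_def)
    show "r p * (1 - simplex_gauge q (snd p)) \<le> 1" "r p * (1 - \<omega> (fst p)) \<le> 1"
      using pos by (auto simp: r_def field_simps) (auto simp: \<mu>_def)
  qed
  let ?Q = "subtopology ?P {p. \<mu> p \<le> 1/2}"
  have contr: "continuous_map ?Q euclideanreal r"
    unfolding r_def by (intro continuous_map_real_divide continuous_intros continuous_map_from_subtopology cont\<mu>) auto
  have cont1: "continuous_map ?Q (top_of_set T) (\<lambda>p. c + r p * (fst p - c))"
  proof -
    have "continuous_map ?Q euclideanreal fst"
      by (intro continuous_map_from_subtopology continuous_map_into_fulltopology[OF continuous_map_fst])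
    then show ?thesis
      using scale[OF _ r(1,3)]
      by (intro continuous_map_into_subtopology continuous_map_add continuous_map_diff
          continuous_map_real_mult contr) (simp_all add: Pi_iff mem_Times_iff)
  qed
  have cont2: "continuous_map ?Q (simplex_topology q) (\<lambda>p. simplex_scale q (r p) (snd p))"
  proof (intro continuous_map_simplex_scale contr continuous_map_from_subtopology continuous_map_snd)
    fix p assume "p \<in> topspace ?Q"
    then have "p \<in> topspace ?P" "\<mu> p \<le> 1/2"
      by auto
    then show "0 \<le> r p \<and> r p * (1 - simplex_gauge q (snd p)) \<le> 1"
      using r by force
  qed
  have "\<mu> (\<pi> p) = 0" if "p \<in> topspace ?P" "\<mu> p \<le> 1/2" for p
  proof -
    have "\<omega> (fst (\<pi> p)) = 1 - r p * (1 - \<omega> (fst p))"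
      using scale[OF _ r(1,3)[OF that]] that(1) by (simp add: \<pi>_def mem_Times_iff)
    moreover have "simplex_gauge q (snd (\<pi> p)) = 1 - r p * (1 - simplex_gauge q (snd p))"
      using r(1)[OF that] by (simp add: \<pi>_def simplex_gauge_scale)
    ultimately have eq: "\<mu> (\<pi> p) = min (1 - r p * (1 - simplex_gauge q (snd p))) (1 - r p * (1 - \<omega> (fst p)))"
      by (simp only: \<mu>_def)
    have "r p * (1 - \<mu> p) = 1"
      using that(2) by (simp add: r_def)
    \<comment> \<open>The gauge that attains the minimum drops to 0, while the other one stays
      nonnegative.\<close>
    moreover have "\<mu> p = simplex_gauge q (snd p) \<or> \<mu> p = \<omega> (fst p)"
      by (simp add: \<mu>_def min_def)
    ultimately have "r p * (1 - simplex_gauge q (snd p)) = 1 \<or> r p * (1 - \<omega> (fst p)) = 1"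
      by metis
    then show ?thesis
      using r(2,3)[OF that] unfolding eq by linarith
  qed
  then have cont\<pi>: "continuous_map ?Q (subtopology ?P {p. \<mu> p = 0}) \<pi>"
    using continuous_map_pairedI[OF cont1 cont2]
    by (intro continuous_map_into_subtopology) (simp_all add: \<pi>_def[symmetric] Pi_iff)
  have \<pi>_id: "\<pi> p = p" if "p \<in> topspace ?P" "\<mu> p = 0" for p
    using that by (auto simp: \<pi>_def r_def simplex_scale_1)
  obtain \<psi> where "continuous_map ?P C \<psi>" "\<And>p. p \<in> topspace ?P \<Longrightarrow> \<mu> p = 0 \<Longrightarrow> \<psi> p = \<phi> p"
    using contractible_space_extension[OF C cont\<mu> \<mu>0 cont\<pi> \<pi>_id \<phi>[folded eq0]] by blast
  then show "\<exists>\<psi>. continuous_map ?P C \<psi> \<and> (\<forall>p\<in>topspace ?P \<inter> prism_boundary T\<^sub>0 q. \<psi> p = \<phi> p)"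
    using \<mu>0_iff by blast
qed

lemma prism_extension_point:
  assumes "contractible_space C" "topspace C \<noteq> {}"
  shows "prism_extension {0} {} C"
  \<comment> \<open>The constant gauge 1 never vanishes, in accordance with the empty
    \<open>T\<^sub>0\<close>, and does not affect the minimum with the gauge of the simplex.\<close>
  by (rule prism_extension_contractible[OF assms, where \<omega> = "\<lambda>_. 1" and c = 0]) auto

lemma prism_extension_interval:
  assumes "contractible_space C" "topspace C \<noteq> {}"
  shows "prism_extension {0..1} {0, 1} C"
\<comment> \<open>The tent function, with value 0 at both ends of the interval and 1 at its
  centre.\<close>
proof (rule prism_extension_contractible[OF assms, where \<omega> = "\<lambda>u. min (2 * u) (2 - 2 * u)" and c = "1/2"])
  fix u r :: real
  assume *: "u \<in> {0..1}" "1 \<le> r" "r * (1 - min (2 * u) (2 - 2 * u)) \<le> 1"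
  have "r * (1 - 2 * u) \<le> r * (1 - min (2 * u) (2 - 2 * u))"
    "r * (1 - (2 - 2 * u)) \<le> r * (1 - min (2 * u) (2 - 2 * u))"
    using * by (intro mult_left_mono; simp)+
  then have "r * (1 - 2 * u) \<le> 1" "r * (1 - (2 - 2 * u)) \<le> 1"
    using *(3) by linarith+
  moreover have "min (2 * (1/2 + r * (u - 1/2))) (2 - 2 * (1/2 + r * (u - 1/2)))
      = 1 - r * (1 - min (2 * u) (2 - 2 * u))"
  proof (cases "2 * u \<le> 1")
    case True
    then have "r * (2 * u) \<le> r * 1"
      using * by (intro mult_left_mono) auto
    with True show ?thesis
      by (simp add: min_def algebra_simps)
  next
    case False
    then have "r * 1 < r * (2 * u)"
      using * by (intro mult_strict_left_mono) auto
    with False show ?thesis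
      by (simp add: min_def algebra_simps)
  qed
  ultimately show "1/2 + r * (u - 1/2) \<in> {0..1} \<and>
      min (2 * (1/2 + r * (u - 1/2))) (2 - 2 * (1/2 + r * (u - 1/2))) = 1 - r * (1 - min (2 * u) (2 - 2 * u))"
    by (simp add: field_simps)
next
  show "continuous_on {0..1} (\<lambda>u::real. min (2 * u) (2 - 2 * u))"
    by (intro continuous_intros)
qed (auto simp: min_def)

text \<open>The homotopy extension property of a simplex relative to its boundary, by radial projection of
  the cylinder from a point above its top face.\<close>

lemma prism_extension_homotopy: "prism_extension {0..1} {0} C"
  unfolding prism_extension_def
proof (intro allI impI)
  fix q \<phi>
  let ?P = "prism {0..1} q"
  assume \<phi>: "continuous_map (subtopology ?P (prism_boundary {0} q)) C \<phi>"
  \<comment> \<open>The projection starts from the point at height 2 over the barycentre. Scaling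
    about it by r reaches the bottom when r (2 - u) = 2 and the sides when r (1 - gauge) = 1;
    \<open>1 / m\<close> is the smaller of these two ratios. Since the prism has height 1,
    \<open>m\<close> is at least 1/2 and the ratio stays bounded.\<close>
  define m where "m = (\<lambda>p. max (1 - fst p / 2) (1 - simplex_gauge q (snd p)))"
  define r where "r = (\<lambda>p. 1 / m p)"
  define \<pi> where "\<pi> = (\<lambda>p. (2 - r p * (2 - fst p), simplex_scale q (r p) (snd p)))"
  have P: "0 \<le> fst p" "fst p \<le> 1" "snd p \<in> standard_simplex q"
    "0 \<le> simplex_gauge q (snd p)" "simplex_gauge q (snd p) \<le> 1" if "p \<in> topspace ?P" for p
    using that simplex_gauge_nonneg simplex_gauge_le_1 by auto
  have m: "1/2 \<le> m p" "m p \<le> 1" if "p \<in> topspace ?P" for p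
  proof -
    have "1 - fst p / 2 \<le> m p"
      by (simp add: m_def)
    then show "1/2 \<le> m p"
      using P[OF that] by linarith
    show "m p \<le> 1"
      using P[OF that] by (simp add: m_def)
  qed
  have contfst: "continuous_map ?P euclideanreal fst"
    by (rule continuous_map_into_fulltopology[OF continuous_map_fst])
  have contg: "continuous_map ?P euclideanreal (\<lambda>p. simplex_gauge q (snd p))"
    using continuous_map_compose[OF continuous_map_snd continuous_map_simplex_gauge]
    by (auto simp: comp_def)
  have contr: "continuous_map ?P euclideanreal r"
    unfolding r_def
  proof (rule continuous_map_real_divide)
    show "continuous_map ?P euclideanreal m"
      unfolding m_def by (intro continuous_intros contfst contg) auto
  qed (use m in force)+
  have r: "1 \<le> r p" "r p * (2 - fst p) \<le> 2" "r p * (1 - simplex_gauge q (snd p)) \<le> 1"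
    if "p \<in> topspace ?P" for p
  proof -
    have pos: "0 < m p" "m p \<le> 1"
      using m[OF that] by auto
    then show "1 \<le> r p"
      by (simp add: r_def)
    have "r p * m p = 1"
      using pos by (simp add: r_def)
    moreover have "r p * (1 - fst p / 2) \<le> r p * m p" "r p * (1 - simplex_gauge q (snd p)) \<le> r p * m p"
      using \<open>1 \<le> r p\<close> by (intro mult_left_mono; simp add: m_def)+
    ultimately show "r p * (2 - fst p) \<le> 2" "r p * (1 - simplex_gauge q (snd p)) \<le> 1"
      by (simp_all add: algebra_simps)
  qed
  have top: "1 \<le> r p * (2 - fst p)" if "p \<in> topspace ?P" for p
    using mult_mono[OF r(1)[OF that], of 1 "2 - fst p"] P[OF that] r(1)[OF that] by auto
  have edge: "r p * (2 - fst p) = 2 \<or> r p * (1 - simplex_gauge q (snd p)) = 1" if "p \<in> topspace ?P" for p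
  proof -
    have "r p * m p = 1"
      using m[OF that] by (simp add: r_def)
    then show ?thesis
      by (auto simp: m_def max_def field_simps split: if_splits)
  qed
  have cont\<pi>: "continuous_map ?P ?P \<pi>"
    unfolding \<pi>_def
  proof (intro continuous_map_pairedI)
    show "continuous_map ?P unit_interval (\<lambda>p. 2 - r p * (2 - fst p))"
      using r(2) top by (auto simp: continuous_map_in_subtopology simp del: topspace_prod_topology
          intro!: continuous_intros contr contfst)
    show "continuous_map ?P (simplex_topology q) (\<lambda>p. simplex_scale q (r p) (snd p))"
      using r(1,3) by (intro continuous_map_simplex_scale contr continuous_map_snd) force
  qed
  have in_bd: "\<pi> p \<in> prism_boundary {0} q" if "p \<in> topspace ?P" for p
  proof (cases "r p * (2 - fst p) = 2")
    case False
    then have "simplex_gauge q (simplex_scale q (r p) (snd p)) = 0"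
      using edge[OF that] r(1)[OF that] by (simp add: simplex_gauge_scale)
    then show ?thesis
      using simplex_gauge_eq_0_iff[OF simplex_scale_in_simplex[OF P(3)[OF that]]] r[OF that]
      by (auto simp: prism_boundary_def \<pi>_def)
  qed (simp add: prism_boundary_def \<pi>_def)
  have id: "\<pi> p = p" if p: "p \<in> topspace ?P" "p \<in> prism_boundary {0} q" for p
  proof -
    have "fst p = 0 \<or> simplex_gauge q (snd p) = 0"
      using p simplex_gauge_eq_0_iff by (auto simp: prism_boundary_def)
    then have "m p = 1"
      using P[OF p(1)] by (auto simp: m_def)
    then show ?thesis
      using P[OF p(1)] by (simp add: \<pi>_def r_def simplex_scale_1)
  qed
  have "continuous_map ?P (subtopology ?P (prism_boundary {0} q)) \<pi>"
    using cont\<pi> in_bd by (auto simp: continuous_map_in_subtopology simp del: topspace_prod_topology)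
  then have "continuous_map ?P C (\<phi> \<circ> \<pi>)"
    by (rule continuous_map_compose[OF _ \<phi>])
  then show "\<exists>\<psi>. continuous_map ?P C \<psi> \<and> (\<forall>p\<in>topspace ?P \<inter> prism_boundary {0} q. \<psi> p = \<phi> p)"
    using id by (intro exI[of _ "\<phi> \<circ> \<pi>"]) auto
qed

section \<open>Coherent families of maps\<close>

definition delta_set :: "(nat \<Rightarrow> 'x set) \<Rightarrow> (nat \<Rightarrow> nat \<Rightarrow> 'x \<Rightarrow> 'x) \<Rightarrow> bool" where
  "delta_set X d \<longleftrightarrow>
     (\<forall>q. \<forall>x\<in>X (Suc q). \<forall>i\<le>Suc q. d (Suc q) i x \<in> X q) \<and>
     (\<forall>q. \<forall>x\<in>X (Suc (Suc q)). \<forall>j\<le>Suc (Suc q). \<forall>i<j.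
        d (Suc q) i (d (Suc (Suc q)) j x) = d (Suc q) (j - 1) (d (Suc (Suc q)) i x))"

lemma delta_set_face:
  assumes "delta_set X d" "x \<in> X (Suc q)" "i \<le> Suc q"
  shows "d (Suc q) i x \<in> X q"
  using assms by (auto simp: delta_set_def)

lemma delta_set_face_face:
  assumes "delta_set X d" "x \<in> X (Suc (Suc q))" "i < j" "j \<le> Suc (Suc q)"
  shows "d (Suc q) i (d (Suc (Suc q)) j x) = d (Suc q) (j - 1) (d (Suc (Suc q)) i x)"
  using assms by (auto simp: delta_set_def)

definition delete_coordinate :: "nat \<Rightarrow> (nat \<Rightarrow> 'a) \<Rightarrow> nat \<Rightarrow> 'a" where
  "delete_coordinate i t = (\<lambda>k. if k < i then t k else t (Suc k))"

lemma delete_coordinate_face [simp]: "delete_coordinate i (simplical_face i t) = t"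
  by (auto simp: delete_coordinate_def simplical_face_def)

lemma face_delete_coordinate:
  assumes "t i = 0"
  shows "simplical_face i (delete_coordinate i t) = t"
  using assms by (auto simp: delete_coordinate_def simplical_face_def fun_eq_iff)

lemma simplical_face_same [simp]: "simplical_face i t i = 0"
  by (simp add: simplical_face_def)

lemma simplical_face_in_simplex:
  "i \<le> Suc q \<Longrightarrow> t \<in> standard_simplex q \<Longrightarrow> simplical_face i t \<in> standard_simplex (Suc q)"
  using simplical_face_in_standard_simplex[of "Suc q" i t] by simp

lemma delete_coordinate_in_simplex:
  assumes t: "t \<in> standard_simplex (Suc q)" "t i = 0" "i \<le> Suc q"
  shows "delete_coordinate i t \<in> standard_simplex q"
proof -
  have "{..Suc q} = insert i ({..<i} \<union> {i<..Suc q})"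
    using t(3) by auto
  then have "(\<Sum>k\<le>Suc q. t k) = (\<Sum>k<i. t k) + (\<Sum>k\<in>{i<..Suc q}. t k)"
    using t(2) by (subst \<open>{..Suc q} = _\<close>) (simp, subst sum.union_disjoint, auto)
  also have "(\<Sum>k\<in>{i<..Suc q}. t k) = (\<Sum>k\<in>{i..q}. t (Suc k))"
    by (rule sum.reindex_bij_witness[of _ Suc "\<lambda>k. k - 1"]) auto
  also have "(\<Sum>k<i. t k) + (\<Sum>k\<in>{i..q}. t (Suc k)) = (\<Sum>k\<le>q. delete_coordinate i t k)"
  proof -
    have "{..q} = {..<i} \<union> {i..q}"
      using t(3) by auto
    moreover have "(\<Sum>k\<in>{..<i} \<union> {i..q}. delete_coordinate i t k)
        = (\<Sum>k<i. delete_coordinate i t k) + (\<Sum>k\<in>{i..q}. delete_coordinate i t k)"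
      by (rule sum.union_disjoint) auto
    ultimately show ?thesis
      by (simp add: delete_coordinate_def)
  qed
  finally show ?thesis
    using t by (auto simp: standard_simplex_def delete_coordinate_def)
qed

lemma delete_coordinate_commute:
  assumes "i < j"
  shows "delete_coordinate i (delete_coordinate j t) = delete_coordinate (j - 1) (delete_coordinate i t)"
  using assms by (auto simp: delete_coordinate_def fun_eq_iff)

lemma closedin_simplex_topology_zero:
  "closedin (simplex_topology q) {t \<in> standard_simplex q. t i = 0}"
proof -
  have "closedin (simplex_topology q) {t \<in> topspace (simplex_topology q). t i \<in> {0}}"
    by (rule closedin_continuous_map_preimage[OF continuous_map_simplex_coordinate]) simp
  then show ?thesis
    by simp
qed

lemma subtopology_prism:
  assumes "T\<^sub>0 \<subseteq> T"
  shows "subtopology (prism T q) (T\<^sub>0 \<times> standard_simplex q) = prism T\<^sub>0 q"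
proof -
  have "T \<times> standard_simplex q \<inter> T\<^sub>0 \<times> standard_simplex q = T\<^sub>0 \<times> standard_simplex q"
    using assms by auto
  then show ?thesis
    by (simp add: prod_topology_subtopology(1) subtopology_subtopology)
qed

text \<open>A section of a system with constant fibre \<open>C\<close>, parametrised by
  \<open>T\<close>. The map \<open>\<gamma> (Suc q) i x\<close> carries values belonging to the i-th
  face of \<open>x\<close> into the fibre belonging to \<open>x\<close>; it need not be invertible,
  so this is weaker than a local system.\<close>

definition coherent_family ::
  "real set \<Rightarrow> (nat \<Rightarrow> 'x set) \<Rightarrow> (nat \<Rightarrow> nat \<Rightarrow> 'x \<Rightarrow> 'x) \<Rightarrow> 'c topology \<Rightarrow>
   (nat \<Rightarrow> nat \<Rightarrow> 'x \<Rightarrow> 'c \<Rightarrow> 'c) \<Rightarrow> (nat \<Rightarrow> 'x \<Rightarrow> real \<Rightarrow> (nat \<Rightarrow> real) \<Rightarrow> 'c) \<Rightarrow> bool" where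
  "coherent_family T X d C \<gamma> c \<longleftrightarrow>
     (\<forall>q. \<forall>x\<in>X q. continuous_map (prism T q) C (\<lambda>(u, t). c q x u t)) \<and>
     (\<forall>q. \<forall>x\<in>X (Suc q). \<forall>i\<le>Suc q. \<forall>u\<in>T. \<forall>t\<in>standard_simplex q.
        c (Suc q) x u (simplical_face i t) = \<gamma> (Suc q) i x (c q (d (Suc q) i x) u t))"

text \<open>The cocycle condition mirrors the identity for two successive faces. It makes the values
  prescribed on two facets agree on their common face of codimension two.\<close>

definition transition_maps ::
  "(nat \<Rightarrow> 'x set) \<Rightarrow> (nat \<Rightarrow> nat \<Rightarrow> 'x \<Rightarrow> 'x) \<Rightarrow> 'c topology \<Rightarrow> (nat \<Rightarrow> nat \<Rightarrow> 'x \<Rightarrow> 'c \<Rightarrow> 'c) \<Rightarrow> bool" where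
  "transition_maps X d C \<gamma> \<longleftrightarrow>
     (\<forall>q. \<forall>x\<in>X (Suc q). \<forall>i\<le>Suc q. continuous_map C C (\<gamma> (Suc q) i x)) \<and>
     (\<forall>q. \<forall>x\<in>X (Suc (Suc q)). \<forall>j\<le>Suc (Suc q). \<forall>i<j. \<forall>v\<in>topspace C.
        \<gamma> (Suc (Suc q)) j x (\<gamma> (Suc q) i (d (Suc (Suc q)) j x) v) =
        \<gamma> (Suc (Suc q)) i x (\<gamma> (Suc q) (j - 1) (d (Suc (Suc q)) i x) v))"

lemma coherent_family_continuous:
  assumes "coherent_family T X d C \<gamma> c" "x \<in> X q"
  shows "continuous_map (prism T q) C (\<lambda>(u, t). c q x u t)"
  using assms by (auto simp: coherent_family_def)

lemma coherent_family_face: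
  assumes "coherent_family T X d C \<gamma> c" "x \<in> X (Suc q)" "i \<le> Suc q" "u \<in> T" "t \<in> standard_simplex q"
  shows "c (Suc q) x u (simplical_face i t) = \<gamma> (Suc q) i x (c q (d (Suc q) i x) u t)"
  using assms by (auto simp: coherent_family_def)

text \<open>The facets and the part over \<open>T\<^sub>0\<close> are finitely many closed sets
  covering the prism boundary, so matching maps on them paste together; then the extension property
  applies.\<close>

lemma prism_filling:
  fixes f :: "nat \<Rightarrow> real \<Rightarrow> (nat \<Rightarrow> real) \<Rightarrow> 'c"
  assumes ext: "prism_extension T T\<^sub>0 C" and T\<^sub>0: "T\<^sub>0 \<subseteq> T" "closed T\<^sub>0"
    and f: "\<And>i. i \<le> Suc q \<Longrightarrow> continuous_map (prism T q) C (\<lambda>(u, t). f i u t)"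
    and b: "continuous_map (prism T\<^sub>0 (Suc q)) C (\<lambda>(u, t). b u t)"
    and bf: "\<And>i u t. i \<le> Suc q \<Longrightarrow> u \<in> T\<^sub>0 \<Longrightarrow> t \<in> standard_simplex q \<Longrightarrow> b u (simplical_face i t) = f i u t"
    and ff: "\<And>i j u t. i < j \<Longrightarrow> j \<le> Suc q \<Longrightarrow> u \<in> T \<Longrightarrow> t \<in> standard_simplex (Suc q) \<Longrightarrow>
      t i = 0 \<Longrightarrow> t j = 0 \<Longrightarrow> f i u (delete_coordinate i t) = f j u (delete_coordinate j t)"
  obtains g where "continuous_map (prism T (Suc q)) C (\<lambda>(u, t). g u t)"
    "\<And>i u t. i \<le> Suc q \<Longrightarrow> u \<in> T \<Longrightarrow> t \<in> standard_simplex q \<Longrightarrow> g u (simplical_face i t) = f i u t"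
    "\<And>u t. u \<in> T\<^sub>0 \<Longrightarrow> t \<in> standard_simplex (Suc q) \<Longrightarrow> g u t = b u t"
proof -
  let ?P = "subtopology (prism T (Suc q)) (prism_boundary T\<^sub>0 (Suc q))"
  \<comment> \<open>\<open>None\<close> stands for the part over \<open>T\<^sub>0\<close> and
    \<open>Some i\<close> for the i-th side, where \<open>delete_coordinate i\<close> recovers the
    coordinates of the facet.\<close>
  define I where "I = insert None (Some ` {..Suc q})"
  define D where "D = (\<lambda>k. case k of None \<Rightarrow> T\<^sub>0 \<times> standard_simplex (Suc q)
     | Some i \<Rightarrow> T \<times> {t \<in> standard_simplex (Suc q). t i = 0})"
  define h where "h = (\<lambda>k p. case k of None \<Rightarrow> b (fst p) (snd p)
     | Some i \<Rightarrow> f i (fst p) (delete_coordinate i (snd p)))"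
  obtain \<phi> where \<phi>: "continuous_map ?P C \<phi>"
    "\<And>p k. k \<in> I \<Longrightarrow> p \<in> topspace ?P \<inter> D k \<Longrightarrow> \<phi> p = h k p"
  proof (rule pasting_lemma_exists_closed[where X = ?P and I = I and T = D and Y = C and f = h])
    show "finite I"
      by (simp add: I_def)
    show "topspace ?P \<subseteq> \<Union> (D ` I)"
      by (auto simp: prism_boundary_def I_def D_def)
    have sub: "D k \<subseteq> prism_boundary T\<^sub>0 (Suc q)" if "k \<in> I" for k
      using that by (auto simp: I_def D_def prism_boundary_def)
    have clo: "closedin (prism T (Suc q)) (D k)" if "k \<in> I" for k
    proof (cases k)
      case None
      have "closedin (top_of_set T) T\<^sub>0"
        using T\<^sub>0 by (simp add: closed_subset)
      then show ?thesis
        by (simp add: None D_def closedin_prod_Times_iff flip: topspace_simplex_topology)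
    next
      case (Some i)
      then show ?thesis
        using closedin_simplex_topology_zero[of "Suc q" i]
        by (simp add: D_def closedin_prod_Times_iff)
    qed
    then show "closedin ?P (D k)" if "k \<in> I" for k
      using that sub by (simp add: closedin_subset_topspace)
    show "continuous_map (subtopology ?P (D k)) C (h k)" if "k \<in> I" for k
    proof -
      have eq: "subtopology ?P (D k) = subtopology (prism T (Suc q)) (D k)"
        using sub[OF that] by (simp add: subtopology_subtopology inf.absorb2)
      show ?thesis
      proof (cases k)
        case None
        have "subtopology (prism T (Suc q)) (D k) = prism T\<^sub>0 (Suc q)"
          using T\<^sub>0(1) by (simp add: None D_def subtopology_prism)
        then show ?thesis
          unfolding eq using b by (simp add: None h_def case_prod_unfold)
      next
        case (Some i)
        let ?S = "subtopology (simplex_topology (Suc q)) {t \<in> standard_simplex (Suc q). t i = 0}"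
        have i: "i \<le> Suc q"
          using that Some by (auto simp: I_def)
        have "subtopology (prism T (Suc q)) (D k) = prod_topology (top_of_set T) ?S"
          by (simp add: Some D_def prod_topology_subtopology subtopology_topspace)
        moreover have "continuous_map ?S (simplex_topology q) (delete_coordinate i)"
        proof (rule continuous_map_simplex_topologyI)
          show "continuous_map ?S euclideanreal (\<lambda>t. delete_coordinate i t k)" for k
            by (auto simp: delete_coordinate_def continuous_map_simplex_coordinate
                intro!: continuous_map_from_subtopology)
        qed (use i delete_coordinate_in_simplex in auto)
        then have "continuous_map (prod_topology (top_of_set T) ?S) (prism T q)
            (\<lambda>p. (fst p, delete_coordinate i (snd p)))"
          by (intro continuous_map_pairedI continuous_map_fst
              continuous_map_compose[OF continuous_map_snd, unfolded comp_def])
        then have "continuous_map (prod_topology (top_of_set T) ?S) C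
            ((\<lambda>(u, t). f i u t) \<circ> (\<lambda>p. (fst p, delete_coordinate i (snd p))))"
          by (rule continuous_map_compose[OF _ f[OF i]])
        ultimately show ?thesis
          unfolding eq by (simp add: Some h_def comp_def)
      qed
    qed
    have hbf: "h None p = h (Some i) p" if "Some i \<in> I" "p \<in> D None \<inter> D (Some i)" for i p
      using that bf[of i "fst p" "delete_coordinate i (snd p)"] delete_coordinate_in_simplex[of "snd p" q i]
      by (auto simp: h_def I_def D_def face_delete_coordinate)
    have hff: "h (Some i) p = h (Some j) p" if "i < j" "Some j \<in> I" "p \<in> D (Some i) \<inter> D (Some j)" for i j p
      using that ff[of i j "fst p" "snd p"] by (auto simp: h_def I_def D_def)
    show "h k p = h l p" if "k \<in> I" "l \<in> I" "p \<in> topspace ?P \<inter> D k \<inter> D l" for k l p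
    proof (cases k)
      case None
      show ?thesis
      proof (cases l)
        case (Some j)
        show ?thesis
          unfolding None Some by (rule hbf) (use that None Some in auto)
      qed (simp add: None)
    next
      case k: (Some i)
      show ?thesis
      proof (cases l)
        case None
        show ?thesis
          unfolding None k by (rule hbf[symmetric]) (use that None k in auto)
      next
        case (Some j)
        consider "i < j" | "i = j" | "j < i"
          by linarith
        then show ?thesis
        proof cases
          case 1
          then show ?thesis
            unfolding k Some by (rule hff) (use that Some k in auto)
        next
          case 3
          then show ?thesis
            unfolding k Some by (rule hff[symmetric]) (use that Some k in auto)
        qed (simp add: k Some)
      qed
    qed
  qed auto
  obtain \<psi> where \<psi>: "continuous_map (prism T (Suc q)) C \<psi>"
    "\<And>p. p \<in> topspace (prism T (Suc q)) \<inter> prism_boundary T\<^sub>0 (Suc q) \<Longrightarrow> \<psi> p = \<phi> p"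
    using ext \<phi>(1) unfolding prism_extension_def by blast
  show ?thesis
  proof (rule that[where g = "\<lambda>u t. \<psi> (u, t)"])
    show "continuous_map (prism T (Suc q)) C (\<lambda>(u, t). \<psi> (u, t))"
      using \<psi>(1) by (simp add: case_prod_unfold)
  next
    fix i u t assume *: "i \<le> Suc q" "u \<in> T" "t \<in> standard_simplex q"
    then have "simplical_face i t \<in> standard_simplex (Suc q)"
      by (intro simplical_face_in_simplex)
    moreover have "(u, simplical_face i t) \<in> prism_boundary T\<^sub>0 (Suc q)"
      using *(1) by (auto simp: prism_boundary_def)
    ultimately have "\<psi> (u, simplical_face i t) = h (Some i) (u, simplical_face i t)"
      using * \<psi>(2) \<phi>(2)[of "Some i"] by (simp add: I_def D_def)
    then show "\<psi> (u, simplical_face i t) = f i u t"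
      by (simp add: h_def)
  next
    fix u t assume *: "u \<in> T\<^sub>0" "t \<in> standard_simplex (Suc q)"
    then show "\<psi> (u, t) = b u t"
      using \<psi>(2)[of "(u, t)"] \<phi>(2)[of None "(u, t)"] T\<^sub>0(1)
      by (auto simp: I_def D_def h_def prism_boundary_def)
  qed
qed

text \<open>Induction over skeleta: the faces of a simplex prescribe its values on the boundary, and
  the prism extension property fills the interior. A vertex has no faces, so its values may be
  imposed; \<open>L\<close> is the set of vertices where this is done.\<close>

theorem coherent_family_extension:
  fixes X :: "nat \<Rightarrow> 'x set" and C :: "'c topology"
    and b :: "nat \<Rightarrow> 'x \<Rightarrow> real \<Rightarrow> (nat \<Rightarrow> real) \<Rightarrow> 'c"
  assumes X: "delta_set X d" and \<gamma>: "transition_maps X d C \<gamma>"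
    and ext: "prism_extension T T\<^sub>0 C" and T\<^sub>0: "T\<^sub>0 \<subseteq> T" "closed T\<^sub>0"
    and b: "coherent_family T\<^sub>0 X d C \<gamma> b"
    and l: "\<And>x. x \<in> L \<Longrightarrow> x \<in> X 0 \<Longrightarrow> continuous_map (top_of_set T) C (l x)"
    and bl: "\<And>x u t. x \<in> L \<Longrightarrow> x \<in> X 0 \<Longrightarrow> u \<in> T\<^sub>0 \<Longrightarrow> t \<in> standard_simplex 0 \<Longrightarrow> b 0 x u t = l x u"
  obtains c where "coherent_family T X d C \<gamma> c"
    "\<And>q x u t. x \<in> X q \<Longrightarrow> u \<in> T\<^sub>0 \<Longrightarrow> t \<in> standard_simplex q \<Longrightarrow> c q x u t = b q x u t"
    "\<And>x u t. x \<in> L \<Longrightarrow> x \<in> X 0 \<Longrightarrow> u \<in> T \<Longrightarrow> t \<in> standard_simplex 0 \<Longrightarrow> c 0 x u t = l x u"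
proof -
  \<comment> \<open>The third clause, agreement on overlaps of the facets of (q + 1)-simplices, is
    what the next filling needs. Carrying it in the invariant lets each stage depend on the
    preceding stage alone.\<close>
  define P :: "nat \<Rightarrow> ('x \<Rightarrow> real \<Rightarrow> (nat \<Rightarrow> real) \<Rightarrow> 'c) \<Rightarrow> bool" where "P = (\<lambda>q f.
    (\<forall>x\<in>X q. continuous_map (prism T q) C (\<lambda>(u, t). f x u t)) \<and>
    (\<forall>x\<in>X q. \<forall>u\<in>T\<^sub>0. \<forall>t\<in>standard_simplex q. f x u t = b q x u t) \<and>
    (\<forall>x\<in>X (Suc q). \<forall>j\<le>Suc q. \<forall>i<j. \<forall>u\<in>T. \<forall>t\<in>standard_simplex (Suc q). t i = 0 \<longrightarrow> t j = 0 \<longrightarrow>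
       \<gamma> (Suc q) i x (f (d (Suc q) i x) u (delete_coordinate i t)) =
       \<gamma> (Suc q) j x (f (d (Suc q) j x) u (delete_coordinate j t))) \<and>
    (q = 0 \<longrightarrow> (\<forall>x\<in>X 0 \<inter> L. \<forall>u\<in>T. \<forall>t\<in>standard_simplex 0. f x u t = l x u)))"
  define Q :: "nat \<Rightarrow> ('x \<Rightarrow> real \<Rightarrow> (nat \<Rightarrow> real) \<Rightarrow> 'c) \<Rightarrow> ('x \<Rightarrow> real \<Rightarrow> (nat \<Rightarrow> real) \<Rightarrow> 'c) \<Rightarrow> bool" where "Q = (\<lambda>q f g.
    \<forall>x\<in>X (Suc q). \<forall>i\<le>Suc q. \<forall>u\<in>T. \<forall>t\<in>standard_simplex q.
      g x u (simplical_face i t) = \<gamma> (Suc q) i x (f (d (Suc q) i x) u t))"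
  have "\<exists>f. \<forall>n. P n (f n) \<and> Q n (f n) (f (Suc n))"
  proof (rule dependent_nat_choice)
    have "\<exists>g. continuous_map (prism T 0) C (\<lambda>(u, t). g u t) \<and>
        (\<forall>u\<in>T\<^sub>0. \<forall>t\<in>standard_simplex 0. g u t = b 0 x u t) \<and>
        (x \<in> L \<longrightarrow> (\<forall>u\<in>T. \<forall>t\<in>standard_simplex 0. g u t = l x u))" if x: "x \<in> X 0" for x
    proof (cases "x \<in> L")
      case True
      have "continuous_map (prism T 0) C (l x \<circ> fst)"
        by (rule continuous_map_compose[OF continuous_map_fst l[OF True x]])
      then show ?thesis
        using True bl x by (intro exI[of _ "\<lambda>u t. l x u"]) (auto simp: case_prod_unfold comp_def)
    next
      case False
      \<comment> \<open>The only coordinate of the 0-simplex is 1, so the prism over it has no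
        sides.\<close>
      have bd: "topspace (prism T 0) \<inter> prism_boundary T\<^sub>0 0 = T\<^sub>0 \<times> standard_simplex 0"
        using T\<^sub>0(1) by (auto simp: prism_boundary_def standard_simplex_0)
      have "subtopology (prism T 0) (prism_boundary T\<^sub>0 0) = subtopology (prism T 0) (T\<^sub>0 \<times> standard_simplex 0)"
        by (metis bd subtopology_restrict)
      also have "\<dots> = prism T\<^sub>0 0"
        using T\<^sub>0(1) by (rule subtopology_prism)
      finally have "continuous_map (subtopology (prism T 0) (prism_boundary T\<^sub>0 0)) C (\<lambda>(u, t). b 0 x u t)"
        using coherent_family_continuous[OF b x] by simp
      then obtain \<psi> where "continuous_map (prism T 0) C \<psi>"
        "\<And>p. p \<in> T\<^sub>0 \<times> standard_simplex 0 \<Longrightarrow> \<psi> p = (case p of (u, t) \<Rightarrow> b 0 x u t)"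
        using ext unfolding prism_extension_def bd[symmetric] by blast
      then show ?thesis
        using False by (intro exI[of _ "\<lambda>u t. \<psi> (u, t)"]) (auto simp: case_prod_unfold)
    qed
    then obtain f where f: "\<And>x. x \<in> X 0 \<Longrightarrow> continuous_map (prism T 0) C (\<lambda>(u, t). f x u t) \<and>
        (\<forall>u\<in>T\<^sub>0. \<forall>t\<in>standard_simplex 0. f x u t = b 0 x u t) \<and>
        (x \<in> L \<longrightarrow> (\<forall>u\<in>T. \<forall>t\<in>standard_simplex 0. f x u t = l x u))"
      by metis
    \<comment> \<open>The two ends of an edge are disjoint, so the overlap clause is vacuous at the
      start.\<close>
    have "False" if "i < j" "j \<le> Suc 0" "t \<in> standard_simplex (Suc 0)" "t i = 0" "t j = 0"
      for i j and t :: "nat \<Rightarrow> real"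
    proof -
      have ij: "i = 0" "j = 1"
        using that(1,2) by linarith+
      have "t 0 = 0" "t 1 = 0"
        using that(4,5) unfolding ij by simp_all
      then show False
        using that(3) by (simp add: standard_simplex_def)
    qed
    with f show "\<exists>f. P 0 f"
      unfolding P_def by (intro exI[of _ f]) blast
  next
    fix f n assume f: "P n f"
    have "\<exists>g. continuous_map (prism T (Suc n)) C (\<lambda>(u, t). g u t) \<and>
        (\<forall>i\<le>Suc n. \<forall>u\<in>T. \<forall>t\<in>standard_simplex n.
           g u (simplical_face i t) = \<gamma> (Suc n) i x (f (d (Suc n) i x) u t)) \<and>
        (\<forall>u\<in>T\<^sub>0. \<forall>t\<in>standard_simplex (Suc n). g u t = b (Suc n) x u t)" if x: "x \<in> X (Suc n)" for x
    proof (rule prism_filling[OF ext T\<^sub>0, where q = n and b = "b (Suc n) x"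
          and f = "\<lambda>i u t. \<gamma> (Suc n) i x (f (d (Suc n) i x) u t)"])
      fix i assume i: "i \<le> Suc n"
      have "continuous_map (prism T n) C (\<lambda>(u, t). f (d (Suc n) i x) u t)"
        using f delta_set_face[where X = X and d = d, OF X x i] unfolding P_def by blast
      then have "continuous_map (prism T n) C (\<gamma> (Suc n) i x \<circ> (\<lambda>(u, t). f (d (Suc n) i x) u t))"
        by (rule continuous_map_compose) (use \<gamma> x i in \<open>auto simp: transition_maps_def\<close>)
      then show "continuous_map (prism T n) C (\<lambda>(u, t). \<gamma> (Suc n) i x (f (d (Suc n) i x) u t))"
        by (simp add: comp_def case_prod_unfold)
      show "b (Suc n) x u (simplical_face i t) = \<gamma> (Suc n) i x (f (d (Suc n) i x) u t)"
        if "u \<in> T\<^sub>0" "t \<in> standard_simplex n" for u t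
        using f that coherent_family_face[where X = X and d = d, OF b x i that]
          delta_set_face[where X = X and d = d, OF X x i] unfolding P_def by simp
    next
      show "continuous_map (prism T\<^sub>0 (Suc n)) C (\<lambda>(u, t). b (Suc n) x u t)"
        by (rule coherent_family_continuous[OF b x])
    qed (use f x in \<open>auto simp: P_def\<close>)
    then obtain g where g: "\<And>x. x \<in> X (Suc n) \<Longrightarrow> continuous_map (prism T (Suc n)) C (\<lambda>(u, t). g x u t) \<and>
        (\<forall>i\<le>Suc n. \<forall>u\<in>T. \<forall>t\<in>standard_simplex n.
           g x u (simplical_face i t) = \<gamma> (Suc n) i x (f (d (Suc n) i x) u t)) \<and>
        (\<forall>u\<in>T\<^sub>0. \<forall>t\<in>standard_simplex (Suc n). g x u t = b (Suc n) x u t)"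
      by metis
    have overlap: "\<gamma> (Suc (Suc n)) i x (g (d (Suc (Suc n)) i x) u (delete_coordinate i t)) =
       \<gamma> (Suc (Suc n)) j x (g (d (Suc (Suc n)) j x) u (delete_coordinate j t))"
      if x: "x \<in> X (Suc (Suc n))" and ij: "i < j" "j \<le> Suc (Suc n)" and u: "u \<in> T"
        and t: "t \<in> standard_simplex (Suc (Suc n))" "t i = 0" "t j = 0" for x i j u t
    proof -
      \<comment> \<open>The coordinates of \<open>t\<close> on the common face of codimension two.
        Both sides reduce to the value of \<open>f\<close> there, transported along the two orders
        of taking faces, and the cocycle condition identifies the results.\<close>
      define s where "s = delete_coordinate i (delete_coordinate j t)"
      have s': "s = delete_coordinate (j - 1) (delete_coordinate i t)"
        using ij by (simp add: s_def delete_coordinate_commute)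
      have di: "d (Suc (Suc n)) i x \<in> X (Suc n)" and dj: "d (Suc (Suc n)) j x \<in> X (Suc n)"
        using delta_set_face[where X = X and d = d, OF X x] ij by auto
      have zi: "delete_coordinate j t i = 0" and zj: "delete_coordinate i t (j - 1) = 0"
        using ij t by (auto simp: delete_coordinate_def)
      have ti: "delete_coordinate i t = simplical_face (j - 1) s"
        unfolding s' using face_delete_coordinate[of "delete_coordinate i t" "j - 1", OF zj] by (rule sym)
      have tj: "delete_coordinate j t = simplical_face i s"
        by (simp add: s_def face_delete_coordinate zi)
      have "delete_coordinate j t \<in> standard_simplex (Suc n)"
        using ij t by (intro delete_coordinate_in_simplex) auto
      then have s: "s \<in> standard_simplex n"
        unfolding s_def by (rule delete_coordinate_in_simplex) (use ij zi in auto)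
      have gi: "g (d (Suc (Suc n)) i x) u (simplical_face (j - 1) s) =
          \<gamma> (Suc n) (j - 1) (d (Suc (Suc n)) i x) (f (d (Suc n) (j - 1) (d (Suc (Suc n)) i x)) u s)"
        using g[OF di] ij u s by auto
      have gj: "g (d (Suc (Suc n)) j x) u (simplical_face i s) =
          \<gamma> (Suc n) i (d (Suc (Suc n)) j x) (f (d (Suc n) i (d (Suc (Suc n)) j x)) u s)"
        using g[OF dj] ij u s by auto
      have dd: "d (Suc n) i (d (Suc (Suc n)) j x) = d (Suc n) (j - 1) (d (Suc (Suc n)) i x)"
        using delta_set_face_face[where X = X and d = d, OF X x ij] .
      have "d (Suc n) i (d (Suc (Suc n)) j x) \<in> X n"
        using delta_set_face[where X = X and d = d, OF X dj] ij by auto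
      then have "continuous_map (prism T n) C (\<lambda>(u, t). f (d (Suc n) i (d (Suc (Suc n)) j x)) u t)"
        using f unfolding P_def by blast
      then have "f (d (Suc n) i (d (Suc (Suc n)) j x)) u s \<in> topspace C"
        using u s continuous_map_image_subset_topspace by fastforce
      then show ?thesis
        unfolding ti tj gi gj using \<gamma> x ij by (simp add: transition_maps_def dd)
    qed
    show "\<exists>g. P (Suc n) g \<and> Q n f g"
    proof (intro exI[of _ g] conjI)
      show "P (Suc n) g"
        unfolding P_def
      proof (intro conjI)
        show "\<forall>x\<in>X (Suc n). continuous_map (prism T (Suc n)) C (\<lambda>(u, t). g x u t)"
          using g by blast
        show "\<forall>x\<in>X (Suc n). \<forall>u\<in>T\<^sub>0. \<forall>t\<in>standard_simplex (Suc n). g x u t = b (Suc n) x u t"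
          using g by blast
      qed (use overlap in blast)+
      show "Q n f g"
        using g unfolding Q_def by blast
    qed
  qed
  then obtain f where f: "\<And>n. P n (f n)" "\<And>n. Q n (f n) (f (Suc n))"
    by blast
  show ?thesis
  proof (rule that[of f])
    show "coherent_family T X d C \<gamma> f"
      unfolding coherent_family_def
    proof (intro conjI allI ballI impI)
      show "continuous_map (prism T q) C (\<lambda>(u, t). f q x u t)" if "x \<in> X q" for q x
        using f(1)[of q] that unfolding P_def by blast
      show "f (Suc q) x u (simplical_face i t) = \<gamma> (Suc q) i x (f q (d (Suc q) i x) u t)"
        if "x \<in> X (Suc q)" "i \<le> Suc q" "u \<in> T" "t \<in> standard_simplex q" for q x i u t
        using f(2)[of q] that unfolding Q_def by blast
    qed
    show "f q x u t = b q x u t" if "x \<in> X q" "u \<in> T\<^sub>0" "t \<in> standard_simplex q" for q x u t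
      using f(1)[of q] that unfolding P_def by blast
    show "f 0 x u t = l x u" if "x \<in> L" "x \<in> X 0" "u \<in> T" "t \<in> standard_simplex 0" for x u t
      using f(1)[of 0] that unfolding P_def by blast
  qed
qed

definition coherent_maps ::
  "(nat \<Rightarrow> 'x set) \<Rightarrow> (nat \<Rightarrow> nat \<Rightarrow> 'x \<Rightarrow> 'x) \<Rightarrow> 'c topology \<Rightarrow>
   (nat \<Rightarrow> nat \<Rightarrow> 'x \<Rightarrow> 'c \<Rightarrow> 'c) \<Rightarrow> (nat \<Rightarrow> 'x \<Rightarrow> (nat \<Rightarrow> real) \<Rightarrow> 'c) \<Rightarrow> bool" where
  "coherent_maps X d C \<gamma> c \<longleftrightarrow>
     (\<forall>q. \<forall>x\<in>X q. continuous_map (simplex_topology q) C (c q x)) \<and>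
     (\<forall>q. \<forall>x\<in>X (Suc q). \<forall>i\<le>Suc q. \<forall>t\<in>standard_simplex q.
        c (Suc q) x (simplical_face i t) = \<gamma> (Suc q) i x (c q (d (Suc q) i x) t))"

lemma coherent_mapsI:
  assumes "\<And>q x. x \<in> X q \<Longrightarrow> continuous_map (simplex_topology q) C (c q x)"
    and "\<And>q x i t. x \<in> X (Suc q) \<Longrightarrow> i \<le> Suc q \<Longrightarrow> t \<in> standard_simplex q \<Longrightarrow>
      c (Suc q) x (simplical_face i t) = \<gamma> (Suc q) i x (c q (d (Suc q) i x) t)"
  shows "coherent_maps X d C \<gamma> c"
  using assms by (simp add: coherent_maps_def)

lemma coherent_maps_continuous:
  assumes "coherent_maps X d C \<gamma> c" "x \<in> X q"
  shows "continuous_map (simplex_topology q) C (c q x)"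
  using assms by (simp add: coherent_maps_def)

lemma coherent_maps_face:
  assumes "coherent_maps X d C \<gamma> c" "x \<in> X (Suc q)" "i \<le> Suc q" "t \<in> standard_simplex q"
  shows "c (Suc q) x (simplical_face i t) = \<gamma> (Suc q) i x (c q (d (Suc q) i x) t)"
  using assms by (simp add: coherent_maps_def)

lemma coherent_maps_in_topspace:
  assumes "coherent_maps X d C \<gamma> c" "x \<in> X q" "t \<in> standard_simplex q"
  shows "c q x t \<in> topspace C"
  using continuous_map_image_subset_topspace[OF coherent_maps_continuous[OF assms(1,2)]] assms(3) by auto

lemma coherent_family_slice:
  assumes c: "coherent_family T X d C \<gamma> c" and u: "u \<in> T"
  shows "coherent_maps X d C \<gamma> (\<lambda>q x t. c q x u t)"
proof (rule coherent_mapsI)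
  fix q x assume x: "x \<in> X q"
  have "continuous_map (simplex_topology q) (prism T q) (\<lambda>t. (u, t))"
    using u by (intro continuous_map_pairedI) auto
  from continuous_map_compose[OF this coherent_family_continuous[OF c x]]
  show "continuous_map (simplex_topology q) C (\<lambda>t. c q x u t)"
    by (simp add: comp_def)
qed (use coherent_family_face[OF c] u in blast)

text \<open>A finite set of reals is discrete, so continuity on the prism can be checked slice by
  slice. This supplies the data over \<open>T\<^sub>0\<close>.\<close>

lemma coherent_family_finite:
  assumes T: "finite T" and c: "\<And>u. u \<in> T \<Longrightarrow> coherent_maps X d C \<gamma> (\<lambda>q x t. c q x u t)"
  shows "coherent_family T X d C \<gamma> c"
  unfolding coherent_family_def
proof (intro conjI allI ballI impI)
  fix q x assume x: "x \<in> X q"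
  show "continuous_map (prism T q) C (\<lambda>(u, t). c q x u t)"
  proof (rule pasting_lemma_closed[where I = T and T = "\<lambda>u. {u} \<times> standard_simplex q" and f = "\<lambda>_ (u, t). c q x u t"])
    fix u assume u: "u \<in> T"
    show "closedin (prism T q) ({u} \<times> standard_simplex q)"
      using u by (simp add: closedin_prod_Times_iff closed_subset flip: topspace_simplex_topology)
    have "continuous_map (prism {u} q) C (c q x u \<circ> snd)"
      by (rule continuous_map_compose[OF continuous_map_snd coherent_maps_continuous[OF c[OF u] x]])
    then have "continuous_map (prism {u} q) C (\<lambda>(u, t). c q x u t)"
      by (rule continuous_map_eq) auto
    then show "continuous_map (subtopology (prism T q) ({u} \<times> standard_simplex q)) C (\<lambda>(u, t). c q x u t)"
      using u by (simp add: subtopology_prism)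
  qed (use T in auto)
qed (use coherent_maps_face[OF c] in blast)

text \<open>The case of one parameter value and no prescribed data; with \<open>T\<^sub>0\<close>
  and \<open>L\<close> empty the default values are never consulted.\<close>

lemma coherent_maps_exist:
  assumes "delta_set X d" "transition_maps X d C \<gamma>" "contractible_space C" "topspace C \<noteq> {}"
  obtains c where "coherent_maps X d C \<gamma> c"
proof (rule coherent_family_extension[OF assms(1,2) prism_extension_point[OF assms(3,4)],
      where b = "\<lambda>_ _ _ _. undefined" and L = "{}" and l = "\<lambda>_ _. undefined"])
  show "coherent_family {} X d C \<gamma> (\<lambda>_ _ _ _. undefined)"
    by (rule coherent_family_finite) auto
  fix c assume "coherent_family {0::real} X d C \<gamma> c"
  then show thesis
    using that[OF coherent_family_slice[of "{0}" X d C \<gamma> c 0]] by simp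
qed auto

text \<open>Contractibility fills the cylinder between the two families cell by cell. At vertices of
  \<open>L\<close>, where the families agree, the homotopy can be imposed to be stationary.\<close>

lemma coherent_maps_homotopic:
  assumes X: "delta_set X d" "transition_maps X d C \<gamma>" and C: "contractible_space C"
    and c: "coherent_maps X d C \<gamma> c\<^sub>0" "coherent_maps X d C \<gamma> c\<^sub>1"
    and L: "\<And>x. x \<in> L \<Longrightarrow> x \<in> X 0 \<Longrightarrow> c\<^sub>0 0 x (\<lambda>i. if i = 0 then 1 else 0) = c\<^sub>1 0 x (\<lambda>i. if i = 0 then 1 else 0)"
  obtains c where "coherent_family {0..1} X d C \<gamma> c"
    "\<And>q x t. x \<in> X q \<Longrightarrow> t \<in> standard_simplex q \<Longrightarrow> c q x 0 t = c\<^sub>0 q x t"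
    "\<And>q x t. x \<in> X q \<Longrightarrow> t \<in> standard_simplex q \<Longrightarrow> c q x 1 t = c\<^sub>1 q x t"
    "\<And>x u t. x \<in> L \<Longrightarrow> x \<in> X 0 \<Longrightarrow> u \<in> {0..1} \<Longrightarrow> t \<in> standard_simplex 0 \<Longrightarrow> c 0 x u t = c\<^sub>0 0 x t"
proof (cases "topspace C = {}")
  case True
  then have "x \<notin> X q" for q x
    using coherent_maps_in_topspace[OF c(1)] nonempty_standard_simplex by blast
  then show thesis
    by (intro that[of "\<lambda>_ _ _ _. undefined"]) (auto simp: coherent_family_def)
next
  case False
  define b where "b = (\<lambda>q x u t. if u = (0::real) then c\<^sub>0 q x t else c\<^sub>1 q x t)"
  have b: "coherent_family {0, 1} X d C \<gamma> b"
  proof (rule coherent_family_finite)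
    fix u :: real assume "u \<in> {0, 1}"
    then have "(\<lambda>q x t. b q x u t) = c\<^sub>0 \<or> (\<lambda>q x t. b q x u t) = c\<^sub>1"
      by (auto simp: b_def)
    then show "coherent_maps X d C \<gamma> (\<lambda>q x t. b q x u t)"
      using c by auto
  qed simp
  show thesis
  proof (rule coherent_family_extension[OF X prism_extension_interval[OF C False] _ _ b,
        where L = L and l = "\<lambda>x _. c\<^sub>0 0 x (\<lambda>i. if i = 0 then 1 else 0)"])
    fix x assume "x \<in> L" "x \<in> X 0"
    then show "continuous_map unit_interval C (\<lambda>_. c\<^sub>0 0 x (\<lambda>i. if i = 0 then 1 else 0))"
      using coherent_maps_in_topspace[OF c(1), of x 0] by (simp add: standard_simplex_0)
  next
    fix c' assume "coherent_family {0..1} X d C \<gamma> c'"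
      "\<And>q x u t. x \<in> X q \<Longrightarrow> u \<in> {0, 1} \<Longrightarrow> t \<in> standard_simplex q \<Longrightarrow> c' q x u t = b q x u t"
      "\<And>x u t. x \<in> L \<Longrightarrow> x \<in> X 0 \<Longrightarrow> u \<in> {0..1} \<Longrightarrow> t \<in> standard_simplex 0 \<Longrightarrow>
         c' 0 x u t = c\<^sub>0 0 x (\<lambda>i. if i = 0 then 1 else 0)"
    then show thesis
      by (intro that[of c']) (auto simp: b_def standard_simplex_0)
  qed (use L in \<open>auto simp: b_def standard_simplex_0\<close>)
qed

text \<open>Such a \<pi> does not see the transition maps, so it turns a coherent family into a
  compatible one, that is, into an ordinary map or homotopy on the realization.\<close>

definition invariant_map ::
  "(nat \<Rightarrow> 'x set) \<Rightarrow> 'c topology \<Rightarrow> (nat \<Rightarrow> nat \<Rightarrow> 'x \<Rightarrow> 'c \<Rightarrow> 'c) \<Rightarrow> 'y topology \<Rightarrow> ('c \<Rightarrow> 'y) \<Rightarrow> bool" where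
  "invariant_map X C \<gamma> Y \<pi> \<longleftrightarrow> continuous_map C Y \<pi> \<and>
     (\<forall>q. \<forall>x\<in>X (Suc q). \<forall>i\<le>Suc q. \<forall>v\<in>topspace C. \<pi> (\<gamma> (Suc q) i x v) = \<pi> v)"

lemma coherent_maps_compatible:
  assumes X: "delta_set X d" and c: "coherent_maps X d C \<gamma> c" and \<pi>: "invariant_map X C \<gamma> Y \<pi>"
  shows "compatible_family X d (\<lambda>q x t. \<pi> (c q x t))"
proof (rule compatible_familyI)
  fix q x i t assume *: "x \<in> X (Suc q)" "i \<le> Suc q" "t \<in> standard_simplex q"
  then have "c q (d (Suc q) i x) t \<in> topspace C"
    using coherent_maps_in_topspace[OF c] delta_set_face[where X = X, OF X] by blast
  then show "\<pi> (c (Suc q) x (simplical_face i t)) = \<pi> (c q (d (Suc q) i x) t)"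
    using * coherent_maps_face[OF c *] \<pi> by (simp add: invariant_map_def)
qed

lemma coherent_maps_continuous_map:
  assumes X: "delta_set X d" and c: "coherent_maps X d C \<gamma> c" and \<pi>: "invariant_map X C \<gamma> Y \<pi>"
  shows "continuous_map (realization X d) Y (rlift (\<lambda>q x t. \<pi> (c q x t)))"
  using continuous_map_compose[OF coherent_maps_continuous[OF c]] \<pi>
  by (intro continuous_map_realization[OF coherent_maps_compatible[OF X c \<pi>]])
    (auto simp: invariant_map_def comp_def)

lemma coherent_family_homotopic:
  assumes X: "delta_set X d" and c: "coherent_family {0..1} X d C \<gamma> c" and \<pi>: "invariant_map X C \<gamma> Y \<pi>"
    and "\<And>q x t. x \<in> X q \<Longrightarrow> t \<in> standard_simplex q \<Longrightarrow> f (rpt X d q x t) = \<pi> (c q x 0 t)"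
    and "\<And>q x t. x \<in> X q \<Longrightarrow> t \<in> standard_simplex q \<Longrightarrow> g (rpt X d q x t) = \<pi> (c q x 1 t)"
  shows "homotopic_with (\<lambda>_. True) (realization X d) Y f g"
proof (rule homotopic_with_realization[where F = "\<lambda>u q x t. \<pi> (c q x u t)"])
  show "compatible_family X d (\<lambda>q x t. \<pi> (c q x u t))" if "u \<in> {0..1}" for u
    using coherent_maps_compatible[OF X coherent_family_slice[OF c that] \<pi>] .
  fix q x assume "x \<in> X q"
  then have "continuous_map (prism {0..1} q) Y (\<pi> \<circ> (\<lambda>(u, t). c q x u t))"
    using \<pi> by (intro continuous_map_compose[OF coherent_family_continuous[OF c]]) (auto simp: invariant_map_def)
  then show "continuous_map (prism {0..1} q) Y (\<lambda>(u, t). \<pi> (c q x u t))"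
    by (simp add: comp_def case_prod_unfold)
qed (use assms in auto)

abbreviation "trivial_transition \<equiv> (\<lambda>_ _ _ v. v)"

lemma transition_maps_trivial [simp]: "transition_maps X d C trivial_transition"
  by (simp add: transition_maps_def)

lemma invariant_map_trivial [simp]: "invariant_map X C trivial_transition Y \<pi> \<longleftrightarrow> continuous_map C Y \<pi>"
  by (simp add: invariant_map_def)

lemma coherent_maps_trivial:
  assumes "\<And>q x. x \<in> X q \<Longrightarrow> continuous_map (simplex_topology q) C (c q x)" "compatible_family X d c"
  shows "coherent_maps X d C trivial_transition c"
  using assms by (intro coherent_mapsI) (auto simp: compatible_family_def)

section \<open>Maps of Delta-sets\<close>

definition delta_map ::
  "(nat \<Rightarrow> 'x set) \<Rightarrow> (nat \<Rightarrow> nat \<Rightarrow> 'x \<Rightarrow> 'x) \<Rightarrow> (nat \<Rightarrow> 'y set) \<Rightarrow> (nat \<Rightarrow> nat \<Rightarrow> 'y \<Rightarrow> 'y) \<Rightarrow> ('x \<Rightarrow> 'y) \<Rightarrow> bool" where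
  "delta_map X d Y d' \<phi> \<longleftrightarrow>
     (\<forall>q. \<forall>x\<in>X q. \<phi> x \<in> Y q) \<and>
     (\<forall>q. \<forall>x\<in>X (Suc q). \<forall>i\<le>Suc q. \<phi> (d (Suc q) i x) = d' (Suc q) i (\<phi> x))"

definition rmap ::
  "(nat \<Rightarrow> 'y set) \<Rightarrow> (nat \<Rightarrow> nat \<Rightarrow> 'y \<Rightarrow> 'y) \<Rightarrow> ('x \<Rightarrow> 'y) \<Rightarrow>
   (nat \<times> 'x \<times> (nat \<Rightarrow> real)) set \<Rightarrow> (nat \<times> 'y \<times> (nat \<Rightarrow> real)) set" where
  "rmap Y d' \<phi> = rlift (\<lambda>q x t. rpt Y d' q (\<phi> x) t)"

lemma delta_map_compatible:
  assumes "delta_map X d Y d' \<phi>"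
  shows "compatible_family X d (\<lambda>q x t. rpt Y d' q (\<phi> x) t)"
proof (rule compatible_familyI)
  fix q x i t assume *: "x \<in> X (Suc q)" "i \<le> Suc q" "t \<in> standard_simplex q"
  then have "\<phi> x \<in> Y (Suc q)" "\<phi> (d (Suc q) i x) = d' (Suc q) i (\<phi> x)"
    using assms by (auto simp: delta_map_def)
  then show "rpt Y d' (Suc q) (\<phi> x) (simplical_face i t) = rpt Y d' q (\<phi> (d (Suc q) i x)) t"
    using rpt_face[of "\<phi> x" Y q i t d'] * by simp
qed

lemma rmap_rpt:
  assumes "delta_map X d Y d' \<phi>"
  shows "rmap Y d' \<phi> (rpt X d q x t) = rpt Y d' q (\<phi> x) t"
  unfolding rmap_def by (rule rlift_rpt[OF delta_map_compatible[OF assms]])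

lemma continuous_map_rmap:
  assumes "delta_map X d Y d' \<phi>"
  shows "continuous_map (realization X d) (realization Y d') (rmap Y d' \<phi>)"
  unfolding rmap_def using assms
  by (intro continuous_map_realization[OF delta_map_compatible[OF assms]] continuous_map_rpt)
    (auto simp: delta_map_def)

lemma delta_map_subset:
  assumes "\<And>q. X q \<subseteq> Y q"
  shows "delta_map X d Y d (\<lambda>x. x)"
  using assms by (auto simp: delta_map_def)

lemma delta_set_subset:
  assumes "delta_set Y d" "\<And>q. X q \<subseteq> Y q"
    and "\<And>q x i. x \<in> X (Suc q) \<Longrightarrow> i \<le> Suc q \<Longrightarrow> d (Suc q) i x \<in> X q"
  shows "delta_set X d"
  unfolding delta_set_def
proof (intro conjI allI ballI impI)
  fix q x j i assume "x \<in> X (Suc (Suc q))" "j \<le> Suc (Suc q)" "i < j"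
  then show "d (Suc q) i (d (Suc (Suc q)) j x) = d (Suc q) (j - 1) (d (Suc (Suc q)) i x)"
    using assms(2) by (intro delta_set_face_face[where X = Y, OF assms(1)]) auto
qed (use assms in auto)

abbreviation vertex0 :: "nat \<Rightarrow> real" where
  "vertex0 \<equiv> (\<lambda>i. if i = 0 then 1 else 0)"

section \<open>Extra degeneracies\<close>

definition cone_coordinates :: "real \<Rightarrow> (nat \<Rightarrow> real) \<Rightarrow> nat \<Rightarrow> real" where
  "cone_coordinates u t = (\<lambda>i. if i = 0 then u else (1 - u) * t (i - 1))"

lemma cone_coordinates_in_simplex:
  assumes "u \<in> {0..1}" "t \<in> standard_simplex q"
  shows "cone_coordinates u t \<in> standard_simplex (Suc q)"
proof -
  have "(\<lambda>i. (1 - u) * simplical_face 0 t i + u * vertex0 i) \<in> standard_simplex (Suc q)"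
    using assms by (intro convex_standard_simplex simplical_face_in_simplex) auto
  also have "(\<lambda>i. (1 - u) * simplical_face 0 t i + u * vertex0 i) = cone_coordinates u t"
    by (auto simp: cone_coordinates_def simplical_face_def)
  finally show ?thesis .
qed

text \<open>The simplex \<open>h x\<close> is a cone on \<open>x\<close>: its 0-th face is
  \<open>x\<close>, its other faces are the cones on the faces of \<open>x\<close>, and its apex is
  \<open>v\<close>. Sliding every point towards the apex contracts the realization.\<close>

lemma contractible_extra_degeneracy:
  assumes X: "delta_set X d" and v: "v \<in> X 0"
    and h: "\<And>q x. x \<in> X q \<Longrightarrow> h x \<in> X (Suc q)"
    and h0: "\<And>q x. x \<in> X q \<Longrightarrow> d (Suc q) 0 (h x) = x"
    and hSuc: "\<And>q x i. x \<in> X (Suc q) \<Longrightarrow> i \<le> Suc q \<Longrightarrow>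
      d (Suc (Suc q)) (Suc i) (h x) = h (d (Suc q) i x)"
    and h1: "\<And>x. x \<in> X 0 \<Longrightarrow> d 1 1 (h x) = v"
  shows "contractible_space (realization X d)"
proof -
  define F where "F = (\<lambda>u q x t. rpt X d (Suc q) (h x) (cone_coordinates u t))"
  have F0: "F 0 q x t = rpt X d q x t" if x: "x \<in> X q" and t: "t \<in> standard_simplex q" for q x t
  proof -
    have "cone_coordinates 0 t = simplical_face 0 t"
      by (auto simp: cone_coordinates_def simplical_face_def)
    then show ?thesis
      using rpt_face[of "h x" X q 0 t d] h[OF x] h0[OF x] t by (simp add: F_def)
  qed
  have F1: "F 1 q x t = rpt X d 0 v vertex0" if x: "x \<in> X q" and t: "t \<in> standard_simplex q" for q x t
  proof -
    have "cone_coordinates 1 t = vertex0"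
      by (auto simp: cone_coordinates_def)
    \<comment> \<open>Deleting last vertices leaves the apex in place and ends at the cone on a
      vertex, whose apex is \<open>v\<close>.\<close>
    moreover have "rpt X d (Suc q) (h x) vertex0 = rpt X d 0 v vertex0"
      using x
    proof (induction q arbitrary: x)
      case 0
      have "simplical_face 1 vertex0 = vertex0"
        by (auto simp: simplical_face_def)
      then show ?case
        using rpt_face[of "h x" X 0 1 vertex0 d] h[OF 0] h1[OF 0] by simp
    next
      case (Suc q)
      have eq: "simplical_face (Suc (Suc q)) vertex0 = vertex0"
        by (auto simp: simplical_face_def)
      have "rpt X d (Suc (Suc q)) (h x) vertex0 = rpt X d (Suc q) (d (Suc (Suc q)) (Suc (Suc q)) (h x)) vertex0"
        using rpt_face[of "h x" X "Suc q" "Suc (Suc q)" vertex0 d] h[OF Suc.prems] by (simp add: eq)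
      also have "\<dots> = rpt X d (Suc q) (h (d (Suc q) (Suc q) x)) vertex0"
        using hSuc[OF Suc.prems, of "Suc q"] by simp
      also have "\<dots> = rpt X d 0 v vertex0"
        by (rule Suc.IH[OF delta_set_face[where X = X, OF X Suc.prems order_refl]])
      finally show ?case .
    qed
    ultimately show ?thesis
      by (simp add: F_def)
  qed
  have "homotopic_with (\<lambda>_. True) (realization X d) (realization X d) id (\<lambda>_. rpt X d 0 v vertex0)"
  proof (rule homotopic_with_realization[where F = F])
    fix u :: real assume u: "u \<in> {0..1}"
    show "compatible_family X d (F u)"
    proof (rule compatible_familyI)
      fix q x i t assume *: "x \<in> X (Suc q)" "i \<le> Suc q" "t \<in> standard_simplex q"
      have "cone_coordinates u (simplical_face i t) = simplical_face (Suc i) (cone_coordinates u t)"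
        by (auto simp: cone_coordinates_def simplical_face_def fun_eq_iff)
      then have "F u (Suc q) x (simplical_face i t)
          = rpt X d (Suc (Suc q)) (h x) (simplical_face (Suc i) (cone_coordinates u t))"
        by (simp add: F_def)
      also have "\<dots> = rpt X d (Suc q) (d (Suc (Suc q)) (Suc i) (h x)) (cone_coordinates u t)"
        using * u by (intro rpt_face h cone_coordinates_in_simplex) auto
      also have "\<dots> = F u q (d (Suc q) i x) t"
        using hSuc * by (simp add: F_def)
      finally show "F u (Suc q) x (simplical_face i t) = F u q (d (Suc q) i x) t" .
    qed
  next
    fix q x assume x: "x \<in> X q"
    have "continuous_map (prism {0..1} q) (simplex_topology (Suc q)) (\<lambda>p. cone_coordinates (fst p) (snd p))"
    proof (rule continuous_map_simplex_topologyI)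
      have "continuous_map (prism {0..1} q) euclideanreal fst"
        by (rule continuous_map_into_fulltopology[OF continuous_map_fst])
      moreover have "continuous_map (prism {0..1} q) euclideanreal (\<lambda>p. snd p i)" for i
        using continuous_map_compose[OF continuous_map_snd continuous_map_simplex_coordinate]
        by (auto simp: comp_def)
      ultimately show "continuous_map (prism {0..1} q) euclideanreal (\<lambda>p. cone_coordinates (fst p) (snd p) i)" for i
        unfolding cone_coordinates_def by (cases "i = 0") (auto intro!: continuous_intros)
      show "cone_coordinates (fst p) (snd p) \<in> standard_simplex (Suc q)" if "p \<in> topspace (prism {0..1} q)" for p
        using that by (intro cone_coordinates_in_simplex) auto
    qed
    from continuous_map_compose[OF this continuous_map_rpt[where X = X, OF h[OF x], of d]]
    show "continuous_map (prism {0..1} q) (realization X d) (\<lambda>(u, t). F u q x t)"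
      by (simp add: F_def comp_def case_prod_unfold)
  qed (use F0 F1 in auto)
  then show ?thesis
    unfolding contractible_space_def by blast
qed

section \<open>Attaching pieces along bridges\<close>

text \<open>The point of the standard 1-simplex with weight \<open>s\<close> at the vertex opposite to the \<open>k\<close>-th one.\<close>

definition edge_point :: "nat \<Rightarrow> real \<Rightarrow> nat \<Rightarrow> real" where
  "edge_point k s = (\<lambda>i. if i = k then 1 - s else if i = 1 - k then s else 0)"

lemma edge_point_in_simplex:
  assumes "k \<le> 1" "s \<in> {0..1}"
  shows "edge_point k s \<in> standard_simplex (Suc 0)"
proof -
  have "k = 0 \<or> k = 1"
    using assms(1) by linarith
  then show ?thesis
    using assms(2) by (auto simp: edge_point_def standard_simplex_def)
qed

lemma edge_point_0:
  assumes "k \<le> 1"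
  shows "edge_point k 0 = simplical_face (1 - k) vertex0"
proof -
  have "k = 0 \<or> k = 1"
    using assms by linarith
  then show ?thesis
    by (auto simp: edge_point_def simplical_face_def fun_eq_iff)
qed

lemma edge_point_1:
  assumes "k \<le> 1"
  shows "edge_point k 1 = simplical_face k vertex0"
proof -
  have "k = 0 \<or> k = 1"
    using assms by linarith
  then show ?thesis
    by (auto simp: edge_point_def simplical_face_def fun_eq_iff)
qed

lemma edge_point_coordinate:
  assumes "k \<le> 1" "t \<in> standard_simplex (Suc 0)"
  shows "edge_point k (t (1 - k)) = t"
proof -
  have "k = 0 \<or> k = 1"
    using assms(1) by linarith
  moreover have "t 0 + t 1 = 1" "\<And>i. i > 1 \<Longrightarrow> t i = 0"
    using assms(2) by (auto simp: standard_simplex_def)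
  ultimately show ?thesis
    by (auto simp: edge_point_def fun_eq_iff)
qed

lemma continuous_map_edge_point:
  assumes "k \<le> 1" "continuous_map Z euclideanreal f" "\<And>z. z \<in> topspace Z \<Longrightarrow> f z \<in> {0..1}"
    and "e \<in> X 1"
  shows "continuous_map Z (realization X d) (\<lambda>z. rpt X d 1 e (edge_point k (f z)))"
proof -
  have "continuous_map Z (simplex_topology 1) (\<lambda>z. edge_point k (f z))"
  proof (rule continuous_map_simplex_topologyI)
    show "continuous_map Z euclideanreal (\<lambda>z. edge_point k (f z) i)" for i
      unfolding edge_point_def using assms(2)
      by (cases "i = k"; cases "i = 1 - k") (auto intro!: continuous_intros)
    show "edge_point k (f z) \<in> standard_simplex 1" if "z \<in> topspace Z" for z
      using edge_point_in_simplex[OF assms(1) assms(3)[OF that]] by simp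
  qed
  from continuous_map_compose[OF this continuous_map_rpt[where X = X, OF assms(4), of d]]
  show ?thesis
    by (simp add: comp_def)
qed

definition vertex_contraction ::
  "(nat \<Rightarrow> 'x set) \<Rightarrow> (nat \<Rightarrow> nat \<Rightarrow> 'x \<Rightarrow> 'x) \<Rightarrow> 'x \<Rightarrow>
   (nat \<Rightarrow> 'x \<Rightarrow> real \<Rightarrow> (nat \<Rightarrow> real) \<Rightarrow> (nat \<times> 'x \<times> (nat \<Rightarrow> real)) set) \<Rightarrow> bool" where
  "vertex_contraction X d p c \<longleftrightarrow>
     coherent_family {0..1} X d (realization X d) trivial_transition c \<and>
     (\<forall>q. \<forall>x\<in>X q. \<forall>t\<in>standard_simplex q. c q x 0 t = rpt X d q x t) \<and>
     (\<forall>q. \<forall>x\<in>X q. \<forall>t\<in>standard_simplex q. c q x 1 t = rpt X d 0 p vertex0) \<and>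
     (\<forall>u\<in>{0..1}. c 0 p u vertex0 = rpt X d 0 p vertex0)"

text \<open>The identity and the constant map to \<open>p\<close> agree at \<open>p\<close>, so the
  homotopy between them can be kept stationary there.\<close>

lemma vertex_contraction_exists:
  assumes X: "delta_set X d" and C: "contractible_space (realization X d)" and p: "p \<in> X 0"
  obtains c where "vertex_contraction X d p c"
proof (rule coherent_maps_homotopic[OF X transition_maps_trivial C, where c\<^sub>0 = "rpt X d"
      and c\<^sub>1 = "\<lambda>q x t. rpt X d 0 p vertex0" and L = "{p}"])
  show "coherent_maps X d (realization X d) trivial_transition (rpt X d)"
    by (intro coherent_maps_trivial continuous_map_rpt compatible_family_rpt)
  show "coherent_maps X d (realization X d) trivial_transition (\<lambda>q x t. rpt X d 0 p vertex0)"
    using rpt_in_topspace[of p X 0 vertex0 d] p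
    by (intro coherent_maps_trivial compatible_familyI) auto
next
  fix c assume c: "coherent_family {0..1} X d (realization X d) trivial_transition c"
    "\<And>q x t. x \<in> X q \<Longrightarrow> t \<in> standard_simplex q \<Longrightarrow> c q x 0 t = rpt X d q x t"
    "\<And>q x t. x \<in> X q \<Longrightarrow> t \<in> standard_simplex q \<Longrightarrow> c q x 1 t = rpt X d 0 p vertex0"
    "\<And>x u t. x \<in> {p} \<Longrightarrow> x \<in> X 0 \<Longrightarrow> u \<in> {0..1} \<Longrightarrow> t \<in> standard_simplex 0 \<Longrightarrow> c 0 x u t = rpt X d 0 x t"
  have "c 0 p u vertex0 = rpt X d 0 p vertex0" if "u \<in> {0..1}" for u
    by (rule c(4)) (use p that in auto)
  then show thesis
    using c(1-3) by (intro that) (auto simp: vertex_contraction_def)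
qed auto

text \<open>The contraction of a piece has to fix its end of the bridge, hence \<open>vertex_contraction\<close>; then the
  bridges are collapsed onto their ends in \<open>R\<close>.\<close>

lemma contractible_bridges:
  fixes X R P :: "nat \<Rightarrow> 'x set" and \<beta> :: "'j \<Rightarrow> 'x" and lab :: "'x \<Rightarrow> 'j"
  assumes X: "delta_set X d" and k: "k \<le> 1"
    and X_eq: "\<And>q. X q = R q \<union> P q \<union> (if q = 1 then B else {})"
    and disj: "\<And>q. R q \<inter> P q = {}" "R 1 \<inter> B = {}" "P 1 \<inter> B = {}"
    and R: "\<And>q x i. x \<in> R (Suc q) \<Longrightarrow> i \<le> Suc q \<Longrightarrow> d (Suc q) i x \<in> R q"
    and P: "\<And>q x i. x \<in> P (Suc q) \<Longrightarrow> i \<le> Suc q \<Longrightarrow> d (Suc q) i x \<in> P q"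
      "\<And>q x i. x \<in> P (Suc q) \<Longrightarrow> i \<le> Suc q \<Longrightarrow> lab (d (Suc q) i x) = lab x"
    and \<beta>: "\<And>q x. x \<in> P q \<Longrightarrow> \<beta> (lab x) \<in> B" "\<And>q x. x \<in> P q \<Longrightarrow> lab (\<beta> (lab x)) = lab x"
      "\<And>e. e \<in> B \<Longrightarrow> \<beta> (lab e) = e"
    and B: "\<And>e. e \<in> B \<Longrightarrow> d 1 k e \<in> P 0" "\<And>e. e \<in> B \<Longrightarrow> lab (d 1 k e) = lab e"
      "\<And>e. e \<in> B \<Longrightarrow> d 1 (1 - k) e \<in> R 0"
    and contr_R: "contractible_space (realization R d)"
    and contr_P: "\<And>e. e \<in> B \<Longrightarrow> contractible_space (realization (\<lambda>q. {x \<in> P q. lab x = lab e}) d)"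
  shows "contractible_space (realization X d)"
proof -
  let ?RX = "realization X d" and ?RR = "realization R d"
  have sub: "R q \<subseteq> X q" "P q \<subseteq> X q" "B \<subseteq> X 1" for q
    using X_eq by auto
  have k': "1 - k \<le> 1" "\<And>i. i \<le> Suc 0 \<Longrightarrow> i = k \<or> i = 1 - k"
    using k by auto
  \<comment> \<open>Labels of distinct bridges are distinct, so every bridge carries exactly one
    piece, the one with its own label.\<close>
  define Pc where "Pc = (\<lambda>e q. {x \<in> P q. lab x = lab e})"
  have Pc_X: "Pc e q \<subseteq> X q" for e q
    using sub by (auto simp: Pc_def)
  have Pc_delta: "delta_set (Pc e) d" for e
    by (rule delta_set_subset[OF X]) (use Pc_X P in \<open>auto simp: Pc_def\<close>)
  define \<iota> where "\<iota> = rmap X d (\<lambda>x::'x. x)"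
  have \<iota>_P: "delta_map (Pc e) d X d (\<lambda>x. x)" for e
    by (rule delta_map_subset) (rule Pc_X)
  have \<iota>_R: "delta_map R d X d (\<lambda>x. x)"
    by (rule delta_map_subset) (rule sub)
  have "\<exists>c. vertex_contraction (Pc e) d (d 1 k e) c" if e: "e \<in> B" for e
  proof -
    have "d 1 k e \<in> Pc e 0" "contractible_space (realization (Pc e) d)"
      using B[OF e] contr_P[OF e] by (simp_all add: Pc_def)
    then show ?thesis
      using vertex_contraction_exists[OF Pc_delta] by blast
  qed
  then obtain c where c: "\<And>e. e \<in> B \<Longrightarrow> vertex_contraction (Pc e) d (d 1 k e) (c e)"
    by metis
  have cF: "coherent_family {0..1} (Pc e) d (realization (Pc e) d) trivial_transition (c e)" if "e \<in> B" for e
    using c[OF that] by (simp add: vertex_contraction_def)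
  define br where "br = (\<lambda>x. \<beta> (lab x))"
  have br_B: "br x \<in> B" if "x \<in> P q" for x q
    using \<beta>(1)[OF that] by (simp add: br_def)
  have br_Pc: "x \<in> Pc (br x) q" if x: "x \<in> P q" for x q
    using x \<beta>(2)[OF x] by (simp add: Pc_def br_def)
  have br_face: "br (d (Suc q) i x) = br x" if "x \<in> P (Suc q)" "i \<le> Suc q" for x q i
    using P(2)[OF that] by (simp add: br_def)
  have br_edge: "br e = e" "br (d 1 k e) = e" if "e \<in> B" for e
    using \<beta>(3)[OF that] B(2)[OF that] by (simp_all add: br_def)
  have cases: thesis
    if "x \<in> X q" "x \<in> R q \<Longrightarrow> thesis" "x \<in> P q \<Longrightarrow> x \<notin> R q \<Longrightarrow> thesis"
      "q = 1 \<Longrightarrow> x \<in> B \<Longrightarrow> x \<notin> R q \<Longrightarrow> x \<notin> P q \<Longrightarrow> thesis" for x q thesis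
    using that X_eq[of q] disj by (auto split: if_splits)
  have notin: "x \<notin> R q" if "x \<in> P q" for x q
    using disj(1)[of q] that by auto
  have end_face: "rpt X d 1 e (simplical_face i vertex0) = rpt X d 0 (d 1 i e) vertex0"
    if "e \<in> B" "i \<le> 1" for e i
    using rpt_face[of e X 0 i vertex0 d] sub(3) that by auto

  \<comment> \<open>Stage one: every piece is contracted to its end of the bridge, while
    \<open>R\<close> and the bridges stand still.\<close>
  define F\<^sub>1 where "F\<^sub>1 = (\<lambda>u q x t. if x \<in> P q then \<iota> (c (br x) q x u t) else rpt X d q x t)"
  have F\<^sub>1_0: "F\<^sub>1 0 q x t = rpt X d q x t" if "x \<in> X q" "t \<in> standard_simplex q" for q x t
  proof (cases "x \<in> P q")
    case True
    then have "c (br x) q x 0 t = rpt (Pc (br x)) d q x t"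
      using c[OF br_B[OF True]] br_Pc[OF True] that by (auto simp: vertex_contraction_def)
    then show ?thesis
      using True by (simp add: F\<^sub>1_def \<iota>_def rmap_rpt[OF \<iota>_P])
  qed (simp add: F\<^sub>1_def)
  have F\<^sub>1_1: "F\<^sub>1 1 q x t = rpt X d 0 (d 1 k (br x)) vertex0" if "x \<in> P q" "t \<in> standard_simplex q" for q x t
  proof -
    have "c (br x) q x 1 t = rpt (Pc (br x)) d 0 (d 1 k (br x)) vertex0"
      using c[OF br_B[OF that(1)]] br_Pc[OF that(1)] that by (auto simp: vertex_contraction_def)
    then show ?thesis
      using that by (simp add: F\<^sub>1_def \<iota>_def rmap_rpt[OF \<iota>_P])
  qed
  have comp\<^sub>1: "compatible_family X d (F\<^sub>1 u)" if u: "u \<in> {0..1}" for u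
  proof (rule compatible_familyI)
    fix q x i t assume x: "x \<in> X (Suc q)" and i: "i \<le> Suc q" and t: "t \<in> standard_simplex q"
    from x show "F\<^sub>1 u (Suc q) x (simplical_face i t) = F\<^sub>1 u q (d (Suc q) i x) t"
    proof (rule cases)
      assume xR: "x \<in> R (Suc q)"
      then have "x \<notin> P (Suc q)" "d (Suc q) i x \<notin> P q"
        using R[OF xR i] notin by blast+
      then show ?thesis
        using rpt_face[where X = X, OF x i t] by (simp add: F\<^sub>1_def)
    next
      assume xP: "x \<in> P (Suc q)"
      have "c (br x) (Suc q) x u (simplical_face i t) = c (br x) q (d (Suc q) i x) u t"
        by (rule coherent_family_face[where X = "Pc (br x)", OF cF[OF br_B[OF xP]] br_Pc[OF xP] i u t])
      then show ?thesis
        using xP P(1)[OF xP i] br_face[OF xP i] by (simp add: F\<^sub>1_def)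
    next
      assume q: "Suc q = 1" and xB: "x \<in> B" and "x \<notin> P (Suc q)"
      then have lhs: "F\<^sub>1 u (Suc q) x (simplical_face i t) = rpt X d 0 (d 1 i x) vertex0"
        using end_face[OF xB, of i] i t by (simp add: F\<^sub>1_def standard_simplex_0)
      consider "i = k" | "i = 1 - k" "d 1 i x \<in> R 0"
        using k'(2)[of i] i q B(3)[OF xB] by auto
      then show ?thesis
      proof cases
        case 1
        \<comment> \<open>The bridge does not move in this stage, so its end in the piece must not
          move either; this is where a contraction fixing that vertex is required.\<close>
        have "c x 0 (d 1 k x) u vertex0 = rpt (Pc x) d 0 (d 1 k x) vertex0"
          using c[OF xB] u by (simp add: vertex_contraction_def)
        then show ?thesis
          unfolding lhs using 1 q t B(1)[OF xB] br_edge(2)[OF xB]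
          by (simp add: F\<^sub>1_def standard_simplex_0 \<iota>_def rmap_rpt[OF \<iota>_P])
      next
        case 2
        then have "d 1 i x \<notin> P 0"
          using notin by blast
        then show ?thesis
          unfolding lhs using q t by (simp add: F\<^sub>1_def standard_simplex_0)
      qed
    qed
  qed
  have cont\<^sub>1: "continuous_map (prism {0..1} q) ?RX (\<lambda>(u, t). F\<^sub>1 u q x t)" if x: "x \<in> X q" for q x
  proof (cases "x \<in> P q")
    case True
    have "continuous_map (prism {0..1} q) (realization (Pc (br x)) d) (\<lambda>(u, t). c (br x) q x u t)"
      by (rule coherent_family_continuous[where X = "Pc (br x)", OF cF[OF br_B[OF True]] br_Pc[OF True]])
    from continuous_map_compose[OF this continuous_map_rmap[OF \<iota>_P]]
    show ?thesis
      using True by (simp add: F\<^sub>1_def \<iota>_def comp_def case_prod_unfold)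
  next
    case False
    then show ?thesis
      using continuous_map_compose[OF continuous_map_snd continuous_map_rpt[where X = X, OF x]]
      by (auto simp: F\<^sub>1_def comp_def case_prod_unfold)
  qed
  have hom\<^sub>1: "homotopic_with (\<lambda>_. True) ?RX ?RX id (rlift (F\<^sub>1 1))"
    by (rule homotopic_with_realization[where F = F\<^sub>1])
      (use comp\<^sub>1 cont\<^sub>1 F\<^sub>1_0 rlift_rpt[OF comp\<^sub>1] in auto)

  \<comment> \<open>Stage two: the weight at the end lying in the piece is scaled by 1 - u. It
    starts as 1 on a contracted piece and as the coordinate with index \<open>1 - k\<close> on a
    bridge, and finishes as 0, at the end lying in \<open>R\<close>.\<close>
  define F\<^sub>2 where "F\<^sub>2 = (\<lambda>u q x t. if x \<in> R q then rpt X d q x t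
      else rpt X d 1 (br x) (edge_point k ((1 - u) * (if x \<in> P q then 1 else t (1 - k)))))"
  have F\<^sub>2_0: "F\<^sub>2 0 q x t = F\<^sub>1 1 q x t" if x: "x \<in> X q" and t: "t \<in> standard_simplex q" for q x t
    using x
  proof (rule cases)
    assume "x \<in> R q"
    then show ?thesis
      using disj(1)[of q] by (auto simp: F\<^sub>1_def F\<^sub>2_def)
  next
    assume xP: "x \<in> P q"
    then show ?thesis
      using notin[OF xP] F\<^sub>1_1[OF xP t] end_face[OF br_B[OF xP] k]
      by (simp add: F\<^sub>2_def edge_point_1[OF k])
  next
    assume "q = 1" "x \<in> B" "x \<notin> R q" "x \<notin> P q"
    then show ?thesis
      using br_edge(1) edge_point_coordinate[OF k] t by (simp add: F\<^sub>1_def F\<^sub>2_def)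
  qed
  have comp\<^sub>2: "compatible_family X d (F\<^sub>2 u)" for u
  proof (rule compatible_familyI)
    fix q x i t assume x: "x \<in> X (Suc q)" and i: "i \<le> Suc q" and t: "t \<in> standard_simplex q"
    from x show "F\<^sub>2 u (Suc q) x (simplical_face i t) = F\<^sub>2 u q (d (Suc q) i x) t"
    proof (rule cases)
      assume xR: "x \<in> R (Suc q)"
      then show ?thesis
        using rpt_face[where X = X, OF x i t] R[OF xR i] by (simp add: F\<^sub>2_def)
    next
      assume xP: "x \<in> P (Suc q)"
      then show ?thesis
        using notin[OF xP] P(1)[OF xP i] notin[OF P(1)[OF xP i]] br_face[OF xP i] by (simp add: F\<^sub>2_def)
    next
      assume q: "Suc q = 1" and xB: "x \<in> B" and notin': "x \<notin> R (Suc q)" "x \<notin> P (Suc q)"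
      have t0: "t = vertex0"
        using t q by (simp add: standard_simplex_0)
      consider "i = k" | "i = 1 - k" "i \<noteq> k"
        using k'(2)[of i] i q by auto
      then show ?thesis
      proof cases
        case 1
        then have "simplical_face i vertex0 (1 - k) = (1::real)"
          using k by (cases k) (auto simp: simplical_face_def)
        then show ?thesis
          using notin' q 1 t0 B(1)[OF xB] notin[OF B(1)[OF xB]] br_edge[OF xB] by (simp add: F\<^sub>2_def)
      next
        case 2
        then have "simplical_face i vertex0 (1 - k) = (0::real)"
          by simp
        then show ?thesis
          using notin' q 2 t0 B(3)[OF xB] br_edge(1)[OF xB] end_face[OF xB k'(1)]
          by (simp add: F\<^sub>2_def edge_point_0[OF k])
      qed
    qed
  qed
  have cont\<^sub>2: "continuous_map (prism {0..1} q) ?RX (\<lambda>(u, t). F\<^sub>2 u q x t)" if x: "x \<in> X q" for q x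
  proof (cases "x \<in> R q")
    case True
    then show ?thesis
      using continuous_map_compose[OF continuous_map_snd continuous_map_rpt[where X = X, OF x]]
      by (auto simp: F\<^sub>2_def comp_def case_prod_unfold)
  next
    case False
    define g where "g = (\<lambda>p::real \<times> (nat \<Rightarrow> real). (1 - fst p) * (if x \<in> P q then 1 else snd p (1 - k)))"
    have "continuous_map (prism {0..1} q) euclideanreal fst"
      by (rule continuous_map_into_fulltopology[OF continuous_map_fst])
    moreover have "continuous_map (prism {0..1} q) euclideanreal (\<lambda>p. snd p i)" for i
      using continuous_map_compose[OF continuous_map_snd continuous_map_simplex_coordinate]
      by (auto simp: comp_def)
    ultimately have "continuous_map (prism {0..1} q) euclideanreal g"
      unfolding g_def by (cases "x \<in> P q") (auto intro!: continuous_intros)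
    moreover have "g p \<in> {0..1}" if "p \<in> topspace (prism {0..1} q)" for p
      using that by (auto simp: g_def standard_simplex_def mult_le_one)
    moreover have "br x \<in> X 1"
    proof -
      have "br x \<in> B"
        by (rule cases[OF x]) (use False br_B br_edge(1) in auto)
      then show ?thesis
        using sub(3) by auto
    qed
    ultimately have "continuous_map (prism {0..1} q) ?RX (\<lambda>p. rpt X d 1 (br x) (edge_point k (g p)))"
      by (intro continuous_map_edge_point k) auto
    then show ?thesis
      using False by (simp add: F\<^sub>2_def g_def case_prod_unfold)
  qed
  \<comment> \<open>The collapse, as a map into the realization of \<open>R\<close> itself rather
    than into that of \<open>X\<close>; the contraction of \<open>R\<close> can be composed only
    with the former.\<close>
  define G where "G = (\<lambda>q x t. if x \<in> R q then rpt R d q x t else rpt R d 0 (d 1 (1 - k) (br x)) vertex0)"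
  have compG: "compatible_family X d G"
  proof (rule compatible_familyI)
    fix q x i t assume x: "x \<in> X (Suc q)" and i: "i \<le> Suc q" and t: "t \<in> standard_simplex q"
    from x show "G (Suc q) x (simplical_face i t) = G q (d (Suc q) i x) t"
    proof (rule cases)
      assume xR: "x \<in> R (Suc q)"
      then show ?thesis
        using rpt_face[where X = R, OF xR i t] R[OF xR i] by (simp add: G_def)
    next
      assume xP: "x \<in> P (Suc q)"
      then show ?thesis
        using notin[OF xP] P(1)[OF xP i] notin[OF P(1)[OF xP i]] br_face[OF xP i] by (simp add: G_def)
    next
      assume q: "Suc q = 1" and xB: "x \<in> B" and notin': "x \<notin> R (Suc q)" "x \<notin> P (Suc q)"
      have t0: "t = vertex0"
        using t q by (simp add: standard_simplex_0)
      consider "i = k" | "i = 1 - k" "i \<noteq> k"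
        using k'(2)[of i] i q by auto
      then show ?thesis
      proof cases
        case 1
        then show ?thesis
          using notin' q notin[OF B(1)[OF xB]] br_edge[OF xB] by (simp add: G_def)
      next
        case 2
        then show ?thesis
          using notin' q t0 B(3)[OF xB] br_edge(1)[OF xB] by (simp add: G_def)
      qed
    qed
  qed
  have contG: "continuous_map ?RX ?RR (rlift G)"
  proof (rule continuous_map_realization[OF compG])
    fix q x assume x: "x \<in> X q"
    show "continuous_map (simplex_topology q) ?RR (G q x)"
    proof (cases "x \<in> R q")
      case True
      then have "G q x = rpt R d q x"
        by (simp add: G_def fun_eq_iff)
      then show ?thesis
        using continuous_map_rpt[where X = R, OF True, of d] by simp
    next
      case False
      have "br x \<in> B"
        by (rule cases[OF x]) (use False br_B br_edge(1) in auto)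
      then have "rpt R d 0 (d 1 (1 - k) (br x)) vertex0 \<in> topspace ?RR"
        using B(3) by (intro rpt_in_topspace) auto
      then show ?thesis
        using False by (simp add: G_def[abs_def])
    qed
  qed
  have hom\<^sub>2: "homotopic_with (\<lambda>_. True) ?RX ?RX (rlift (F\<^sub>1 1)) (\<iota> \<circ> rlift G)"
  proof (rule homotopic_with_realization[where F = F\<^sub>2])
    show "rlift (F\<^sub>1 1) (rpt X d q x t) = F\<^sub>2 0 q x t" if "x \<in> X q" "t \<in> standard_simplex q" for q x t
      using F\<^sub>2_0[OF that] rlift_rpt[OF comp\<^sub>1] by simp
    fix q x t assume x: "x \<in> X q" and t: "t \<in> standard_simplex q"
    have "\<iota> (G q x t) = F\<^sub>2 1 q x t"
    proof (cases "x \<in> R q")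
      case True
      then show ?thesis
        by (simp add: G_def F\<^sub>2_def \<iota>_def rmap_rpt[OF \<iota>_R])
    next
      case False
      have "br x \<in> B"
        by (rule cases[OF x]) (use False br_B br_edge(1) in auto)
      then show ?thesis
        using False end_face[OF _ k'(1)]
        by (simp add: G_def F\<^sub>2_def \<iota>_def rmap_rpt[OF \<iota>_R] edge_point_0[OF k])
    qed
    then show "(\<iota> \<circ> rlift G) (rpt X d q x t) = F\<^sub>2 1 q x t"
      using rlift_rpt[OF compG] by simp
  qed (use comp\<^sub>2 cont\<^sub>2 in auto)
  \<comment> \<open>After both stages the identity of \<open>X\<close> has become a map factoring
    through the contractible \<open>R\<close>.\<close>
  obtain a where "homotopic_with (\<lambda>_. True) ?RR ?RR id (\<lambda>_. a)"
    using contr_R unfolding contractible_space_def by blast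
  then have "homotopic_with (\<lambda>_. True) ?RX ?RR (id \<circ> rlift G) ((\<lambda>_. a) \<circ> rlift G)"
    by (rule homotopic_with_compose_continuous_map_right[OF _ contG]) simp
  then have "homotopic_with (\<lambda>_. True) ?RX ?RX (\<iota> \<circ> (id \<circ> rlift G)) (\<iota> \<circ> ((\<lambda>_. a) \<circ> rlift G))"
    unfolding \<iota>_def
    by (rule homotopic_with_compose_continuous_map_left[OF _ continuous_map_rmap[OF \<iota>_R]]) simp
  then have "homotopic_with (\<lambda>_. True) ?RX ?RX (\<iota> \<circ> rlift G) (\<lambda>_. \<iota> a)"
    by (simp add: comp_def)
  then show ?thesis
    unfolding contractible_space_def using homotopic_with_trans[OF homotopic_with_trans[OF hom\<^sub>1 hom\<^sub>2]] by blast
qed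

section \<open>Left actions on labelled Delta-sets\<close>

lemma length_bar_face:
  assumes "length s = Suc q" "i \<le> Suc q"
  shows "length (bar_face S (Suc q) i s) = q"
  using assms by (auto simp: bar_face_def)

lemma bar_face_nth:
  assumes "length s = Suc q" "i \<le> Suc q" "k < q"
  shows "bar_face S (Suc q) i s ! k =
    (if Suc k < i then s ! k else if Suc k = i then s ! k \<otimes>\<^bsub>S\<^esub> s ! Suc k else s ! Suc k)"
proof -
  consider "i = 0" | "i = Suc q" "i \<noteq> 0" | "0 < i" "i < Suc q"
    using assms(2) by linarith
  then show ?thesis
  proof cases
    case 3
    then show ?thesis
      using assms by (auto simp: bar_face_def nth_append nth_Cons' min_def)
  qed (use assms in \<open>auto simp: bar_face_def nth_tl nth_butlast\<close>)
qed

lemma bar_simplices_nth: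
  assumes "s \<in> bar_simplices S q" "k < q"
  shows "s ! k \<in> carrier S"
  using assms by (auto simp: bar_simplices_def)

lemma hd_bar_simplices:
  assumes "s \<in> bar_simplices S (Suc q)"
  shows "hd s = s ! 0" "hd s \<in> carrier S"
proof -
  have "s \<noteq> []"
    using assms by (auto simp: bar_simplices_def)
  then show "hd s = s ! 0"
    by (rule hd_conv_nth)
  then show "hd s \<in> carrier S"
    using bar_simplices_nth[OF assms, of 0] by simp
qed

context monoid
begin

lemma bar_face_closed:
  "s \<in> bar_simplices G (Suc q) \<Longrightarrow> i \<le> Suc q \<Longrightarrow> bar_face G (Suc q) i s \<in> bar_simplices G q"
  by (rule bar_face_in_bar_simplices) auto

text \<open>Compared entry by entry. Associativity matters only for adjacent inner faces, where both
  orders multiply the same three letters.\<close>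

lemma delta_set_bar: "delta_set (bar_simplices G) (bar_face G)"
  unfolding delta_set_def
proof (intro conjI allI ballI impI)
  fix q s i j assume s: "s \<in> bar_simplices G (Suc (Suc q))" and j: "j \<le> Suc (Suc q)" and i: "i < j"
  have len: "length s = Suc (Suc q)"
    using s by (simp add: bar_simplices_def)
  have nth: "\<And>k. k < Suc (Suc q) \<Longrightarrow> s ! k \<in> carrier G"
    using bar_simplices_nth[OF s] .
  show "bar_face G (Suc q) i (bar_face G (Suc (Suc q)) j s)
      = bar_face G (Suc q) (j - 1) (bar_face G (Suc (Suc q)) i s)" (is "?l = ?r")
  proof (rule nth_equalityI)
    show "length ?l = length ?r"
      using i j len by (simp add: length_bar_face)
    fix k assume "k < length ?l"
    then have k: "k < q"
      using i j len by (simp add: length_bar_face)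
    have "?l ! k = (if Suc k < i then s ! k
        else if Suc k = i then (if Suc (Suc k) = j then s ! k \<otimes> (s ! Suc k \<otimes> s ! Suc (Suc k)) else s ! k \<otimes> s ! Suc k)
        else if Suc (Suc k) < j then s ! Suc k else if Suc (Suc k) = j then s ! Suc k \<otimes> s ! Suc (Suc k)
        else s ! Suc (Suc k))"
      using i j len k by (auto simp: bar_face_nth length_bar_face)
    also have "\<dots> = ?r ! k"
      using i j len k nth by (auto simp: bar_face_nth length_bar_face m_assoc)
    finally show "?l ! k = ?r ! k" .
  qed
qed (rule bar_face_closed)

text \<open>Taking faces 0 and 1 is what affects the first letter. The product rule for face 1 is
  the cocycle condition for transport by first letters.\<close>

lemma hd_bar_face:
  assumes "s \<in> bar_simplices G (Suc (Suc q))" "i \<le> Suc (Suc q)"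
  shows "2 \<le> i \<Longrightarrow> hd (bar_face G (Suc (Suc q)) i s) = hd s"
    and "hd (bar_face G (Suc (Suc q)) (Suc 0) s) = hd s \<otimes> hd (bar_face G (Suc (Suc q)) 0 s)"
proof -
  have len: "length s = Suc (Suc q)"
    using assms by (simp add: bar_simplices_def)
  have hd: "hd (bar_face G (Suc (Suc q)) i s) = bar_face G (Suc (Suc q)) i s ! 0" if "i \<le> Suc (Suc q)" for i
    by (rule hd_bar_simplices[OF bar_face_closed[OF assms(1) that]])
  show "hd (bar_face G (Suc (Suc q)) i s) = hd s" if "2 \<le> i"
    using that assms len hd_bar_simplices(1)[OF assms(1)] by (simp add: hd bar_face_nth)
  show "hd (bar_face G (Suc (Suc q)) (Suc 0) s) = hd s \<otimes> hd (bar_face G (Suc (Suc q)) 0 s)"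
    using len hd_bar_simplices(1)[OF assms(1)] by (simp add: hd bar_face_nth)
qed

end

text \<open>A Delta-set over \<open>BS\<close>, together with a left \<open>S\<close>-set \<open>\<Gamma> x\<close> of admissible values at the initial
  vertex of each simplex \<open>x\<close>. The simplices \<open>(s, x)\<close> with \<open>s \<in> \<Gamma> x\<close> form a Delta-set on which \<open>S\<close>
  acts; for \<open>X = BS\<close> and \<open>\<Gamma> x = S\<close> it is the total space \<open>ES\<close>.\<close>

locale labelled_delta_set = monoid S for S (structure) +
  fixes X :: "nat \<Rightarrow> 'x set" and d :: "nat \<Rightarrow> nat \<Rightarrow> 'x \<Rightarrow> 'x" and \<iota> :: "'x \<Rightarrow> 'a list"
    and \<Gamma> :: "'x \<Rightarrow> 'a set"
  assumes X: "delta_set X d"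
    and \<iota>: "delta_map X d (bar_simplices S) (bar_face S) \<iota>"
    and \<Gamma>_carrier: "x \<in> X q \<Longrightarrow> \<Gamma> x \<subseteq> carrier S"
    and \<Gamma>_mult: "x \<in> X q \<Longrightarrow> s \<in> carrier S \<Longrightarrow> g \<in> \<Gamma> x \<Longrightarrow> s \<otimes> g \<in> \<Gamma> x"
    and \<Gamma>_0: "x \<in> X (Suc q) \<Longrightarrow> g \<in> \<Gamma> x \<Longrightarrow> g \<otimes> hd (\<iota> x) \<in> \<Gamma> (d (Suc q) 0 x)"
    and \<Gamma>_Suc: "x \<in> X (Suc q) \<Longrightarrow> g \<in> \<Gamma> x \<Longrightarrow> 0 < i \<Longrightarrow> i \<le> Suc q \<Longrightarrow> g \<in> \<Gamma> (d (Suc q) i x)"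
begin

definition E :: "nat \<Rightarrow> ('a \<times> 'x) set" where
  "E q = {(g, x). x \<in> X q \<and> g \<in> \<Gamma> x}"

definition dE :: "nat \<Rightarrow> nat \<Rightarrow> 'a \<times> 'x \<Rightarrow> 'a \<times> 'x" where
  "dE q i p = (if i = 0 then fst p \<otimes> hd (\<iota> (snd p)) else fst p, d q i (snd p))"

definition act :: "'a \<Rightarrow> (nat \<times> ('a \<times> 'x) \<times> (nat \<Rightarrow> real)) set \<Rightarrow> (nat \<times> ('a \<times> 'x) \<times> (nat \<Rightarrow> real)) set" where
  "act s = rmap E dE (\<lambda>(g, x). (s \<otimes> g, x))"

text \<open>Values are recorded relative to the initial vertex of a simplex. All faces but the 0-th
  share that vertex; the 0-th starts one letter later, and its values are brought back by the action
  of this letter.\<close>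

definition twist :: "('y \<Rightarrow> 'a list) \<Rightarrow> nat \<Rightarrow> nat \<Rightarrow> 'y \<Rightarrow> _ \<Rightarrow> _" where
  "twist \<kappa> q i y v = (if i = 0 then act (hd (\<kappa> y)) v else v)"

definition pr :: "(nat \<times> ('a \<times> 'x) \<times> (nat \<Rightarrow> real)) set \<Rightarrow> (nat \<times> 'x \<times> (nat \<Rightarrow> real)) set" where
  "pr = rmap X d snd"

lemma \<iota>_in: "x \<in> X q \<Longrightarrow> \<iota> x \<in> bar_simplices S q"
  and \<iota>_face: "x \<in> X (Suc q) \<Longrightarrow> i \<le> Suc q \<Longrightarrow> \<iota> (d (Suc q) i x) = bar_face S (Suc q) i (\<iota> x)"
  using \<iota> by (auto simp: delta_map_def)

lemma hd_\<iota>_face: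
  assumes "x \<in> X (Suc (Suc q))" "i \<le> Suc (Suc q)"
  shows "2 \<le> i \<Longrightarrow> hd (\<iota> (d (Suc (Suc q)) i x)) = hd (\<iota> x)"
    and "hd (\<iota> (d (Suc (Suc q)) (Suc 0) x)) = hd (\<iota> x) \<otimes> hd (\<iota> (d (Suc (Suc q)) 0 x))"
  using hd_bar_face[OF \<iota>_in[OF assms(1)] assms(2)] assms by (simp_all add: \<iota>_face)

lemma \<Gamma>_in_carrier: "x \<in> X q \<Longrightarrow> g \<in> \<Gamma> x \<Longrightarrow> g \<in> carrier S"
  using \<Gamma>_carrier by blast

lemma hd_\<iota>: "x \<in> X (Suc q) \<Longrightarrow> hd (\<iota> x) \<in> carrier S"
  using hd_bar_simplices(2)[OF \<iota>_in] .

lemma dE_closed: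
  assumes "p \<in> E (Suc q)" "i \<le> Suc q"
  shows "dE (Suc q) i p \<in> E q"
  using assms \<Gamma>_0 \<Gamma>_Suc delta_set_face[OF X] by (auto simp: E_def dE_def)

lemma delta_set_E: "delta_set E dE"
  unfolding delta_set_def
proof (intro conjI allI ballI impI)
  fix q p i j assume p: "p \<in> E (Suc (Suc q))" and j: "j \<le> Suc (Suc q)" and i: "i < j"
  obtain g x where gx: "p = (g, x)" "x \<in> X (Suc (Suc q))" "g \<in> \<Gamma> x"
    using p by (auto simp: E_def)
  have dd: "d (Suc q) i (d (Suc (Suc q)) j x) = d (Suc q) (j - 1) (d (Suc (Suc q)) i x)"
    using delta_set_face_face[where X = X, OF X gx(2) i j] .
  have "g \<otimes> hd (\<iota> (d (Suc (Suc q)) j x)) = (if j = Suc 0 then g \<otimes> hd (\<iota> x) \<otimes> hd (\<iota> (d (Suc (Suc q)) 0 x))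
      else g \<otimes> hd (\<iota> x))" if "i = 0"
  proof (cases "j = Suc 0")
    case True
    then show ?thesis
      using hd_\<iota>_face(2)[OF gx(2) j] hd_\<iota>[OF gx(2)] hd_\<iota>[OF delta_set_face[where X = X, OF X gx(2), of 0]]
        \<Gamma>_in_carrier[OF gx(2,3)]
      by (simp add: m_assoc)
  next
    case False
    then show ?thesis
      using hd_\<iota>_face(1)[OF gx(2) j] i by simp
  qed
  then show "dE (Suc q) i (dE (Suc (Suc q)) j p) = dE (Suc q) (j - 1) (dE (Suc (Suc q)) i p)"
    using i by (auto simp: dE_def gx(1) dd)
qed (rule dE_closed)

lemma delta_map_act:
  assumes "s \<in> carrier S"
  shows "delta_map E dE E dE (\<lambda>(g, x). (s \<otimes> g, x))"
  unfolding delta_map_def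
proof (intro conjI allI ballI impI)
  fix q p i assume "p \<in> E (Suc q)" "i \<le> Suc q"
  then show "(case dE (Suc q) i p of (g, x) \<Rightarrow> (s \<otimes> g, x)) = dE (Suc q) i (case p of (g, x) \<Rightarrow> (s \<otimes> g, x))"
    using assms \<Gamma>_in_carrier hd_\<iota> by (auto simp: E_def dE_def m_assoc)
qed (use assms \<Gamma>_mult in \<open>auto simp: E_def\<close>)

lemma act_rpt:
  "s \<in> carrier S \<Longrightarrow> act s (rpt E dE q (g, x) t) = rpt E dE q (s \<otimes> g, x) t"
  unfolding act_def by (simp add: rmap_rpt[OF delta_map_act])

lemma continuous_map_act:
  "s \<in> carrier S \<Longrightarrow> continuous_map (realization E dE) (realization E dE) (act s)"
  unfolding act_def by (rule continuous_map_rmap[OF delta_map_act])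

lemma act_act:
  assumes "s \<in> carrier S" "s' \<in> carrier S" "v \<in> topspace (realization E dE)"
  shows "act s (act s' v) = act (s \<otimes> s') v"
  using assms(3)
proof (rule realization_cases)
  fix q p t assume "p \<in> E q" "v = rpt E dE q p t"
  then show ?thesis
    using assms(1,2) \<Gamma>_in_carrier by (auto simp: E_def act_rpt m_assoc)
qed

lemma delta_map_pr: "delta_map E dE X d snd"
  by (auto simp: delta_map_def E_def dE_def)

lemma pr_rpt: "pr (rpt E dE q (g, x) t) = rpt X d q x t"
  unfolding pr_def by (simp add: rmap_rpt[OF delta_map_pr])

lemma pr_act:
  assumes "s \<in> carrier S" "v \<in> topspace (realization E dE)"
  shows "pr (act s v) = pr v"
  using assms(2)
proof (rule realization_cases)
  fix q p t assume "p \<in> E q" "v = rpt E dE q p t"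
  then show ?thesis
    using assms(1) by (cases p) (simp add: act_rpt pr_rpt)
qed

context
  fixes Y :: "nat \<Rightarrow> 'y set" and d' :: "nat \<Rightarrow> nat \<Rightarrow> 'y \<Rightarrow> 'y" and \<kappa> :: "'y \<Rightarrow> 'a list"
  assumes Y: "delta_set Y d'" and \<kappa>: "delta_map Y d' (bar_simplices S) (bar_face S) \<kappa>"
begin

lemma hd_\<kappa>:
  assumes "y \<in> Y (Suc q)"
  shows "hd (\<kappa> y) \<in> carrier S"
proof -
  have "\<kappa> y \<in> bar_simplices S (Suc q)"
    using \<kappa> assms by (auto simp: delta_map_def)
  then show ?thesis
    by (rule hd_bar_simplices)
qed

text \<open>The essential case of the cocycle condition is i = 0, j = 1, where it combines the
  product rule for first letters with associativity of the action. For i = 0 and j at least 2 the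
  first letters agree, and for positive i both transports are trivial.\<close>

lemma transition_maps_twist: "transition_maps Y d' (realization E dE) (twist \<kappa>)"
  unfolding transition_maps_def
proof (intro conjI allI ballI impI)
  fix q y i assume "y \<in> Y (Suc q)"
  then show "continuous_map (realization E dE) (realization E dE) (twist \<kappa> (Suc q) i y)"
    using continuous_map_act[OF hd_\<kappa>] by (cases "i = 0") (simp_all add: twist_def[abs_def])
next
  fix q y i j v assume y: "y \<in> Y (Suc (Suc q))" and j: "j \<le> Suc (Suc q)" and i: "i < j"
    and v: "v \<in> topspace (realization E dE)"
  have ky: "\<kappa> y \<in> bar_simplices S (Suc (Suc q))"
    "\<kappa> (d' (Suc (Suc q)) l y) = bar_face S (Suc (Suc q)) l (\<kappa> y)" if "l \<le> Suc (Suc q)" for l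
    using \<kappa> y that by (auto simp: delta_map_def)
  have y0: "d' (Suc (Suc q)) 0 y \<in> Y (Suc q)"
    using delta_set_face[where X = Y, OF Y y] by simp
  have i0: "act (hd (\<kappa> (d' (Suc (Suc q)) j y))) v
      = act (hd (\<kappa> y)) (if j = Suc 0 then act (hd (\<kappa> (d' (Suc (Suc q)) 0 y))) v else v)" if "i = 0"
  proof (cases "j = Suc 0")
    case True
    then show ?thesis
      using hd_bar_face(2)[OF ky(1)[OF j] j] act_act[OF hd_\<kappa>[OF y] hd_\<kappa>[OF y0] v] ky(2) by simp
  next
    case False
    then show ?thesis
      using hd_bar_face(1)[OF ky(1)[OF j] j] i ky(2)[OF j] by simp
  qed
  show "twist \<kappa> (Suc (Suc q)) j y (twist \<kappa> (Suc q) i (d' (Suc (Suc q)) j y) v) =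
      twist \<kappa> (Suc (Suc q)) i y (twist \<kappa> (Suc q) (j - 1) (d' (Suc (Suc q)) i y) v)"
  proof (cases "i = 0")
    case True
    then show ?thesis
      using i i0 by (cases "j = Suc 0") (simp_all add: twist_def)
  next
    case False
    then show ?thesis
      using i by (simp add: twist_def)
  qed
qed

lemma invariant_map_pr: "invariant_map Y (realization E dE) (twist \<kappa>) (realization X d) pr"
  unfolding invariant_map_def
  using continuous_map_rmap[OF delta_map_pr] pr_act hd_\<kappa> by (auto simp: pr_def twist_def)

end

end

section \<open>Contractible bar constructions and the comparison with the classifying space\<close>

context monoid
begin

text \<open>The bar construction of a right \<open>G\<close>-set \<open>A\<close> with base point \<open>a\<^sub>0\<close> and an equivariant map
  \<open>\<kappa>: A \<rightarrow> G\<close> such that \<open>a\<^sub>0 \<kappa>(a) = a\<close>; thus \<open>A\<close> is a retract of \<open>G\<close>. Simplices are tagged by \<open>T\<close>.\<close>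

lemma contractible_translation:
  fixes T :: "'a list \<Rightarrow> 'x"
  assumes P: "delta_set P \<delta>" "\<And>q. P q = {(a, T s) |a s. a \<in> A \<and> s \<in> bar_simplices G q}"
    and \<delta>: "\<And>q a s i. a \<in> A \<Longrightarrow> s \<in> bar_simplices G (Suc q) \<Longrightarrow> i \<le> Suc q \<Longrightarrow>
      \<delta> (Suc q) i (a, T s) = (if i = 0 then ra a (hd s) else a, T (bar_face G (Suc q) i s))"
    and T: "inj T"
    and a\<^sub>0: "a\<^sub>0 \<in> A"
    and \<kappa>: "\<And>a. a \<in> A \<Longrightarrow> \<kappa> a \<in> carrier G" "\<And>a. a \<in> A \<Longrightarrow> ra a\<^sub>0 (\<kappa> a) = a"
      "\<And>a b. a \<in> A \<Longrightarrow> b \<in> carrier G \<Longrightarrow> \<kappa> (ra a b) = \<kappa> a \<otimes> b"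
  shows "contractible_space (realization P \<delta>)"
proof -
  \<comment> \<open>The cone starts at the base point and prepends the letter \<kappa>(a), which
    leads from the base point to \<open>a\<close>. Stripping and restoring the tag is the task of
    \<open>inv_into\<close>.\<close>
  define h where "h = (\<lambda>p. (a\<^sub>0, T (\<kappa> (fst p) # inv_into UNIV T (snd p))))"
  have h: "h (a, T s) = (a\<^sub>0, T (\<kappa> a # s))" for a s
    using T by (simp add: h_def)
  have bar: "\<kappa> a # s \<in> bar_simplices G (Suc q)" if "a \<in> A" "s \<in> bar_simplices G q" for a s q
    using that \<kappa>(1) by (auto simp: bar_simplices_def)
  show ?thesis
  proof (rule contractible_extra_degeneracy[OF P(1), where h = h and v = "(a\<^sub>0, T [])"])
    show "(a\<^sub>0, T []) \<in> P 0"
      using a\<^sub>0 by (auto simp: P(2) bar_simplices_def)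
  next
    fix q p assume "p \<in> P q"
    then obtain a s where p: "p = (a, T s)" "a \<in> A" "s \<in> bar_simplices G q"
      by (auto simp: P(2))
    show "h p \<in> P (Suc q)"
      using bar[OF p(2,3)] a\<^sub>0 by (auto simp: p(1) h P(2))
    show "\<delta> (Suc q) 0 (h p) = p"
      using \<delta>[OF a\<^sub>0 bar[OF p(2,3)], of 0] \<kappa>(2)[OF p(2)] by (simp add: p(1) h bar_face_def)
  next
    fix q p i assume "p \<in> P (Suc q)" and i: "i \<le> Suc q"
    then obtain a s where p: "p = (a, T s)" "a \<in> A" "s \<in> bar_simplices G (Suc q)"
      by (auto simp: P(2))
    then obtain b s' where s: "s = b # s'" "length s' = q" "b \<in> carrier G"
      by (cases s) (auto simp: bar_simplices_def)
    \<comment> \<open>Prepending a letter shifts face indices by one. The only new product is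
      \<kappa>(a) b, which by equivariance is the letter prepended to the 0-th face.\<close>
    have "bar_face G (Suc (Suc q)) (Suc i) (\<kappa> a # s) =
        (if i = 0 then (\<kappa> a \<otimes> b) # bar_face G (Suc q) i s else \<kappa> a # bar_face G (Suc q) i s)"
      using i s by (cases i) (auto simp: bar_face_def)
    then show "\<delta> (Suc (Suc q)) (Suc i) (h p) = h (\<delta> (Suc q) i p)"
      using \<delta>[OF a\<^sub>0 bar[OF p(2,3)], of "Suc i"] \<delta>[OF p(2,3) i] i \<kappa>(3)[OF p(2) s(3)] s(1)
      by (simp add: p(1) h)
  next
    fix p assume "p \<in> P 0"
    then obtain a where p: "p = (a, T [])" "a \<in> A"
      by (auto simp: P(2) bar_simplices_def)
    have "[] \<in> bar_simplices G 0"
      by (simp add: bar_simplices_def)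
    then show "\<delta> 1 1 (h p) = (a\<^sub>0, T [])"
      using \<delta>[OF a\<^sub>0 bar[OF p(2)], of "[]" 0 1] by (simp add: p(1) h bar_face_def)
  qed
qed

lemma labelled_delta_set_bar:
  "labelled_delta_set G (bar_simplices G) (bar_face G) (\<lambda>s. s) (\<lambda>_. carrier G)"
  using hd_bar_simplices(2)
  by unfold_locales (auto simp: delta_set_bar intro!: delta_map_subset)

interpretation ES: labelled_delta_set G "bar_simplices G" "bar_face G" "\<lambda>s. s" "\<lambda>_. carrier G"
  by (rule labelled_delta_set_bar)

lemma contractible_ES: "contractible_space (realization ES.E ES.dE)"
  by (rule contractible_translation[OF ES.delta_set_E, where A = "carrier G" and T = "\<lambda>s. s"
        and ra = "(\<otimes>)" and \<kappa> = "\<lambda>a. a" and a\<^sub>0 = \<one>])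
    (auto simp: ES.E_def ES.dE_def)

text \<open>This is an instance of Quillen's Theorem A. The homotopy inverse and the homotopies are projections
  of coherent families in the contractible \<open>G\<close>-spaces, which are unique up to homotopy.\<close>

theorem homotopy_equivalent_classifying_space:
  fixes X :: "nat \<Rightarrow> 'x set" and base :: "'x \<Rightarrow> 'a"
  assumes "labelled_delta_set G X d \<iota> \<Gamma>"
    and contr: "contractible_space (realization (labelled_delta_set.E X \<Gamma>) (labelled_delta_set.dE G d \<iota>))"
    and base: "\<And>q x. x \<in> X q \<Longrightarrow> base x \<in> \<Gamma> x"
      "\<And>q x. x \<in> X (Suc q) \<Longrightarrow> base x \<otimes> hd (\<iota> x) = hd (\<iota> x) \<otimes> base (d (Suc q) 0 x)"
      "\<And>q x i. x \<in> X (Suc q) \<Longrightarrow> 0 < i \<Longrightarrow> i \<le> Suc q \<Longrightarrow> base (d (Suc q) i x) = base x"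
    and ne: "X 0 \<noteq> {}"
  shows "classifying_space G homotopy_equivalent_space realization X d"
proof -
  interpret L: labelled_delta_set G X d \<iota> \<Gamma> by fact
  let ?BG = "realization (bar_simplices G) (bar_face G)" and ?X = "realization X d"
    and ?EX = "realization L.E L.dE" and ?EG = "realization ES.E ES.dE"
  have ne': "topspace ?EX \<noteq> {}"
    using ne base(1) rpt_in_topspace[of _ L.E 0 vertex0] by (fastforce simp: L.E_def)
  have id: "delta_map (bar_simplices G) (bar_face G) (bar_simplices G) (bar_face G) (\<lambda>s. s)"
    by (rule delta_map_subset) simp
  \<comment> \<open>A lift of the simplices of BG to the total space over \<open>X\<close>; its
    projection to \<open>X\<close> will be the homotopy inverse of \<open>h\<close>.\<close>
  obtain c where c: "coherent_maps (bar_simplices G) (bar_face G) ?EX (L.twist (\<lambda>s. s)) c"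
    using coherent_maps_exist[OF delta_set_bar L.transition_maps_twist[OF delta_set_bar id] contr ne'] .
  define f where "f = rlift (\<lambda>q s t. L.pr (c q s t))"
  have compf: "compatible_family (bar_simplices G) (bar_face G) (\<lambda>q s t. L.pr (c q s t))"
    by (rule coherent_maps_compatible[OF delta_set_bar c L.invariant_map_pr[OF delta_set_bar id]])
  have contf: "continuous_map ?BG ?X f"
    unfolding f_def by (rule coherent_maps_continuous_map[OF delta_set_bar c L.invariant_map_pr[OF delta_set_bar id]])
  define h where "h = rmap (bar_simplices G) (bar_face G) \<iota>"
  have conth: "continuous_map ?X ?BG h"
    unfolding h_def by (rule continuous_map_rmap[OF L.\<iota>])

  \<comment> \<open>Over \<open>X\<close> there are two lifts to the same contractible space: the
    restriction of \<open>c\<close> along \<iota>, and the tautological one, which sends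
    \<open>x\<close> to itself with value \<open>base x\<close>. A homotopy between them projects to
    one from \<open>f \<circ> h\<close> to the identity.\<close>
  have c\<^sub>0: "coherent_maps X d ?EX (L.twist \<iota>) (\<lambda>q x. c q (\<iota> x))"
    using coherent_maps_continuous[OF c] coherent_maps_face[OF c] L.\<iota>_in L.\<iota>_face
    by (intro coherent_mapsI) (auto simp: L.twist_def)
  have c\<^sub>1: "coherent_maps X d ?EX (L.twist \<iota>) (\<lambda>q x. rpt L.E L.dE q (base x, x))"
  proof (rule coherent_mapsI)
    show "continuous_map (simplex_topology q) ?EX (rpt L.E L.dE q (base x, x))" if "x \<in> X q" for q x
      using that base(1) by (intro continuous_map_rpt) (auto simp: L.E_def)
    fix q x i t assume x: "x \<in> X (Suc q)" and i: "i \<le> Suc q" and t: "t \<in> standard_simplex q"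
    have "(base x, x) \<in> L.E (Suc q)"
      using x base(1) by (auto simp: L.E_def)
    then have "rpt L.E L.dE (Suc q) (base x, x) (simplical_face i t)
        = rpt L.E L.dE q (L.dE (Suc q) i (base x, x)) t"
      by (rule rpt_face[OF _ i t])
    \<comment> \<open>Moving \<open>base x\<close> on by the first letter gives the same as acting
      with this letter on the base value of the 0-th face; this is the commutation assumed of
      \<open>base\<close>.\<close>
    also have "\<dots> = L.twist \<iota> (Suc q) i x (rpt L.E L.dE q (base (d (Suc q) i x), d (Suc q) i x) t)"
      using base(2)[OF x] base(3)[OF x _ i] L.hd_\<iota>[OF x]
      by (simp add: L.dE_def L.twist_def L.act_rpt)
    finally show "rpt L.E L.dE (Suc q) (base x, x) (simplical_face i t)
        = L.twist \<iota> (Suc q) i x (rpt L.E L.dE q (base (d (Suc q) i x), d (Suc q) i x) t)" .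
  qed
  obtain H where H: "coherent_family {0..1} X d ?EX (L.twist \<iota>) H"
    "\<And>q x t. x \<in> X q \<Longrightarrow> t \<in> standard_simplex q \<Longrightarrow> H q x 0 t = c q (\<iota> x) t"
    "\<And>q x t. x \<in> X q \<Longrightarrow> t \<in> standard_simplex q \<Longrightarrow> H q x 1 t = rpt L.E L.dE q (base x, x) t"
    using coherent_maps_homotopic[OF L.X L.transition_maps_twist[OF L.X L.\<iota>] contr c\<^sub>0 c\<^sub>1, where L = "{}"]
    by auto
  have hom\<^sub>1: "homotopic_with (\<lambda>_. True) ?X ?X (f \<circ> h) id"
  proof (rule coherent_family_homotopic[OF L.X H(1) L.invariant_map_pr[OF L.X L.\<iota>]])
    fix q x t assume "x \<in> X q" "t \<in> standard_simplex q"
    then show "(f \<circ> h) (rpt X d q x t) = L.pr (H q x 0 t)" "id (rpt X d q x t) = L.pr (H q x 1 t)"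
      using H(2,3) by (simp_all add: f_def h_def rmap_rpt[OF L.\<iota>] rlift_rpt[OF compf] L.pr_rpt)
  qed

  \<comment> \<open>Replacing \<open>x\<close> by its word maps the total space over
    \<open>X\<close> equivariantly to the one over BG, so \<open>c\<close> becomes a lift there as
    well. Its homotopy to the tautological lift with value 1 projects to one from
    \<open>h \<circ> f\<close> to the identity.\<close>
  have \<phi>: "delta_map L.E L.dE ES.E ES.dE (\<lambda>(g, x). (g, \<iota> x))"
    using L.\<iota>_in L.\<iota>_face L.\<Gamma>_in_carrier by (auto simp: delta_map_def L.E_def ES.E_def L.dE_def ES.dE_def)
  define \<Phi> where "\<Phi> = rmap ES.E ES.dE (\<lambda>(g, x). (g, \<iota> x))"
  have \<Phi>_rpt: "\<Phi> (rpt L.E L.dE q (g, x) t) = rpt ES.E ES.dE q (g, \<iota> x) t" for q g x t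
    unfolding \<Phi>_def by (simp add: rmap_rpt[OF \<phi>])
  have \<Phi>_act: "\<Phi> (L.act s v) = ES.act s (\<Phi> v)" if "s \<in> carrier G" "v \<in> topspace ?EX" for s v
    using that(2)
  proof (rule realization_cases)
    fix q p t assume "p \<in> L.E q" "v = rpt L.E L.dE q p t"
    then show ?thesis
      using that(1) by (cases p) (simp add: L.act_rpt ES.act_rpt \<Phi>_rpt)
  qed
  have pr_\<Phi>: "ES.pr (\<Phi> v) = h (L.pr v)" if "v \<in> topspace ?EX" for v
    using that
  proof (rule realization_cases)
    fix q p t assume "p \<in> L.E q" "v = rpt L.E L.dE q p t"
    then show ?thesis
      by (cases p) (simp add: L.pr_rpt ES.pr_rpt \<Phi>_rpt h_def rmap_rpt[OF L.\<iota>])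
  qed
  have c\<^sub>2: "coherent_maps (bar_simplices G) (bar_face G) ?EG (ES.twist (\<lambda>s. s)) (\<lambda>q s t. \<Phi> (c q s t))"
  proof (rule coherent_mapsI)
    show "continuous_map (simplex_topology q) ?EG (\<lambda>t. \<Phi> (c q s t))" if "s \<in> bar_simplices G q" for q s
      using continuous_map_compose[OF coherent_maps_continuous[OF c that] continuous_map_rmap[OF \<phi>]]
      by (simp add: \<Phi>_def comp_def)
    fix q s i t assume s: "s \<in> bar_simplices G (Suc q)" and i: "i \<le> Suc q" and t: "t \<in> standard_simplex q"
    have "c q (bar_face G (Suc q) i s) t \<in> topspace ?EX"
      using coherent_maps_in_topspace[OF c bar_face_closed[OF s i] t] .
    then show "\<Phi> (c (Suc q) s (simplical_face i t))
        = ES.twist (\<lambda>s. s) (Suc q) i s (\<Phi> (c q (bar_face G (Suc q) i s) t))"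
      using \<Phi>_act hd_bar_simplices(2)[OF s] coherent_maps_face[OF c s i t]
      by (cases "i = 0") (simp_all add: L.twist_def ES.twist_def)
  qed
  have c\<^sub>3: "coherent_maps (bar_simplices G) (bar_face G) ?EG (ES.twist (\<lambda>s. s)) (\<lambda>q s. rpt ES.E ES.dE q (\<one>, s))"
  proof (rule coherent_mapsI)
    show "continuous_map (simplex_topology q) ?EG (rpt ES.E ES.dE q (\<one>, s))" if "s \<in> bar_simplices G q" for q s
      using that by (intro continuous_map_rpt) (auto simp: ES.E_def)
    fix q s i t assume s: "s \<in> bar_simplices G (Suc q)" and i: "i \<le> Suc q" and t: "t \<in> standard_simplex q"
    have "(\<one>, s) \<in> ES.E (Suc q)"
      using s by (auto simp: ES.E_def)
    then have "rpt ES.E ES.dE (Suc q) (\<one>, s) (simplical_face i t)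
        = rpt ES.E ES.dE q (ES.dE (Suc q) i (\<one>, s)) t"
      by (rule rpt_face[OF _ i t])
    then show "rpt ES.E ES.dE (Suc q) (\<one>, s) (simplical_face i t)
        = ES.twist (\<lambda>s. s) (Suc q) i s (rpt ES.E ES.dE q (\<one>, bar_face G (Suc q) i s) t)"
      using hd_bar_simplices(2)[OF s] by (simp add: ES.dE_def ES.twist_def ES.act_rpt)
  qed
  obtain H' where H': "coherent_family {0..1} (bar_simplices G) (bar_face G) ?EG (ES.twist (\<lambda>s. s)) H'"
    "\<And>q s t. s \<in> bar_simplices G q \<Longrightarrow> t \<in> standard_simplex q \<Longrightarrow> H' q s 0 t = \<Phi> (c q s t)"
    "\<And>q s t. s \<in> bar_simplices G q \<Longrightarrow> t \<in> standard_simplex q \<Longrightarrow> H' q s 1 t = rpt ES.E ES.dE q (\<one>, s) t"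
    using coherent_maps_homotopic[OF delta_set_bar ES.transition_maps_twist[OF delta_set_bar id]
        contractible_ES c\<^sub>2 c\<^sub>3, where L = "{}"] by auto
  have hom\<^sub>2: "homotopic_with (\<lambda>_. True) ?BG ?BG (h \<circ> f) id"
  proof (rule coherent_family_homotopic[OF delta_set_bar H'(1) ES.invariant_map_pr[OF delta_set_bar id]])
    fix q s t assume s: "s \<in> bar_simplices G q" "t \<in> standard_simplex q"
    then have "c q s t \<in> topspace ?EX"
      using coherent_maps_in_topspace[OF c] by blast
    then show "(h \<circ> f) (rpt (bar_simplices G) (bar_face G) q s t) = ES.pr (H' q s 0 t)"
      using H'(2)[OF s] by (simp add: f_def rlift_rpt[OF compf] pr_\<Phi>)
    show "id (rpt (bar_simplices G) (bar_face G) q s t) = ES.pr (H' q s 1 t)"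
      using H'(3)[OF s] by (simp add: ES.pr_rpt)
  qed
  show ?thesis
    unfolding homotopy_equivalent_space_def classifying_space_def
    using contf conth hom\<^sub>1 hom\<^sub>2 by blast
qed

end

section \<open>Joining two Delta-sets by an edge\<close>

definition glift :: "('a \<Rightarrow> 'b) \<Rightarrow> 'a set \<Rightarrow> 'b" where
  "glift f c = f (SOME p. p \<in> c)"

lemma glift_glue_class:
  assumes "\<And>p q. R p q \<Longrightarrow> f p = f q"
  shows "glift f (glue_class R p) = f p"
proof -
  have "f p = f q" if "equivclp R p q" for q
    using that by (induction rule: equivclp_induct) (auto dest: assms)
  moreover have "(SOME q. q \<in> glue_class R p) \<in> glue_class R p"
    by (rule someI[of _ p]) (simp add: glue_class_def)
  ultimately show ?thesis
    by (simp add: glift_def glue_class_def)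
qed

lemma continuous_map_glift:
  assumes "\<And>p q. R p q \<Longrightarrow> f p = f q" "continuous_map X Y f"
  shows "continuous_map (quotient_topology X R) Y (glift f)"
proof (rule continuous_compose_quotient_map[OF quotient_map_glue_class])
  have "glift f \<circ> glue_class R = f"
    by (intro ext) (simp add: glift_glue_class[OF assms(1)])
  then show "continuous_map X Y (glift f \<circ> glue_class R)"
    using assms(2) by simp
qed

lemma continuous_map_unit_interval_glift:
  assumes f: "\<And>u p q. R p q \<Longrightarrow> f u p = f u q"
    and cont: "continuous_map (prod_topology unit_interval X) Y (\<lambda>(u, p). f u p)"
  shows "continuous_map (prod_topology unit_interval (quotient_topology X R)) Y (\<lambda>(u, c). glift (f u) c)"
proof (rule continuous_compose_quotient_map[OF quotient_map_prod_right[OF _ _ quotient_map_glue_class]])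
  show "locally_compact_space unit_interval"
    by (simp add: compact_imp_locally_compact_space compact_space_subtopology)
  show "Hausdorff_space unit_interval \<or> regular_space unit_interval"
    by (simp add: Hausdorff_space_subtopology)
  show "continuous_map (prod_topology unit_interval X) Y
      ((\<lambda>(u, c). glift (f u) c) \<circ> (\<lambda>(x, y). (x, glue_class R y)))"
    using cont by (rule continuous_map_eq) (auto simp: glift_glue_class[OF f])
qed

lemma continuous_map_Inl: "continuous_map X (disjoint_union_topology X Y) Inl"
  by (auto simp: continuous_map_def topspace_disjoint_union_topology openin_disjoint_union_topology
      vimage_def Collect_conj_eq openin_Int)

lemma continuous_map_Inr: "continuous_map Y (disjoint_union_topology X Y) Inr"
  by (auto simp: continuous_map_def topspace_disjoint_union_topology openin_disjoint_union_topology
      vimage_def Collect_conj_eq openin_Int)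

lemma continuous_map_disjoint_union:
  assumes "continuous_map X Z (\<lambda>x. f (Inl x))" "continuous_map Y Z (\<lambda>y. f (Inr y))"
  shows "continuous_map (disjoint_union_topology X Y) Z f"
  unfolding continuous_map_def
proof (intro conjI allI impI)
  show "f \<in> topspace (disjoint_union_topology X Y) \<rightarrow> topspace Z"
    using assms[THEN continuous_map_image_subset_topspace]
    by (auto simp: topspace_disjoint_union_topology)
  fix U assume U: "openin Z U"
  let ?V = "{p \<in> topspace (disjoint_union_topology X Y). f p \<in> U}"
  have "Inl -` ?V = {x \<in> topspace X. f (Inl x) \<in> U}" "Inr -` ?V = {y \<in> topspace Y. f (Inr y) \<in> U}"
    by (auto simp: topspace_disjoint_union_topology)
  then show "openin (disjoint_union_topology X Y) ?V"
    using assms[THEN openin_continuous_map_preimage, OF U] by (simp add: openin_disjoint_union_topology)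
qed

lemma continuous_map_prod_disjoint_union:
  assumes "continuous_map (prod_topology Z X) Y (\<lambda>(z, x). f (z, Inl x))"
    and "continuous_map (prod_topology Z X') Y (\<lambda>(z, x). f (z, Inr x))"
  shows "continuous_map (prod_topology Z (disjoint_union_topology X X')) Y f"
proof -
  let ?D = "disjoint_union_topology X X'"
  define T where "T = (\<lambda>b::bool. if b then Inl ` topspace X else Inr ` topspace X')"
  have vimages: "Inl -` T True = topspace X" "Inr -` T True = {}" "Inl -` T False = {}" "Inr -` T False = topspace X'"
    by (auto simp: T_def)
  then have open_T: "openin ?D (T b)" for b
    by (cases b) (simp_all add: openin_disjoint_union_topology)
  have projl: "continuous_map (subtopology ?D (T True)) X projl"
    unfolding continuous_map_def
  proof (intro conjI allI impI)
    fix U assume U: "openin X U"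
    let ?V = "{p \<in> topspace (subtopology ?D (T True)). projl p \<in> U}"
    have "Inl -` ?V = U" "Inr -` ?V = {}"
      using openin_subset[OF U] by (auto simp: T_def topspace_disjoint_union_topology)
    then have "openin ?D ?V"
      using U by (simp only: openin_disjoint_union_topology openin_empty simp_thms)
    then show "openin (subtopology ?D (T True)) ?V"
      unfolding openin_open_subtopology[OF open_T] by auto
  qed (auto simp: T_def topspace_disjoint_union_topology)
  have projr: "continuous_map (subtopology ?D (T False)) X' projr"
    unfolding continuous_map_def
  proof (intro conjI allI impI)
    fix U assume U: "openin X' U"
    let ?V = "{p \<in> topspace (subtopology ?D (T False)). projr p \<in> U}"
    have "Inr -` ?V = U" "Inl -` ?V = {}"
      using openin_subset[OF U] by (auto simp: T_def topspace_disjoint_union_topology)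
    then have "openin ?D ?V"
      using U by (simp only: openin_disjoint_union_topology openin_empty simp_thms)
    then show "openin (subtopology ?D (T False)) ?V"
      unfolding openin_open_subtopology[OF open_T] by auto
  qed (auto simp: T_def topspace_disjoint_union_topology)
  show ?thesis
  proof (rule pasting_lemma[where I = UNIV and T = "\<lambda>b. topspace Z \<times> T b" and f = "\<lambda>_. f"])
    show "openin (prod_topology Z ?D) (topspace Z \<times> T b)" for b
      by (simp add: openin_prod_Times_iff open_T)
    show "continuous_map (subtopology (prod_topology Z ?D) (topspace Z \<times> T b)) Y f" for b
    proof -
      have eq: "subtopology (prod_topology Z ?D) (topspace Z \<times> T b) = prod_topology Z (subtopology ?D (T b))"
        by (simp add: prod_topology_subtopology subtopology_topspace subtopology_restrict)
      show ?thesis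
      proof (cases b)
        case True
        have "continuous_map (prod_topology Z (subtopology ?D (T True))) (prod_topology Z X) (\<lambda>p. (fst p, projl (snd p)))"
          by (intro continuous_map_pairedI continuous_map_fst continuous_map_compose[OF continuous_map_snd projl, unfolded comp_def])
        from continuous_map_compose[OF this assms(1)]
        have "continuous_map (prod_topology Z (subtopology ?D (T True))) Y f"
          by (rule continuous_map_eq) (auto simp: T_def)
        then show ?thesis
          using True eq by simp
      next
        case False
        have "continuous_map (prod_topology Z (subtopology ?D (T False))) (prod_topology Z X') (\<lambda>p. (fst p, projr (snd p)))"
          by (intro continuous_map_pairedI continuous_map_fst continuous_map_compose[OF continuous_map_snd projr, unfolded comp_def])
        from continuous_map_compose[OF this assms(2)]
        have "continuous_map (prod_topology Z (subtopology ?D (T False))) Y f"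
          by (rule continuous_map_eq) (auto simp: T_def)
        then show ?thesis
          using False eq by simp
      qed
    qed
    fix p assume "p \<in> topspace (prod_topology Z ?D)"
    then show "\<exists>b. b \<in> UNIV \<and> p \<in> topspace Z \<times> T b \<and> f p = f p"
      by (auto simp: T_def topspace_disjoint_union_topology mem_Times_iff elim!: PlusE
          intro: exI[of _ True] exI[of _ False])
  qed auto
qed

section \<open>The bridged Delta-set and the wedge sum\<close>

datatype ('a, 'b) bridged = Left 'a | Right 'b | Bridge

definition bridged_simplices ::
  "(nat \<Rightarrow> 'a set) \<Rightarrow> (nat \<Rightarrow> 'b set) \<Rightarrow> nat \<Rightarrow> ('a, 'b) bridged set" where
  "bridged_simplices X Y q = Left ` X q \<union> Right ` Y q \<union> (if q = 1 then {Bridge} else {})"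

text \<open>The edge \<open>Bridge\<close> goes from the vertex \<open>b\<close> of the second Delta-set to the vertex \<open>a\<close> of the first.\<close>

definition bridged_face ::
  "(nat \<Rightarrow> nat \<Rightarrow> 'a \<Rightarrow> 'a) \<Rightarrow> (nat \<Rightarrow> nat \<Rightarrow> 'b \<Rightarrow> 'b) \<Rightarrow> 'a \<Rightarrow> 'b \<Rightarrow>
   nat \<Rightarrow> nat \<Rightarrow> ('a, 'b) bridged \<Rightarrow> ('a, 'b) bridged" where
  "bridged_face dX dY a b q i z =
     (case z of Left x \<Rightarrow> Left (dX q i x) | Right y \<Rightarrow> Right (dY q i y)
        | Bridge \<Rightarrow> if i = 0 then Left a else Right b)"

lemma bridged_cases:
  assumes "z \<in> bridged_simplices X Y q"
  obtains x where "z = Left x" "x \<in> X q" | y where "z = Right y" "y \<in> Y q" | "z = Bridge" "q = 1"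
  using assms by (auto simp: bridged_simplices_def split: if_splits)

lemma delta_set_bridged:
  assumes "delta_set X dX" "delta_set Y dY" "a \<in> X 0" "b \<in> Y 0"
  shows "delta_set (bridged_simplices X Y) (bridged_face dX dY a b)"
  unfolding delta_set_def
proof (intro conjI allI ballI impI)
  fix q z i assume "z \<in> bridged_simplices X Y (Suc q)" "i \<le> Suc q"
  then show "bridged_face dX dY a b (Suc q) i z \<in> bridged_simplices X Y q"
    using assms by (auto simp: bridged_simplices_def bridged_face_def delta_set_def split: if_splits)
next
  fix q z j i assume "z \<in> bridged_simplices X Y (Suc (Suc q))" "j \<le> Suc (Suc q)" "i < j"
  then show "bridged_face dX dY a b (Suc q) i (bridged_face dX dY a b (Suc (Suc q)) j z)
      = bridged_face dX dY a b (Suc q) (j - 1) (bridged_face dX dY a b (Suc (Suc q)) i z)"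
    using delta_set_face_face[where X = X, OF assms(1)] delta_set_face_face[where X = Y, OF assms(2)]
    by (auto simp: bridged_simplices_def bridged_face_def)
qed

text \<open>One map collapses the bridge. A map back must send both base points to the same point,
  so the inclusion of \<open>Y\<close> is first deformed: the vertex \<open>b\<close> is dragged
  along the bridge to \<open>a\<close>, and homotopy extension carries the rest of \<open>Y\<close>
  along.\<close>

theorem homotopy_equivalent_bridged_wedge:
  fixes X :: "nat \<Rightarrow> 'a set" and Y :: "nat \<Rightarrow> 'b set"
  assumes X: "delta_set X dX" "a \<in> X 0" and Y: "delta_set Y dY" "b \<in> Y 0"
  shows "realization (bridged_simplices X Y) (bridged_face dX dY a b) homotopy_equivalent_space
    wedge_sum (realization X dX) (rpt X dX 0 a vertex0) (realization Y dY) (rpt Y dY 0 b vertex0)"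
proof -
  let ?Z = "bridged_simplices X Y" and ?dZ = "bridged_face dX dY a b"
  let ?RX = "realization X dX" and ?RY = "realization Y dY" and ?RZ = "realization ?Z ?dZ"
  let ?A = "rpt X dX 0 a vertex0" and ?B = "rpt Y dY 0 b vertex0"
  define R :: "(nat \<times> 'a \<times> (nat \<Rightarrow> real)) set + (nat \<times> 'b \<times> (nat \<Rightarrow> real)) set \<Rightarrow>
      (nat \<times> 'a \<times> (nat \<Rightarrow> real)) set + (nat \<times> 'b \<times> (nat \<Rightarrow> real)) set \<Rightarrow> bool"
    where "R = (\<lambda>p q. p = Inl ?A \<and> q = Inr ?B)"
  let ?D = "disjoint_union_topology ?RX ?RY"
  define W where "W = wedge_sum ?RX ?A ?RY ?B"
  have W: "W = quotient_topology ?D R"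
    by (simp add: W_def wedge_sum_def R_def)
  define cl where "cl = glue_class R"
  have contcl: "continuous_map ?D W cl"
    unfolding W cl_def by (rule quotient_imp_continuous_map[OF quotient_map_glue_class])
  have cl_eq: "cl (Inl ?A) = cl (Inr ?B)"
  proof -
    have "R (Inl ?A) (Inr ?B)"
      by (simp add: R_def)
    then have "equivclp R (Inl ?A) = equivclp R (Inr ?B)"
      by (intro ext) (meson equivclp_sym equivclp_trans r_into_equivclp)
    then show ?thesis
      by (simp add: cl_def glue_class_def)
  qed
  have A: "?A \<in> topspace ?RX"
    using X(2) by (intro rpt_in_topspace) auto
  have Bridge: "Bridge \<in> ?Z 1"
    by (simp add: bridged_simplices_def)
  have end_0: "rpt ?Z ?dZ 1 Bridge (edge_point 1 0) = rpt ?Z ?dZ 0 (Left a) vertex0"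
    using rpt_face[of Bridge ?Z 0 0 vertex0 ?dZ] Bridge by (simp add: edge_point_0 bridged_face_def)
  have end_1: "rpt ?Z ?dZ 1 Bridge (edge_point 1 1) = rpt ?Z ?dZ 0 (Right b) vertex0"
    using rpt_face[of Bridge ?Z 0 1 vertex0 ?dZ] Bridge by (simp add: edge_point_1 bridged_face_def)

  define \<kappa> where "\<kappa> = (\<lambda>q z t. case z of Left x \<Rightarrow> cl (Inl (rpt X dX q x t))
     | Right y \<Rightarrow> cl (Inr (rpt Y dY q y t)) | Bridge \<Rightarrow> cl (Inl ?A))"
  have comp\<kappa>: "compatible_family ?Z ?dZ \<kappa>"
  proof (rule compatible_familyI)
    fix q z i t assume z: "z \<in> ?Z (Suc q)" and i: "i \<le> Suc q" and t: "t \<in> standard_simplex q"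
    from z show "\<kappa> (Suc q) z (simplical_face i t) = \<kappa> q (?dZ (Suc q) i z) t"
    proof (cases rule: bridged_cases)
      case (1 x)
      then show ?thesis
        using rpt_face[where X = X, OF 1(2) i t] by (simp add: \<kappa>_def bridged_face_def)
    next
      case (2 y)
      then show ?thesis
        using rpt_face[where X = Y, OF 2(2) i t] by (simp add: \<kappa>_def bridged_face_def)
    next
      case 3
      then show ?thesis
        using t cl_eq by (simp add: \<kappa>_def bridged_face_def standard_simplex_0)
    qed
  qed
  define k where "k = rlift \<kappa>"
  have k_rpt: "k (rpt ?Z ?dZ q z t) = \<kappa> q z t" for q z t
    unfolding k_def by (rule rlift_rpt[OF comp\<kappa>])
  have contk: "continuous_map ?RZ W k"
    unfolding k_def
  proof (rule continuous_map_realization[OF comp\<kappa>])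
    fix q z assume "z \<in> ?Z q"
    then show "continuous_map (simplex_topology q) W (\<kappa> q z)"
    proof (cases rule: bridged_cases)
      case (1 x)
      then show ?thesis
        using continuous_map_compose[OF continuous_map_compose[OF continuous_map_rpt[where X = X, OF 1(2)] continuous_map_Inl] contcl]
        by (simp add: \<kappa>_def[abs_def] comp_def)
    next
      case (2 y)
      then show ?thesis
        using continuous_map_compose[OF continuous_map_compose[OF continuous_map_rpt[where X = Y, OF 2(2)] continuous_map_Inr] contcl]
        by (simp add: \<kappa>_def[abs_def] comp_def)
    next
      case 3
      have "cl (Inl ?A) \<in> topspace W"
        using continuous_map_image_subset_topspace[OF contcl] A
        by (auto simp: topspace_disjoint_union_topology)
      then show ?thesis
        using 3 by (simp add: \<kappa>_def[abs_def])
    qed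
  qed

  have Left: "delta_map X dX ?Z ?dZ Left"
    by (auto simp: delta_map_def bridged_simplices_def bridged_face_def)
  have Right: "delta_map Y dY ?Z ?dZ Right"
    by (auto simp: delta_map_def bridged_simplices_def bridged_face_def)
  have b0: "coherent_family {0} Y dY ?RZ trivial_transition (\<lambda>q y u t. rpt ?Z ?dZ q (Right y) t)"
    using delta_map_compatible[OF Right] Right
    by (intro coherent_family_finite coherent_maps_trivial continuous_map_rpt) (auto simp: delta_map_def)
  \<comment> \<open>The bridge has vertex 0 at \<open>b\<close> and vertex 1 at \<open>a\<close>.
    Weight 1 - u at vertex 0 gives the path from \<open>b\<close> to \<open>a\<close>.\<close>
  have bridge_cont: "continuous_map unit_interval ?RZ (\<lambda>u. rpt ?Z ?dZ 1 Bridge (edge_point 1 (1 - u)))"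
    by (intro continuous_map_edge_point Bridge continuous_map_diff) auto
  obtain G where G: "coherent_family {0..1} Y dY ?RZ trivial_transition G"
    "\<And>q y t. y \<in> Y q \<Longrightarrow> t \<in> standard_simplex q \<Longrightarrow> G q y 0 t = rpt ?Z ?dZ q (Right y) t"
    "\<And>u. u \<in> {0..1} \<Longrightarrow> G 0 b u vertex0 = rpt ?Z ?dZ 1 Bridge (edge_point 1 (1 - u))"
  proof (rule coherent_family_extension[OF Y(1) transition_maps_trivial prism_extension_homotopy _ _ b0,
        where L = "{b}" and l = "\<lambda>_ u. rpt ?Z ?dZ 1 Bridge (edge_point 1 (1 - u))"])
    show "rpt ?Z ?dZ 0 (Right y) t = rpt ?Z ?dZ 1 Bridge (edge_point 1 (1 - u))"
      if "y \<in> {b}" "u \<in> {0}" "t \<in> standard_simplex 0" for y u t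
      using that end_1 by (simp add: standard_simplex_0)
    fix G assume "coherent_family {0..1} Y dY ?RZ trivial_transition G"
      "\<And>q y u t. y \<in> Y q \<Longrightarrow> u \<in> {0} \<Longrightarrow> t \<in> standard_simplex q \<Longrightarrow> G q y u t = rpt ?Z ?dZ q (Right y) t"
      "\<And>y u t. y \<in> {b} \<Longrightarrow> y \<in> Y 0 \<Longrightarrow> u \<in> {0..1} \<Longrightarrow> t \<in> standard_simplex 0 \<Longrightarrow>
         G 0 y u t = rpt ?Z ?dZ 1 Bridge (edge_point 1 (1 - u))"
    then show thesis
      using Y(2) by (intro that[of G]) auto
  qed (use bridge_cont in auto)
  have compG: "compatible_family Y dY (\<lambda>q y t. G q y u t)" if "u \<in> {0..1}" for u
    using coherent_maps_compatible[OF Y(1) coherent_family_slice[OF G(1) that], of ?RZ id]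
    by simp
  define g where "g = (\<lambda>u. rlift (\<lambda>q y t. G q y u t))"
  have g_rpt: "g u (rpt Y dY q y t) = G q y u t" if "u \<in> {0..1}" for u q y t
    unfolding g_def by (rule rlift_rpt[OF compG[OF that]])
  have contg: "continuous_map (prod_topology unit_interval ?RY) ?RZ (\<lambda>(u, p). g u p)"
    unfolding g_def
    by (rule continuous_map_unit_interval_realization[OF compG coherent_family_continuous[OF G(1)]])
  have contg1: "continuous_map ?RY ?RZ (g 1)"
    using continuous_map_o_Pair[OF contg, of 1] by (simp add: comp_def)

  \<comment> \<open>At time 1 the deformed inclusion of \<open>Y\<close> sends \<open>b\<close> to
    \<open>a\<close>, so the two maps respect the gluing.\<close>
  define j\<^sub>0 where "j\<^sub>0 = case_sum (rmap ?Z ?dZ Left) (g 1)"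
  have j\<^sub>0_R: "j\<^sub>0 p = j\<^sub>0 q" if "R p q" for p q
    using that G(3)[of 1] end_0 by (auto simp: R_def j\<^sub>0_def rmap_rpt[OF Left] g_rpt)
  define j where "j = glift j\<^sub>0"
  have j_cl: "j (cl p) = j\<^sub>0 p" for p
    unfolding j_def cl_def by (rule glift_glue_class[OF j\<^sub>0_R])
  have contj: "continuous_map W ?RZ j"
    unfolding W j_def
    by (intro continuous_map_glift j\<^sub>0_R continuous_map_disjoint_union)
      (simp_all add: j\<^sub>0_def continuous_map_rmap[OF Left] contg1)

  \<comment> \<open>The bridge shrinks towards \<open>a\<close> at the speed at which
    \<open>G\<close> drags \<open>b\<close> along it, so the homotopies match at
    \<open>b\<close>.\<close>
  define F where "F = (\<lambda>u q z t. case z of Left x \<Rightarrow> rpt ?Z ?dZ q z t | Right y \<Rightarrow> G q y u t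
     | Bridge \<Rightarrow> rpt ?Z ?dZ 1 Bridge (edge_point 1 ((1 - u) * t 0)))"
  have hom\<^sub>1: "homotopic_with (\<lambda>_. True) ?RZ ?RZ id (j \<circ> k)"
  proof (rule homotopic_with_realization[where F = F])
    fix u :: real assume u: "u \<in> {0..1}"
    show "compatible_family ?Z ?dZ (F u)"
    proof (rule compatible_familyI)
      fix q z i t assume z: "z \<in> ?Z (Suc q)" and i: "i \<le> Suc q" and t: "t \<in> standard_simplex q"
      from z show "F u (Suc q) z (simplical_face i t) = F u q (?dZ (Suc q) i z) t"
      proof (cases rule: bridged_cases)
        case (1 x)
        then show ?thesis
          using rpt_face[where X = ?Z, OF z i t] by (simp add: F_def bridged_face_def)
      next
        case (2 y)
        then show ?thesis
          using compatible_familyD[where X = Y, OF compG[OF u] 2(2) i t] by (simp add: F_def bridged_face_def)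
      next
        case 3
        then have q: "q = 0" and t0: "t = vertex0"
          using t by (auto simp: standard_simplex_0)
        show ?thesis
        proof (cases "i = 0")
          case True
          then show ?thesis
            using 3 q t0 end_0 by (simp add: F_def bridged_face_def)
        next
          case False
          then have "simplical_face i vertex0 0 = (1::real)"
            by (simp add: simplical_face_def)
          then show ?thesis
            using False 3 q t0 G(3)[OF u] by (simp add: F_def bridged_face_def)
        qed
      qed
    qed
  next
    fix q z assume z: "z \<in> ?Z q"
    then show "continuous_map (prism {0..1} q) ?RZ (\<lambda>(u, t). F u q z t)"
    proof (cases rule: bridged_cases)
      case (1 x)
      then show ?thesis
        using continuous_map_compose[OF continuous_map_snd continuous_map_rpt[where X = ?Z, OF z]]
        by (auto simp: F_def comp_def case_prod_unfold)
    next
      case (2 y)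
      then show ?thesis
        using coherent_family_continuous[where X = Y, OF G(1) 2(2)] by (simp add: F_def)
    next
      case 3
      have "continuous_map (prism {0..1} q) euclideanreal fst"
        by (rule continuous_map_into_fulltopology[OF continuous_map_fst])
      moreover have "continuous_map (prism {0..1} q) euclideanreal (\<lambda>p. snd p 0)"
        using continuous_map_compose[OF continuous_map_snd continuous_map_simplex_coordinate]
        by (auto simp: comp_def)
      ultimately have "continuous_map (prism {0..1} q) ?RZ
          (\<lambda>p. rpt ?Z ?dZ 1 Bridge (edge_point 1 ((1 - fst p) * snd p 0)))"
        by (intro continuous_map_edge_point Bridge continuous_intros)
          (auto simp: standard_simplex_def mult_le_one)
      then show ?thesis
        using 3 by (simp add: F_def case_prod_unfold)
    qed
  next
    fix q z t assume z: "z \<in> ?Z q" and t: "t \<in> standard_simplex q"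
    from z show "id (rpt ?Z ?dZ q z t) = F 0 q z t"
    proof (cases rule: bridged_cases)
      case 3
      then show ?thesis
        using t edge_point_coordinate[of 1 t] by (simp add: F_def)
    qed (use G(2) t in \<open>simp_all add: F_def\<close>)
    from z show "(j \<circ> k) (rpt ?Z ?dZ q z t) = F 1 q z t"
      by (cases rule: bridged_cases)
        (use end_0 in \<open>simp_all add: k_rpt \<kappa>_def j_cl j\<^sub>0_def rmap_rpt[OF Left] g_rpt F_def\<close>)
  qed

  \<comment> \<open>The collapse turns the path along the bridge into a constant one, so this
    respects the gluing. The value chosen for u outside the unit interval extends this to all u, as
    \<open>continuous_map_unit_interval_glift\<close> demands.\<close>
  define H\<^sub>0 where "H\<^sub>0 = (\<lambda>u p. case p of Inl x \<Rightarrow> cl (Inl x) | Inr y \<Rightarrow> if u \<in> {0..1} then k (g u y) else cl (Inl ?A))"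
  have H\<^sub>0_R: "H\<^sub>0 u p = H\<^sub>0 u q" if "R p q" for u p q
    using that G(3)[of u] by (auto simp: R_def H\<^sub>0_def g_rpt k_rpt \<kappa>_def)
  have contH: "continuous_map (prod_topology unit_interval W) W (\<lambda>(u, c). glift (H\<^sub>0 u) c)"
    unfolding W
  proof (rule continuous_map_unit_interval_glift[OF H\<^sub>0_R])
    show "continuous_map (prod_topology unit_interval ?D) (quotient_topology ?D R) (\<lambda>(u, p). H\<^sub>0 u p)"
      unfolding W[symmetric]
    proof (rule continuous_map_prod_disjoint_union)
      have "continuous_map (prod_topology unit_interval ?RX) W (\<lambda>p. cl (Inl (snd p)))"
        using continuous_map_compose[OF continuous_map_compose[OF continuous_map_snd continuous_map_Inl] contcl]
        by (simp add: comp_def)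
      then show "continuous_map (prod_topology unit_interval ?RX) W (\<lambda>(u, x). case (u, Inl x) of (u, p) \<Rightarrow> H\<^sub>0 u p)"
        by (simp add: H\<^sub>0_def case_prod_unfold)
      show "continuous_map (prod_topology unit_interval ?RY) W (\<lambda>(u, y). case (u, Inr y) of (u, p) \<Rightarrow> H\<^sub>0 u p)"
        using continuous_map_compose[OF contg contk] by (rule continuous_map_eq) (auto simp: H\<^sub>0_def)
    qed
  qed
  have hom\<^sub>2: "homotopic_with (\<lambda>_. True) W W id (k \<circ> j)"
  proof -
    have "glift (H\<^sub>0 0) c = c \<and> glift (H\<^sub>0 1) c = k (j c)" if c: "c \<in> topspace W" for c
    proof -
      obtain p where p: "p \<in> topspace ?D" "c = cl p"
        using c by (auto simp: W topspace_quotient_topology cl_def)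
      have H: "glift (H\<^sub>0 u) (cl p) = H\<^sub>0 u p" for u
        unfolding cl_def by (rule glift_glue_class[OF H\<^sub>0_R])
      show ?thesis
      proof (cases p)
        case (Inl x)
        then have "x \<in> topspace ?RX"
          using p(1) by (auto simp: topspace_disjoint_union_topology)
        then obtain q y t where "x = rpt X dX q y t"
          by (rule realization_cases)
        then show ?thesis
          unfolding p(2) H by (simp add: Inl H\<^sub>0_def j_cl j\<^sub>0_def rmap_rpt[OF Left] k_rpt \<kappa>_def)
      next
        case (Inr x)
        then have "x \<in> topspace ?RY"
          using p(1) by (auto simp: topspace_disjoint_union_topology)
        then obtain q y t where "y \<in> Y q" "t \<in> standard_simplex q" "x = rpt Y dY q y t"
          by (rule realization_cases)
        then show ?thesis
          using G(2) unfolding p(2) H by (simp add: Inr H\<^sub>0_def j_cl j\<^sub>0_def g_rpt k_rpt \<kappa>_def)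
      qed
    qed
    then show ?thesis
      using contH by (subst homotopic_with) (auto intro!: exI[where x = "\<lambda>(u, c). glift (H\<^sub>0 u) c"])
  qed
  show ?thesis
    unfolding homotopy_equivalent_space_def W_def[symmetric]
    using contk contj homotopic_with_symD[OF hom\<^sub>1] homotopic_with_symD[OF hom\<^sub>2] by blast
qed

section \<open>Rectangular bands as minimal ideals\<close>

text \<open>Faces involve products alone, so a homomorphism of semigroups suffices. The application
  to b -> (e, b) depends on this.\<close>

lemma bar_face_map:
  assumes s: "s \<in> bar_simplices A (Suc q)" and i: "i \<le> Suc q"
    and h: "\<And>x y. x \<in> carrier A \<Longrightarrow> y \<in> carrier A \<Longrightarrow> h (x \<otimes>\<^bsub>A\<^esub> y) = h x \<otimes>\<^bsub>B\<^esub> h y"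
  shows "bar_face B (Suc q) i (map h s) = map h (bar_face A (Suc q) i s)"
proof (rule nth_equalityI)
  have len: "length s = Suc q"
    using s by (simp add: bar_simplices_def)
  then show "length (bar_face B (Suc q) i (map h s)) = length (map h (bar_face A (Suc q) i s))"
    using i by (simp add: length_bar_face)
  fix k assume "k < length (bar_face B (Suc q) i (map h s))"
  then have k: "k < q"
    using i len by (simp add: length_bar_face)
  show "bar_face B (Suc q) i (map h s) ! k = map h (bar_face A (Suc q) i s) ! k"
    using i len k bar_simplices_nth[OF s] by (simp add: bar_face_nth length_bar_face h)
qed

locale band_amalgam = M: monoid M + N: monoid N
  for M :: "('a, 'm) monoid_scheme" and N :: "('b, 'n) monoid_scheme" +
  fixes K :: "'a set" and e :: 'a
  assumes ideal: "semigroup_ideal M K" and band: "rectangular_band (M\<lparr>carrier := K\<rparr>)" and e: "e \<in> K"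
begin

lemma K_carrier: "k \<in> K \<Longrightarrow> k \<in> carrier M"
  and K_left: "m \<in> carrier M \<Longrightarrow> k \<in> K \<Longrightarrow> m \<otimes>\<^bsub>M\<^esub> k \<in> K"
  and K_right: "m \<in> carrier M \<Longrightarrow> k \<in> K \<Longrightarrow> k \<otimes>\<^bsub>M\<^esub> m \<in> K"
  using ideal by (auto simp: semigroup_ideal_def)

lemma e_carrier [simp]: "e \<in> carrier M"
  using K_carrier e .

lemma K_idem: "k \<in> K \<Longrightarrow> k \<otimes>\<^bsub>M\<^esub> k = k"
  and K_absorb: "k \<in> K \<Longrightarrow> l \<in> K \<Longrightarrow> k \<otimes>\<^bsub>M\<^esub> l \<otimes>\<^bsub>M\<^esub> k = k"
  using band by (auto simp: rectangular_band_def)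

text \<open>Writing l = l k l puts m inside k (m l) k, which the rectangular identity collapses to k
  because m l lies in the ideal.\<close>

lemma K_middle:
  assumes "k \<in> K" "m \<in> carrier M" "l \<in> K"
  shows "k \<otimes>\<^bsub>M\<^esub> m \<otimes>\<^bsub>M\<^esub> l = k \<otimes>\<^bsub>M\<^esub> l"
proof -
  have [simp]: "k \<in> carrier M" "l \<in> carrier M" "m \<in> carrier M"
    using assms K_carrier by auto
  have "k \<otimes>\<^bsub>M\<^esub> m \<otimes>\<^bsub>M\<^esub> l = k \<otimes>\<^bsub>M\<^esub> m \<otimes>\<^bsub>M\<^esub> (l \<otimes>\<^bsub>M\<^esub> k \<otimes>\<^bsub>M\<^esub> l)"
    using K_absorb[OF assms(3,1)] by simp
  also have "\<dots> = (k \<otimes>\<^bsub>M\<^esub> (m \<otimes>\<^bsub>M\<^esub> l) \<otimes>\<^bsub>M\<^esub> k) \<otimes>\<^bsub>M\<^esub> l"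
    by (simp add: M.m_assoc)
  also have "k \<otimes>\<^bsub>M\<^esub> (m \<otimes>\<^bsub>M\<^esub> l) \<otimes>\<^bsub>M\<^esub> k = k"
    using assms K_left by (intro K_absorb) auto
  finally show ?thesis .
qed

section \<open>The monoid S and its minimal ideal\<close>

definition S :: "('a \<times> 'b) monoid" where
  "S = (M \<times>\<times> N)\<lparr>carrier := (carrier M \<times> {\<one>\<^bsub>N\<^esub>}) \<union> (K \<times> carrier N)\<rparr>"

lemma S_carrier_iff [simp]:
  "s \<in> carrier S \<longleftrightarrow> fst s \<in> carrier M \<and> snd s \<in> carrier N \<and> (fst s \<in> K \<or> snd s = \<one>\<^bsub>N\<^esub>)"
  using K_carrier by (cases s) (auto simp: S_def)

lemma mult_S [simp]: "s \<otimes>\<^bsub>S\<^esub> t = (fst s \<otimes>\<^bsub>M\<^esub> fst t, snd s \<otimes>\<^bsub>N\<^esub> snd t)"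
  by (cases s; cases t) (simp add: S_def)

lemma one_S [simp]: "\<one>\<^bsub>S\<^esub> = (\<one>\<^bsub>M\<^esub>, \<one>\<^bsub>N\<^esub>)"
  by (simp add: S_def)

lemma monoid_S: "monoid S"
proof -
  have "submonoid (carrier M \<times> {\<one>\<^bsub>N\<^esub>} \<union> K \<times> carrier N) (M \<times>\<times> N)"
    by (rule submonoid_DirProd_ideal[OF M.monoid_axioms N.monoid_axioms ideal])
  then show ?thesis
    unfolding S_def by (rule submonoid.submonoid_is_monoid) (rule DirProd_monoid[OF M.monoid_axioms N.monoid_axioms])
qed

sublocale S: monoid S
  by (rule monoid_S)

lemma minimal_ideal_S:
  assumes "minimal_ideal N J"
  shows "minimal_ideal S (K \<times> J)"
proof -
  have J: "J \<noteq> {}" "\<And>j. j \<in> J \<Longrightarrow> j \<in> carrier N"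
    "\<And>n j. n \<in> carrier N \<Longrightarrow> j \<in> J \<Longrightarrow> n \<otimes>\<^bsub>N\<^esub> j \<in> J \<and> j \<otimes>\<^bsub>N\<^esub> n \<in> J"
    using assms by (auto simp: minimal_ideal_def semigroup_ideal_def)
  have "semigroup_ideal S (K \<times> J)"
    using J e K_carrier K_left K_right unfolding semigroup_ideal_def by auto
  moreover have "K \<times> J \<subseteq> I" if "semigroup_ideal S I" for I
  proof -
    have I: "I \<subseteq> carrier S" "I \<noteq> {}" "\<And>s x. s \<in> carrier S \<Longrightarrow> x \<in> I \<Longrightarrow> s \<otimes>\<^bsub>S\<^esub> x \<in> I \<and> x \<otimes>\<^bsub>S\<^esub> s \<in> I"
      using that by (auto simp: semigroup_ideal_def)
    \<comment> \<open>The elements n for which all of K x {n} lies in I. If this is an ideal of N,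
      then it contains J, and I contains K x J.\<close>
    define I\<^sub>N where "I\<^sub>N = {n \<in> carrier N. \<forall>k\<in>K. (k, n) \<in> I}"
    obtain a n where an: "(a, n) \<in> I"
      using I(2) by auto
    then have an': "a \<in> carrier M" "n \<in> carrier N"
      using I(1) K_carrier by auto
    have "(k, n) \<in> I" if k: "k \<in> K" for k
    proof -
      \<comment> \<open>The product is (k a k, n), and k a k = k k = k.\<close>
      have "(k, \<one>\<^bsub>N\<^esub>) \<otimes>\<^bsub>S\<^esub> (a, n) \<otimes>\<^bsub>S\<^esub> (k, \<one>\<^bsub>N\<^esub>) \<in> I"
        using I(3) an k by (auto simp: K_carrier)
      then show ?thesis
        using an' K_middle[OF k an'(1) k] K_idem[OF k] by simp
    qed
    then have "n \<in> I\<^sub>N"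
      using an' by (simp add: I\<^sub>N_def)
    moreover have "p \<otimes>\<^bsub>N\<^esub> m \<in> I\<^sub>N \<and> m \<otimes>\<^bsub>N\<^esub> p \<in> I\<^sub>N" if p: "p \<in> carrier N" and m: "m \<in> I\<^sub>N" for p m
    proof -
      have "(k, p) \<otimes>\<^bsub>S\<^esub> (k, m) \<in> I \<and> (k, m) \<otimes>\<^bsub>S\<^esub> (k, p) \<in> I" if "k \<in> K" for k
        using I(3)[of "(k, p)" "(k, m)"] that p m K_carrier[OF that] by (auto simp: I\<^sub>N_def)
      then show ?thesis
        using p m K_idem by (auto simp: I\<^sub>N_def)
    qed
    ultimately have "semigroup_ideal N I\<^sub>N"
      by (auto simp: semigroup_ideal_def I\<^sub>N_def)
    then have "J \<subseteq> I\<^sub>N"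
      using assms by (simp add: minimal_ideal_def)
    then show ?thesis
      by (auto simp: I\<^sub>N_def)
  qed
  ultimately show ?thesis
    by (simp add: minimal_ideal_def)
qed

text \<open>The model of the wedge sum: the classifying spaces of \<open>M\<close> and \<open>N\<close>, joined by an edge labelled
  by the idempotent \<open>f = (e, 1)\<close>. Both \<open>N\<close>-simplices and the edge begin at the vertex of \<open>N\<close>, which
  corresponds to the left ideal \<open>Sf\<close>.\<close>

abbreviation "f \<equiv> (e, \<one>\<^bsub>N\<^esub>)"

abbreviation "WX \<equiv> bridged_simplices (bar_simplices M) (bar_simplices N)"

abbreviation "Wd \<equiv> bridged_face (bar_face M) (bar_face N) [] []"

definition word :: "('a list, 'b list) bridged \<Rightarrow> ('a \<times> 'b) list" where
  "word z = (case z of Left s \<Rightarrow> map (\<lambda>a. (a, \<one>\<^bsub>N\<^esub>)) s | Right s \<Rightarrow> map (\<lambda>b. (e, b)) s | Bridge \<Rightarrow> [f])"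

text \<open>As f is idempotent, Sf consists of the s with s f = s, a condition on the first
  coordinate alone.\<close>

definition initial_set :: "('a list, 'b list) bridged \<Rightarrow> ('a \<times> 'b) set" where
  "initial_set z = (case z of Left s \<Rightarrow> carrier S | _ \<Rightarrow> {s \<in> carrier S. fst s \<otimes>\<^bsub>M\<^esub> e = fst s})"

lemma delta_set_WX: "delta_set WX Wd"
  by (rule delta_set_bridged[OF M.delta_set_bar N.delta_set_bar]) (auto simp: bar_simplices_def)

lemma delta_map_word: "delta_map WX Wd (bar_simplices S) (bar_face S) word"
  unfolding delta_map_def
proof (intro conjI allI ballI impI)
  fix q z assume "z \<in> WX q"
  then show "word z \<in> bar_simplices S q"
    by (cases rule: bridged_cases)
      (auto simp: word_def bar_simplices_def e)
next
  fix q z i assume z: "z \<in> WX (Suc q)" and i: "i \<le> Suc q"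
  from z show "word (Wd (Suc q) i z) = bar_face S (Suc q) i (word z)"
  proof (cases rule: bridged_cases)
    case (1 s)
    then show ?thesis
      using bar_face_map[OF 1(2) i, of "\<lambda>a. (a, \<one>\<^bsub>N\<^esub>)" S] by (simp add: word_def bridged_face_def)
  next
    case (2 s)
    then show ?thesis
      using bar_face_map[OF 2(2) i, of "\<lambda>b. (e, b)" S] K_idem[OF e] by (simp add: word_def bridged_face_def)
  next
    case 3
    then show ?thesis
      using i by (auto simp: word_def bridged_face_def bar_face_def)
  qed
qed

lemma hd_word:
  assumes "z \<in> WX (Suc q)"
  shows "hd (word z) = (case z of Left s \<Rightarrow> (hd s, \<one>\<^bsub>N\<^esub>) | Right s \<Rightarrow> (e, hd s) | Bridge \<Rightarrow> f)"
  using assms by (cases rule: bridged_cases) (auto simp: word_def bar_simplices_def intro: hd_map)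

sublocale L: labelled_delta_set S WX Wd word initial_set
proof unfold_locales
  fix z q g assume z: "z \<in> WX (Suc q)" and g: "g \<in> initial_set z"
  from z show "g \<otimes>\<^bsub>S\<^esub> hd (word z) \<in> initial_set (Wd (Suc q) 0 z)"
  proof (cases rule: bridged_cases)
    case (1 s)
    then show ?thesis
      using g hd_word[OF z] hd_bar_simplices(2)[OF 1(2)] K_right
      by (auto simp: initial_set_def bridged_face_def)
  next
    case (2 s)
    \<comment> \<open>First coordinates of elements of Sf lie in K, so the second coordinate may
      become any element of N.\<close>
    then have "fst g \<in> K"
      using g K_left[OF _ e, of "fst g"] by (auto simp: initial_set_def)
    then show ?thesis
      using 2 g hd_word[OF z] hd_bar_simplices(2)[OF 2(2)] K_idem[OF e]
      by (auto simp: initial_set_def bridged_face_def M.m_assoc)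
  next
    case 3
    then show ?thesis
      using g hd_word[OF z] K_left[OF _ e]
      by (auto simp: initial_set_def bridged_face_def)
  qed
next
  show "g \<in> initial_set (Wd (Suc q) i z)"
    if "z \<in> WX (Suc q)" "g \<in> initial_set z" "0 < i" "i \<le> Suc q" for z q g i
    using that by (auto simp: initial_set_def bridged_face_def split: bridged.splits)
  show "s \<otimes>\<^bsub>S\<^esub> g \<in> initial_set z" if "z \<in> WX q" "s \<in> carrier S" "g \<in> initial_set z" for z q s g
  proof -
    have "g \<in> carrier S"
      using that(3) by (auto simp: initial_set_def split: bridged.splits)
    then have "s \<otimes>\<^bsub>S\<^esub> g \<in> carrier S"
      using S.m_closed[OF that(2)] by blast
    moreover have "fst s \<in> carrier M" "fst g \<in> carrier M"
      using that(2) \<open>g \<in> carrier S\<close> by simp_all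
    ultimately show ?thesis
      using that(3) by (auto simp: initial_set_def M.m_assoc split: bridged.splits)
  qed
qed (auto simp: delta_set_WX delta_map_word initial_set_def split: bridged.splits)

text \<open>The product with the identity of N remains unsimplified because \<open>g\<close> is an
  arbitrary pair; the right action passed to \<open>contractible_translation\<close> has the same
  form.\<close>

lemma dE_Left:
  assumes "s \<in> bar_simplices M (Suc q)"
  shows "L.dE (Suc q) i (g, Left s) =
    (if i = 0 then (fst g \<otimes>\<^bsub>M\<^esub> hd s, snd g \<otimes>\<^bsub>N\<^esub> \<one>\<^bsub>N\<^esub>) else g, Left (bar_face M (Suc q) i s))"
proof -
  have "Left s \<in> WX (Suc q)"
    using assms by (auto simp: bridged_simplices_def)
  from hd_word[OF this] show ?thesis
    by (simp add: L.dE_def bridged_face_def)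
qed

lemma dE_Right:
  assumes "s \<in> bar_simplices N (Suc q)"
  shows "L.dE (Suc q) i (g, Right s) =
    (if i = 0 then (fst g \<otimes>\<^bsub>M\<^esub> e, snd g \<otimes>\<^bsub>N\<^esub> hd s) else g, Right (bar_face N (Suc q) i s))"
proof -
  have "Right s \<in> WX (Suc q)"
    using assms by (auto simp: bridged_simplices_def)
  from hd_word[OF this] show ?thesis
    by (simp add: L.dE_def bridged_face_def)
qed

lemma dE_Bridge:
  "L.dE 1 i (g, Bridge) = (if i = 0 then ((fst g \<otimes>\<^bsub>M\<^esub> e, snd g \<otimes>\<^bsub>N\<^esub> \<one>\<^bsub>N\<^esub>), Left []) else (g, Right []))"
  by (simp add: L.dE_def bridged_face_def word_def)

section \<open>Decomposition of the total space into pieces\<close>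

definition Ke :: "'a set" where
  "Ke = {k \<in> K. k \<otimes>\<^bsub>M\<^esub> e = k}"

lemma KeD: "x \<in> Ke \<Longrightarrow> x \<in> K" "x \<in> Ke \<Longrightarrow> x \<in> carrier M" "x \<in> Ke \<Longrightarrow> x \<otimes>\<^bsub>M\<^esub> e = x"
  using K_carrier by (auto simp: Ke_def)

lemma mult_e_Ke: "a \<in> K \<Longrightarrow> a \<otimes>\<^bsub>M\<^esub> e \<in> Ke"
  using K_carrier K_left[OF _ e] K_idem[OF e] by (simp add: Ke_def M.m_assoc)

text \<open>An element fixed by right multiplication with e lies in K, as K is an ideal. Hence the
  values over the vertex of BN are exactly Ke x N.\<close>

lemma mult_e_Ke_iff: "a \<in> carrier M \<Longrightarrow> a \<otimes>\<^bsub>M\<^esub> e = a \<longleftrightarrow> a \<in> Ke"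
  using K_left[OF _ e, of a] by (auto simp: Ke_def)

text \<open>The simplices of the total space, sorted by pieces. The vertices of \<open>pieces_M\<close> over \<open>(x, n)\<close> form
  the right \<open>M\<close>-set \<open>{(a, n). a e = x}\<close>, those of \<open>pieces_N\<close> over \<open>x\<close> the free \<open>N\<close>-set \<open>{x} \<times> N\<close>. The graph
  of pieces is a tree: \<open>piece_1\<close> is joined to the pieces of \<open>pieces_N\<close>, and each of these to its own
  pieces of \<open>pieces_M\<close>.\<close>

definition "piece_1 q = {(g, Left s) |g s. g \<in> carrier M \<times> {\<one>\<^bsub>N\<^esub>} \<and> s \<in> bar_simplices M q}"
definition "pieces_N q = {(g, Right s) |g s. g \<in> Ke \<times> carrier N \<and> s \<in> bar_simplices N q}"
definition "pieces_M q = {(g, Left s) |g s. g \<in> K \<times> (carrier N - {\<one>\<^bsub>N\<^esub>}) \<and> s \<in> bar_simplices M q}"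
definition "bridges_1 = {(g, Bridge :: ('a list, 'b list) bridged) |g. g \<in> Ke \<times> {\<one>\<^bsub>N\<^esub>}}"
definition "bridges_M = {(g, Bridge :: ('a list, 'b list) bridged) |g. g \<in> Ke \<times> (carrier N - {\<one>\<^bsub>N\<^esub>})}"
definition "stage_1 q = piece_1 q \<union> pieces_N q \<union> (if q = 1 then bridges_1 else {})"

lemmas piece_defs = piece_1_def pieces_N_def pieces_M_def bridges_1_def bridges_M_def

text \<open>As a right M-set, S is the disjoint union of M x {1} and K x (N - {1}), with K x {1}
  counted in the first part. The bridges over Ke x N are sorted by the same distinction.\<close>

lemma E_eq: "L.E q = stage_1 q \<union> pieces_M q \<union> (if q = 1 then bridges_M else {})"
proof (rule Set.set_eqI)
  fix p :: "('a \<times> 'b) \<times> ('a list, 'b list) bridged"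
  obtain g z where p: "p = (g, z)"
    by (cases p)
  obtain a n where g: "g = (a, n)"
    by (cases g)
  show "p \<in> L.E q \<longleftrightarrow> p \<in> stage_1 q \<union> pieces_M q \<union> (if q = 1 then bridges_M else {})"
    using K_carrier mult_e_Ke_iff[of a] KeD[of a]
    by (cases z) (auto simp: p g L.E_def stage_1_def piece_defs bridged_simplices_def initial_set_def)
qed

lemma piece_1_face: "p \<in> piece_1 (Suc q) \<Longrightarrow> i \<le> Suc q \<Longrightarrow> L.dE (Suc q) i p \<in> piece_1 q"
  using hd_bar_simplices(2)[of _ M q] M.bar_face_closed[of _ q i] by (auto simp: piece_1_def dE_Left)

lemma pieces_N_face: "p \<in> pieces_N (Suc q) \<Longrightarrow> i \<le> Suc q \<Longrightarrow> L.dE (Suc q) i p \<in> pieces_N q"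
  using hd_bar_simplices(2)[of _ N q] N.bar_face_closed[of _ q i] by (auto simp: pieces_N_def dE_Right KeD(3))

lemma pieces_M_face: "p \<in> pieces_M (Suc q) \<Longrightarrow> i \<le> Suc q \<Longrightarrow> L.dE (Suc q) i p \<in> pieces_M q"
  using hd_bar_simplices(2)[of _ M q] M.bar_face_closed[of _ q i] K_right by (auto simp: pieces_M_def dE_Left)

lemma Nil_bar [simp]: "[] \<in> bar_simplices A q \<longleftrightarrow> q = 0"
  by (auto simp: bar_simplices_def)

lemma stage_1_face:
  assumes "p \<in> stage_1 (Suc q)" "i \<le> Suc q"
  shows "L.dE (Suc q) i p \<in> stage_1 q"
proof -
  consider "p \<in> piece_1 (Suc q)" | "p \<in> pieces_N (Suc q)" | "q = 0" "p \<in> bridges_1"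
    using assms(1) by (auto simp: stage_1_def split: if_splits)
  then show ?thesis
  proof cases
    case 3
    then show ?thesis
      using dE_Bridge[of i] KeD by (cases "i = 0") (auto simp: stage_1_def piece_defs)
  qed (use piece_1_face pieces_N_face assms(2) in \<open>auto simp: stage_1_def\<close>)
qed

lemma delta_set_stage_1: "delta_set stage_1 L.dE"
  by (rule delta_set_subset[OF L.delta_set_E]) (use stage_1_face in \<open>auto simp: E_eq\<close>)

lemma inj_Left [simp]: "inj Left" and inj_Right [simp]: "inj Right"
  by (simp_all add: inj_def)

lemma contractible_piece_1: "contractible_space (realization piece_1 L.dE)"
proof (rule M.contractible_translation[where A = "carrier M \<times> {\<one>\<^bsub>N\<^esub>}" and T = Left and \<kappa> = fst
      and a\<^sub>0 = "(\<one>\<^bsub>M\<^esub>, \<one>\<^bsub>N\<^esub>)" and ra = "\<lambda>g b. (fst g \<otimes>\<^bsub>M\<^esub> b, snd g \<otimes>\<^bsub>N\<^esub> \<one>\<^bsub>N\<^esub>)"])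
  show "delta_set piece_1 L.dE"
    by (rule delta_set_subset[OF L.delta_set_E]) (use piece_1_face in \<open>auto simp: E_eq stage_1_def\<close>)
qed (auto simp: piece_1_def dE_Left)

text \<open>Right multiplication by (e, b) fixes the first coordinate, as x e = x, so the vertices
  form a copy of N under right translation.\<close>

lemma contractible_pieces_N:
  assumes x: "x \<in> Ke"
  shows "contractible_space (realization (\<lambda>q. {p \<in> pieces_N q. fst (fst p) = x}) L.dE)"
proof (rule N.contractible_translation[where A = "{x} \<times> carrier N" and T = Right and \<kappa> = snd
      and a\<^sub>0 = "(x, \<one>\<^bsub>N\<^esub>)" and ra = "\<lambda>g b. (fst g \<otimes>\<^bsub>M\<^esub> e, snd g \<otimes>\<^bsub>N\<^esub> b)"])
  have "fst (fst (L.dE (Suc q) i p)) = x" if "p \<in> pieces_N (Suc q)" "fst (fst p) = x" for q i p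
    using that KeD(3)[OF x] by (auto simp: pieces_N_def dE_Right)
  then show "delta_set (\<lambda>q. {p \<in> pieces_N q. fst (fst p) = x}) L.dE"
    by (intro delta_set_subset[OF L.delta_set_E]) (use pieces_N_face in \<open>auto simp: E_eq stage_1_def\<close>)
qed (use x KeD(3)[OF x] in \<open>auto simp: pieces_N_def dE_Right\<close>)

text \<open>The label a e survives the right action of M, so it is constant on each piece.\<close>

lemma pieces_M_label:
  assumes "a \<in> K" "m \<in> carrier M"
  shows "a \<otimes>\<^bsub>M\<^esub> m \<otimes>\<^bsub>M\<^esub> e = a \<otimes>\<^bsub>M\<^esub> e"
  by (rule K_middle[OF assms e])

text \<open>If a e = x, then x (e a) = a e a = a. So a -> e a is an equivariant map to M, and (x, n)
  serves as the base point from which e a leads to a.\<close>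

lemma contractible_pieces_M:
  assumes x: "x \<in> Ke" and n: "n \<in> carrier N" "n \<noteq> \<one>\<^bsub>N\<^esub>"
  shows "contractible_space (realization (\<lambda>q. {p \<in> pieces_M q. (fst (fst p) \<otimes>\<^bsub>M\<^esub> e, snd (fst p)) = (x, n)}) L.dE)"
proof (rule M.contractible_translation[where A = "{a \<in> K. a \<otimes>\<^bsub>M\<^esub> e = x} \<times> {n}" and T = Left
      and \<kappa> = "\<lambda>g. e \<otimes>\<^bsub>M\<^esub> fst g" and a\<^sub>0 = "(x, n)" and ra = "\<lambda>g b. (fst g \<otimes>\<^bsub>M\<^esub> b, snd g \<otimes>\<^bsub>N\<^esub> \<one>\<^bsub>N\<^esub>)"])
  have "(fst (fst (L.dE (Suc q) i p)) \<otimes>\<^bsub>M\<^esub> e, snd (fst (L.dE (Suc q) i p))) = (x, n)"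
    if "p \<in> pieces_M (Suc q)" "(fst (fst p) \<otimes>\<^bsub>M\<^esub> e, snd (fst p)) = (x, n)" for q i p
    using that n(1) hd_bar_simplices(2)[of _ M q] pieces_M_label by (auto simp: pieces_M_def dE_Left)
  then show "delta_set (\<lambda>q. {p \<in> pieces_M q. (fst (fst p) \<otimes>\<^bsub>M\<^esub> e, snd (fst p)) = (x, n)}) L.dE"
    by (intro delta_set_subset[OF L.delta_set_E]) (use pieces_M_face in \<open>auto simp: E_eq\<close>)
  show "(fst (x, n) \<otimes>\<^bsub>M\<^esub> (e \<otimes>\<^bsub>M\<^esub> fst g), snd (x, n) \<otimes>\<^bsub>N\<^esub> \<one>\<^bsub>N\<^esub>) = g"
    if g: "g \<in> {a \<in> K. a \<otimes>\<^bsub>M\<^esub> e = x} \<times> {n}" for g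
  proof -
    obtain a where a: "g = (a, n)" "a \<in> K" "a \<otimes>\<^bsub>M\<^esub> e = x"
      using g by auto
    have "x \<otimes>\<^bsub>M\<^esub> (e \<otimes>\<^bsub>M\<^esub> a) = x \<otimes>\<^bsub>M\<^esub> e \<otimes>\<^bsub>M\<^esub> a"
      using KeD(2)[OF x] K_carrier[OF a(2)] by (simp add: M.m_assoc)
    also have "\<dots> = a \<otimes>\<^bsub>M\<^esub> e \<otimes>\<^bsub>M\<^esub> a"
      using KeD(3)[OF x] a(3) by simp
    also have "\<dots> = a"
      by (rule K_absorb[OF a(2) e])
    finally show ?thesis
      using n(1) a(1) by simp
  qed
qed (use x n KeD K_carrier in \<open>auto simp: pieces_M_def dE_Left M.m_assoc\<close>)

text \<open>The bridge (x, 1) leads from the piece {x} x N to the vertex (x, 1) of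
  \<open>piece_1\<close>, and x labels both bridge and piece. The new pieces lie at the initial ends
  of the bridges, hence the face index 1.\<close>

lemma contractible_stage_1: "contractible_space (realization stage_1 L.dE)"
proof (rule contractible_bridges[OF delta_set_stage_1, where k = 1 and R = piece_1 and P = pieces_N
      and B = bridges_1 and lab = "\<lambda>p. fst (fst p)" and \<beta> = "\<lambda>x. ((x, \<one>\<^bsub>N\<^esub>), Bridge)"])
  show "fst (fst (L.dE (Suc q) i p)) = fst (fst p)" if "p \<in> pieces_N (Suc q)" "i \<le> Suc q" for q p i
    using that KeD(3) by (auto simp: pieces_N_def dE_Right)
  show "L.dE 1 1 p \<in> pieces_N 0" "fst (fst (L.dE 1 1 p)) = fst (fst p)" "L.dE 1 (1 - 1) p \<in> piece_1 0"
    if "p \<in> bridges_1" for p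
    using that dE_Bridge[of 1] dE_Bridge[of 0] KeD by (auto simp: piece_defs)
  show "contractible_space (realization (\<lambda>q. {x \<in> pieces_N q. fst (fst x) = fst (fst p)}) L.dE)"
    if "p \<in> bridges_1" for p
    using that by (intro contractible_pieces_N) (auto simp: bridges_1_def)
qed (auto simp: stage_1_def contractible_piece_1 piece_1_face pieces_N_face,
    auto simp: piece_defs)

text \<open>For n other than 1 the bridge (x, n) starts in the part already contracted and ends in
  the piece of all (a, n) with a e = x. The new pieces lie at the terminal ends, hence the face
  index 0.\<close>

lemma contractible_E: "contractible_space (realization L.E L.dE)"
proof (rule contractible_bridges[OF L.delta_set_E, where k = 0 and R = stage_1 and P = pieces_M
      and B = bridges_M and lab = "\<lambda>p. (fst (fst p) \<otimes>\<^bsub>M\<^esub> e, snd (fst p))" and \<beta> = "\<lambda>g. (g, Bridge)"])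
  show "(fst (fst (L.dE (Suc q) i p)) \<otimes>\<^bsub>M\<^esub> e, snd (fst (L.dE (Suc q) i p))) = (fst (fst p) \<otimes>\<^bsub>M\<^esub> e, snd (fst p))"
    if "p \<in> pieces_M (Suc q)" "i \<le> Suc q" for q p i
    using that hd_bar_simplices(2)[of _ M q] pieces_M_label by (auto simp: pieces_M_def dE_Left)
  show "((fst (fst p) \<otimes>\<^bsub>M\<^esub> e, snd (fst p)), Bridge) \<in> bridges_M" if "p \<in> pieces_M q" for p q
    using that mult_e_Ke by (auto simp: piece_defs)
  show "(fst (fst ((fst (fst p) \<otimes>\<^bsub>M\<^esub> e, snd (fst p)), Bridge)) \<otimes>\<^bsub>M\<^esub> e,
      snd (fst ((fst (fst p) \<otimes>\<^bsub>M\<^esub> e, snd (fst p)), Bridge))) = (fst (fst p) \<otimes>\<^bsub>M\<^esub> e, snd (fst p))"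
    if "p \<in> pieces_M q" for p q
    using that mult_e_Ke KeD(3) by (auto simp: piece_defs)
  show "L.dE 1 0 p \<in> pieces_M 0"
    "(fst (fst (L.dE 1 0 p)) \<otimes>\<^bsub>M\<^esub> e, snd (fst (L.dE 1 0 p))) = (fst (fst p) \<otimes>\<^bsub>M\<^esub> e, snd (fst p))"
    "L.dE 1 (1 - 0) p \<in> stage_1 0" "((fst (fst p) \<otimes>\<^bsub>M\<^esub> e, snd (fst p)), Bridge) = p"
    if "p \<in> bridges_M" for p
    using that dE_Bridge[of 1] dE_Bridge[of 0] KeD by (auto simp: stage_1_def piece_defs)
  show "contractible_space (realization (\<lambda>q. {x \<in> pieces_M q.
      (fst (fst x) \<otimes>\<^bsub>M\<^esub> e, snd (fst x)) = (fst (fst p) \<otimes>\<^bsub>M\<^esub> e, snd (fst p))}) L.dE)"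
    if "p \<in> bridges_M" for p
    using that KeD(3) by (intro contractible_pieces_M) (auto simp: bridges_M_def)
  show "stage_1 q \<inter> pieces_M q = {}" "stage_1 1 \<inter> bridges_M = {}" "pieces_M 1 \<inter> bridges_M = {}" for q
    by (auto simp: stage_1_def piece_defs split: if_splits)
qed (auto simp: E_eq contractible_stage_1 stage_1_face pieces_M_face)

theorem classifying_space_S:
  "classifying_space S homotopy_equivalent_space
     wedge_sum (classifying_space M) (classifying_vertex M) (classifying_space N) (classifying_vertex N)"
proof -
  \<comment> \<open>The identity of S over the vertex of BM and f, which acts as an identity on the
    words from N, over that of BN. On the bridge the commutation condition reads f f = f 1.\<close>
  define base where "base = (\<lambda>z. case z of Left (s :: 'a list) \<Rightarrow> (\<one>\<^bsub>M\<^esub>, \<one>\<^bsub>N\<^esub>) | (_ :: ('a list, 'b list) bridged) \<Rightarrow> f)"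
  have "classifying_space S homotopy_equivalent_space realization WX Wd"
  proof (rule S.homotopy_equivalent_classifying_space[OF L.labelled_delta_set_axioms contractible_E, where base = base])
    show "base z \<in> initial_set z" for z
      using e K_idem[OF e] by (auto simp: base_def initial_set_def split: bridged.splits)
    fix q z assume z: "z \<in> WX (Suc q)"
    from z show "base z \<otimes>\<^bsub>S\<^esub> hd (word z) = hd (word z) \<otimes>\<^bsub>S\<^esub> base (Wd (Suc q) 0 z)"
    proof (cases rule: bridged_cases)
      case (1 s)
      then show ?thesis
        using hd_word[OF z] hd_bar_simplices(2)[OF 1(2)] by (simp add: base_def bridged_face_def)
    next
      case (2 s)
      then show ?thesis
        using hd_word[OF z] hd_bar_simplices(2)[OF 2(2)] by (simp add: base_def bridged_face_def)
    next
      case 3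
      then show ?thesis
        using hd_word[OF z] K_idem[OF e] by (simp add: base_def bridged_face_def)
    qed
    show "base (Wd (Suc q) i z) = base z" if "0 < i" "i \<le> Suc q" for i
      using that by (auto simp: base_def bridged_face_def split: bridged.splits)
  next
    show "WX 0 \<noteq> {}"
      by (auto simp: bridged_simplices_def bar_simplices_def)
  qed
  also have "realization WX Wd homotopy_equivalent_space
      wedge_sum (classifying_space M) (classifying_vertex M) (classifying_space N) (classifying_vertex N)"
    using homotopy_equivalent_bridged_wedge[OF M.delta_set_bar _ N.delta_set_bar, of "[]" "[]"]
    by (simp add: classifying_space_def classifying_vertex_def rpt_def)
  finally show ?thesis .
qed

end

theorem theorem3p1:
  fixes M :: "('a, 'm) monoid_scheme" and N :: "('b, 'n) monoid_scheme"
    and K :: "'a set" and S :: "('a \<times> 'b) monoid"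
  assumes "monoid M" and "monoid N"
    and "minimal_ideal M K" and "rectangular_band (M\<lparr>carrier := K\<rparr>)"
    and "S = (M \<times>\<times> N)\<lparr>carrier := (carrier M \<times> {\<one>\<^bsub>N\<^esub>}) \<union> (K \<times> carrier N)\<rparr>"
  shows "classifying_space S homotopy_equivalent_space
           wedge_sum (classifying_space M) (classifying_vertex M)
                     (classifying_space N) (classifying_vertex N)
         \<and> (\<forall>J. minimal_ideal N J \<longrightarrow> minimal_ideal S (K \<times> J))
         \<and> (finite (carrier M) \<and> finite (carrier N) \<longrightarrow> finite (carrier S))"
proof -
  have K: "semigroup_ideal M K"
    using assms(3) by (simp add: minimal_ideal_def)
  \<comment> \<open>Any element of K can serve as the idempotent e.\<close>
  then obtain e where "e \<in> K"
    by (auto simp: semigroup_ideal_def)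
  then interpret band_amalgam M N K e
    using assms(1,2,4) K by (intro band_amalgam.intro band_amalgam_axioms.intro)
  have S_eq: "S = band_amalgam.S M N K"
    using assms(5) by (simp add: S_def)
  have "finite K" if "finite (carrier M)"
    using that K finite_subset by (auto simp: semigroup_ideal_def)
  then show ?thesis
    using classifying_space_S minimal_ideal_S assms(5) by (auto simp: S_eq)
qed

end
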